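(* Let $n\geq 2$ be an integer and let $\mathcal{A}$ be a von Neumann algebra with no central summands of type $I_1$, with center $\mathcal{Z}_{\mathcal{A}}$. Let $\varphi:\mathcal{A}\to\mathcal{A}$ be a nonlinear Lie $n$-derivation. Then there exist an additive derivation $d:\mathcal{A}\to\mathcal{A}$ and a mapping $f:\mathcal{A}\to\mathcal{Z}_{\mathcal{A}}$ such that $\varphi=d+f$ and $f(p_n(x_1,x_2,\dots,x_n))=0$ for all $x_1,\dots,x_n\in\mathcal{A}$.
   Context: A von Neumann algebra $\mathcal{A}$ has no central summands of type $I_1$ if it has no nonzero abelian direct summand, i.e. there is no nonzero central projection $E\in\mathcal{A}$ such that $E\mathcal{A}$ is commutative. The commutator is $[x,y]=xy-yx$. Define recursively $p_1(x_1)=x_1$ and $p_k(x_1,\dots,x_k)=[p_{k-1}(x_1,\dots,x_{k-1}),x_k]$ for $k\geq 2$; the element $p_n(x_1,\dots,x_n)$ is called an $(n-1)$-th commutator. A mapping $\varphi:\mathcal{A}\to\mathcal{A}$ (not assumed to be additive, linear or continuous) is a nonlinear Lie $n$-derivation if $$\varphi(p_n(x_1,\dots,x_n))=\sum_{i=1}^n p_n(x_1,\dots,x_{i-1},\varphi(x_i),x_{i+1},\dots,x_n)$$ for all $x_1,\dots,x_n\in\mathcal{A}$. An additive derivation of $\mathcal{A}$ is an additive (not necessarily linear) mapping $d:\mathcal{A}\to\mathcal{A}$ with $d(xy)=d(x)y+xd(y)$ for all $x,y\in\mathcal{A}$. *)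

theory Defs
  imports "HOL-Analysis.Analysis"
begin

subsection \<open>Complex Hilbert spaces\<close>

text \<open>The inner product is linear in its first argument. Positive definiteness is contained in
  \<open>cinner_self\<close>, since the norm of \<^class>\<open>banach\<close> is nonnegative and vanishes only at 0. The
  zero space is not excluded.\<close>

class complex_hilbert = banach +
  fixes scaleC :: "complex \<Rightarrow> 'a \<Rightarrow> 'a"  (infixr \<open>*\<^sub>C\<close> 75)
    and cinner :: "'a \<Rightarrow> 'a \<Rightarrow> complex"
  assumes scaleC_add_right: "a *\<^sub>C (x + y) = a *\<^sub>C x + a *\<^sub>C y"
    and scaleC_add_left: "(a + b) *\<^sub>C x = a *\<^sub>C x + b *\<^sub>C x"
    and scaleC_scaleC: "a *\<^sub>C (b *\<^sub>C x) = (a * b) *\<^sub>C x"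
    and scaleR_scaleC: "r *\<^sub>R x = complex_of_real r *\<^sub>C x"
    and cinner_add_left: "cinner (x + y) z = cinner x z + cinner y z"
    and cinner_scaleC_left: "cinner (a *\<^sub>C x) y = a * cinner x y"
    and cinner_commute: "cinner y x = cnj (cinner x y)"
    and cinner_self: "cinner x x = complex_of_real ((norm x)\<^sup>2)"

subsection \<open>The ring of bounded complex-linear operators\<close>

typedef (overloaded) ('h::complex_hilbert) bounded_op =
    "{T :: 'h \<Rightarrow> 'h. bounded_linear T \<and> (\<forall>c x. T (c *\<^sub>C x) = c *\<^sub>C T x)}"
  morphisms op_apply Bounded_Op
proof
  show "(\<lambda>x. x) \<in> {T :: 'h \<Rightarrow> 'h. bounded_linear T \<and> (\<forall>c x. T (c *\<^sub>C x) = c *\<^sub>C T x)}"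
    by (simp add: bounded_linear_ident)
qed

setup_lifting type_definition_bounded_op

lemma scaleC_zero_right: "c *\<^sub>C (0::'h::complex_hilbert) = 0"
  using scaleC_add_right[of c "0::'h" 0] by simp

lemma scaleC_minus_right: "c *\<^sub>C (- x) = - (c *\<^sub>C (x::'h::complex_hilbert))"
  using scaleC_add_right[of c x "- x"] by (simp add: scaleC_zero_right eq_neg_iff_add_eq_0 add.commute)

lemma scaleC_diff_right: "c *\<^sub>C (x - y) = c *\<^sub>C x - c *\<^sub>C (y::'h::complex_hilbert)"
  using scaleC_add_right[of c x "- y"] by (simp add: scaleC_minus_right)

text \<open>Multiplication is composition. There is no \<^class>\<open>ring_1\<close> instance because \<open>0 = 1\<close> on the
  zero space.\<close>

instantiation bounded_op :: (complex_hilbert) "{ring, monoid_mult}"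
begin

lift_definition zero_bounded_op :: "'a bounded_op" is "\<lambda>x. 0"
  by (simp add: scaleC_zero_right)

lift_definition one_bounded_op :: "'a bounded_op" is "\<lambda>x. x"
  by (simp add: bounded_linear_ident)

lift_definition plus_bounded_op :: "'a bounded_op \<Rightarrow> 'a bounded_op \<Rightarrow> 'a bounded_op"
  is "\<lambda>S T x. S x + T x"
  by (simp add: bounded_linear_add scaleC_add_right)

lift_definition minus_bounded_op :: "'a bounded_op \<Rightarrow> 'a bounded_op \<Rightarrow> 'a bounded_op"
  is "\<lambda>S T x. S x - T x"
  by (simp add: bounded_linear_sub scaleC_diff_right)

lift_definition uminus_bounded_op :: "'a bounded_op \<Rightarrow> 'a bounded_op"
  is "\<lambda>T x. - T x"
  by (simp add: bounded_linear_minus scaleC_minus_right)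

lift_definition times_bounded_op :: "'a bounded_op \<Rightarrow> 'a bounded_op \<Rightarrow> 'a bounded_op"
  is "\<lambda>S T x. S (T x)"
  by (simp add: bounded_linear_compose)

instance
proof
  fix a b c :: "'a bounded_op"
  show "a + b + c = a + (b + c)" by transfer (simp add: add.assoc)
  show "a + b = b + a" by transfer (simp add: add.commute)
  show "0 + a = a" by transfer simp
  show "- a + a = 0" by transfer simp
  show "a - b = a + - b" by transfer simp
  show "a * b * c = a * (b * c)" by transfer simp
  show "(a + b) * c = a * c + b * c" by transfer simp
  show "a * (b + c) = a * b + a * c"
    by transfer (simp add: bounded_linear.linear linear_add)
  show "1 * a = a" by transfer simp
  show "a * 1 = a" by transfer simp
qed

end

subsection \<open>Von Neumann algebras\<close>

text \<open>\<open>is_adjoint S T\<close> means that S is the adjoint of T; such an S is unique.\<close>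

definition is_adjoint :: "'h::complex_hilbert bounded_op \<Rightarrow> 'h bounded_op \<Rightarrow> bool" where
  "is_adjoint S T \<longleftrightarrow> (\<forall>x y. cinner (op_apply S x) y = cinner x (op_apply T y))"

definition is_projection :: "'h::complex_hilbert bounded_op \<Rightarrow> bool" where
  "is_projection P \<longleftrightarrow> P * P = P \<and> is_adjoint P P"

definition commutant :: "'h::complex_hilbert bounded_op set \<Rightarrow> 'h bounded_op set" where
  "commutant S = {T. \<forall>s\<in>S. T * s = s * T}"

text \<open>Dixmier's definition: a self-adjoint set of operators equal to its bicommutant. That it is
  a complex subalgebra containing 1 need not be required separately, because every commutant
  is one.\<close>

definition von_neumann_algebra :: "'h::complex_hilbert bounded_op set \<Rightarrow> bool" where
  "von_neumann_algebra A \<longleftrightarrow>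
     (\<forall>a\<in>A. \<exists>b\<in>A. is_adjoint b a) \<and> commutant (commutant A) = A"

definition center :: "'h::complex_hilbert bounded_op set \<Rightarrow> 'h bounded_op set" where
  "center A = {z \<in> A. \<forall>a\<in>A. z * a = a * z}"

definition no_I1_central_summand :: "'h::complex_hilbert bounded_op set \<Rightarrow> bool" where
  "no_I1_central_summand A \<longleftrightarrow>
     \<not> (\<exists>E \<in> center A. is_projection E \<and> E \<noteq> 0 \<and>
          (\<forall>a\<in>A. \<forall>b\<in>A. (E * a) * (E * b) = (E * b) * (E * a)))"

subsection \<open>Lie n-derivations\<close>

definition commutator :: "'a::ring \<Rightarrow> 'a \<Rightarrow> 'a" where
  "commutator x y = x * y - y * x"

text \<open>\<open>iter_commutator k x\<close> is $p_k(x_1,\ldots,x_k)$ for the arguments \<open>x 1, \<dots>, x k\<close>. The value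
  for \<open>k = 0\<close> is a dummy.\<close>

fun iter_commutator :: "nat \<Rightarrow> (nat \<Rightarrow> 'a::ring) \<Rightarrow> 'a" where
  "iter_commutator 0 x = 0"
| "iter_commutator (Suc 0) x = x 1"
| "iter_commutator (Suc (Suc k)) x = commutator (iter_commutator (Suc k) x) (x (Suc (Suc k)))"

definition nonlinear_Lie_n_derivation :: "nat \<Rightarrow> 'a::ring set \<Rightarrow> ('a \<Rightarrow> 'a) \<Rightarrow> bool" where
  "nonlinear_Lie_n_derivation n A \<phi> \<longleftrightarrow> \<phi> \<in> A \<rightarrow> A \<and>
     (\<forall>x \<in> {1..n} \<rightarrow> A.
        \<phi> (iter_commutator n x) = (\<Sum>i=1..n. iter_commutator n (x(i := \<phi> (x i)))))"

definition additive_derivation :: "'a::ring set \<Rightarrow> ('a \<Rightarrow> 'a) \<Rightarrow> bool" where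
  "additive_derivation A d \<longleftrightarrow> d \<in> A \<rightarrow> A \<and>
     (\<forall>x\<in>A. \<forall>y\<in>A. d (x + y) = d x + d y) \<and>
     (\<forall>x\<in>A. \<forall>y\<in>A. d (x * y) = d x * y + x * d y)"

end

theory Submission
  imports Defs
begin

text \<open>Pick a projection \<open>P\<close> in the algebra such that \<open>P\<close> and \<open>Q = 1 - P\<close> both have central carrier 1;
  it is glued by Zorn's lemma from noncentral projections of central summands. The rest is algebra in
  the Peirce decomposition. A Lie \<open>n\<close>-derivation is a Lie \<open>(2n-1)\<close>-derivation, so the degree may be
  taken odd. After subtracting an inner derivation, \<open>\<phi> P\<close> and \<open>\<phi> Q\<close> are central. Since commuting
  an odd number of times with \<open>P\<close> is the same as commuting once, this gives
  \<open>\<phi> [x,t] = [\<phi> x,t] + [x,\<phi> t]\<close> for off-diagonal \<open>x\<close>. It forces \<open>\<phi>\<close> to be additive modulo the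
  centre, because a diagonal element that commutes with \<open>PAQ\<close> is central. On a diagonal corner, the
  part of \<open>\<phi>\<close> in the opposite corner is central in that corner; the centre of \<open>QAQ\<close> is \<open>Q\<close> times the
  centre of the algebra, so \<open>\<phi>\<close> can be corrected there by a central value. The corrected map is a
  derivation. The map \<open>f\<close> then vanishes on \<open>p\<^sub>n\<close> because central values do not contribute to
  commutators.

  The operator theory (noncentral projections in noncommutative summands, centres of corners) rests on
  the expansion of a self-adjoint contraction \<open>b\<close> as \<open>\<Sum>k. (2 e\<^sub>k - 1) / 2\<^bsup>k+1\<^esup>\<close> with projections
  \<open>e\<^sub>k\<close> in the bicommutant of \<open>b\<close>.\<close>

subsection \<open>Commutator calculus\<close>

text \<open>\<phi> is not assumed additive, so each sum or sign rule has to be extracted from the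
  Lie identity by writing an element as an iterated commutator in a suitable way. Odd degree helps
  here: for \<open>u\<close> in \<open>PAQ\<close> one has \<open>[u, P] = - u\<close>, and an even
  number of copies of \<open>P\<close> after \<open>u\<close> returns \<open>u\<close> itself, so
  that \<open>\<phi> u\<close> appears on both sides and nothing need be known about
  \<open>\<phi> (- u)\<close>. Most identities are obtained only modulo the centre. Two devices
  remove the central remainder: a central element lying in a single off-diagonal corner, or in one
  diagonal corner, is 0; and a central remainder whose square can be shown to vanish is 0. The
  algebraic part is pure ring theory. The Hilbert space enters only to verify the assumptions of
  locale \<open>peirce\<close>.\<close>

fun leibniz_sum :: "nat \<Rightarrow> (nat \<Rightarrow> 'a::ring) \<Rightarrow> (nat \<Rightarrow> 'a) \<Rightarrow> 'a" where
  "leibniz_sum 0 x y = 0"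
| "leibniz_sum (Suc 0) x y = y 1"
| "leibniz_sum (Suc (Suc k)) x y =
     commutator (leibniz_sum (Suc k) x y) (x (Suc (Suc k)))
     + commutator (iter_commutator (Suc k) x) (y (Suc (Suc k)))"

lemma iter_commutator_cong:
  "(\<And>i. 1 \<le> i \<Longrightarrow> i \<le> n \<Longrightarrow> x i = x' i) \<Longrightarrow> iter_commutator n x = iter_commutator n x'"
  by (induction n x rule: iter_commutator.induct) auto

lemma leibniz_sum_cong:
  "(\<And>i. 1 \<le> i \<Longrightarrow> i \<le> n \<Longrightarrow> x i = x' i) \<Longrightarrow> (\<And>i. 1 \<le> i \<Longrightarrow> i \<le> n \<Longrightarrow> y i = y' i)
    \<Longrightarrow> leibniz_sum n x y = leibniz_sum n x' y'"
proof (induction n x y rule: leibniz_sum.induct)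
  case (3 k x y)
  then show ?case using iter_commutator_cong[of "Suc k" x x'] by auto
qed auto

lemma commutator_sum_left: "commutator (sum f I) y = (\<Sum>i\<in>I. commutator (f i) (y::'a::ring))"
  by (simp add: commutator_def sum_distrib_left sum_distrib_right sum_subtractf)

text \<open>\<open>leibniz_sum\<close> is the right-hand side of the Lie identity with the values
  \<open>y\<close> kept independent of \<open>x\<close>. Its recursion peels off the last argument,
  which suits argument lists ending in many copies of \<open>P\<close>.\<close>

lemma sum_iter_commutator:
  "(\<Sum>i=1..n. iter_commutator n (x(i := y i))) = leibniz_sum n x (y :: nat \<Rightarrow> 'a::ring)"
proof (induction n x y rule: leibniz_sum.induct)
  case (3 k x y)
  have "(\<Sum>i=1..Suc (Suc k). iter_commutator (Suc (Suc k)) (x(i := y i)))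
      = (\<Sum>i=1..Suc k. iter_commutator (Suc (Suc k)) (x(i := y i)))
        + iter_commutator (Suc (Suc k)) (x(Suc (Suc k) := y (Suc (Suc k))))"
    by simp
  also have "(\<Sum>i=1..Suc k. iter_commutator (Suc (Suc k)) (x(i := y i)))
      = (\<Sum>i=1..Suc k. commutator (iter_commutator (Suc k) (x(i := y i))) (x (Suc (Suc k))))"
    by (rule sum.cong) auto
  also have "\<dots> = commutator (leibniz_sum (Suc k) x y) (x (Suc (Suc k)))"
    using 3 by (simp only: commutator_sum_left[symmetric])
  also have "iter_commutator (Suc (Suc k)) (x(Suc (Suc k) := y (Suc (Suc k))))
      = commutator (iter_commutator (Suc k) x) (y (Suc (Suc k)))"
    using iter_commutator_cong[of "Suc k" "x(Suc (Suc k) := y (Suc (Suc k)))" x] by simp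
  finally show ?case by simp
qed auto

lemma leibniz_sum_diff:
  "leibniz_sum n x (\<lambda>i. y i - y' i) = leibniz_sum n x y - leibniz_sum n x y'"
proof (induction n x y rule: leibniz_sum.induct)
  case (3 k x y)
  show ?case unfolding leibniz_sum.simps(3) 3 by (simp add: commutator_def algebra_simps)
qed auto

text \<open>The first \<open>n\<close> arguments act only through their own iterated commutator, so
  a Lie identity can be substituted into itself. The index \<open>n + i - 1\<close> shifts the
  remaining arguments to positions from 2 on.\<close>

lemma iter_commutator_concat:
  assumes "n \<ge> 1"
  shows "iter_commutator (n + k) x
    = iter_commutator (Suc k) (\<lambda>i. if i = 1 then iter_commutator n x else x (n + i - 1))"
proof (induction k)
  case (Suc k)
  obtain n' where "n = Suc n'" using assms by (cases n) auto
  with Suc show ?case by simp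
qed auto

lemma leibniz_sum_concat:
  assumes "n \<ge> 1"
  shows "leibniz_sum (n + k) x y
    = leibniz_sum (Suc k) (\<lambda>i. if i = 1 then iter_commutator n x else x (n + i - 1))
        (\<lambda>i. if i = 1 then leibniz_sum n x y else y (n + i - 1))"
proof (induction k)
  case (Suc k)
  obtain n' where "n = Suc n'" using assms by (cases n) auto
  with Suc iter_commutator_concat[OF assms, of k x] show ?case by simp
qed auto

locale subring =
  fixes A :: "'a::{ring,monoid_mult} set"
  assumes add_closed: "x \<in> A \<Longrightarrow> y \<in> A \<Longrightarrow> x + y \<in> A"
    and minus_closed: "x \<in> A \<Longrightarrow> - x \<in> A"
    and mult_closed: "x \<in> A \<Longrightarrow> y \<in> A \<Longrightarrow> x * y \<in> A"
    and one_closed: "1 \<in> A"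
begin

definition Z :: "'a set" where "Z = {z \<in> A. \<forall>a\<in>A. z * a = a * z}"

lemma diff_closed: "x \<in> A \<Longrightarrow> y \<in> A \<Longrightarrow> x - y \<in> A"
  using add_closed[of x "- y"] minus_closed by simp

lemma zero_closed: "0 \<in> A"
  using diff_closed[OF one_closed one_closed] by simp

lemma commutator_closed: "x \<in> A \<Longrightarrow> y \<in> A \<Longrightarrow> commutator x y \<in> A"
  by (simp add: commutator_def diff_closed mult_closed)

lemmas closed = add_closed minus_closed mult_closed one_closed diff_closed zero_closed
  commutator_closed

lemma Z_in: "z \<in> Z \<Longrightarrow> z \<in> A"
  by (simp add: Z_def)

lemma Z_commute: "z \<in> Z \<Longrightarrow> a \<in> A \<Longrightarrow> z * a = a * z"
  by (simp add: Z_def)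

lemma Z_add: "z \<in> Z \<Longrightarrow> w \<in> Z \<Longrightarrow> z + w \<in> Z"
  by (simp add: Z_def closed algebra_simps)

lemma Z_minus: "z \<in> Z \<Longrightarrow> - z \<in> Z"
  by (simp add: Z_def closed)

lemma Z_diff: "z \<in> Z \<Longrightarrow> w \<in> Z \<Longrightarrow> z - w \<in> Z"
  by (simp add: Z_def closed algebra_simps)

lemma Z_zero: "0 \<in> Z"
  by (simp add: Z_def closed)

lemma Z_one: "1 \<in> Z"
  by (simp add: Z_def one_closed)

lemma Z_mult: "z \<in> Z \<Longrightarrow> w \<in> Z \<Longrightarrow> z * w \<in> Z"
proof -
  assume z: "z \<in> Z" and w: "w \<in> Z"
  have "z * w * a = a * (z * w)" if a: "a \<in> A" for a
  proof -
    have "z * w * a = z * (w * a)" by (rule mult.assoc)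
    also have "\<dots> = z * a * w" by (simp only: Z_commute[OF w a] mult.assoc)
    also have "\<dots> = a * (z * w)" by (simp only: Z_commute[OF z a] mult.assoc)
    finally show ?thesis .
  qed
  then show "z * w \<in> Z" using Z_in[OF z] Z_in[OF w] by (simp add: Z_def mult_closed)
qed

lemma commutator_Z_right: "z \<in> Z \<Longrightarrow> a \<in> A \<Longrightarrow> commutator a z = 0"
  by (simp add: commutator_def Z_commute)

lemma commutator_Z_left: "z \<in> Z \<Longrightarrow> a \<in> A \<Longrightarrow> commutator z a = 0"
  by (simp add: commutator_def Z_commute)

lemma iter_commutator_closed:
  "(\<And>i. 1 \<le> i \<Longrightarrow> i \<le> n \<Longrightarrow> x i \<in> A) \<Longrightarrow> iter_commutator n x \<in> A"
  by (induction n x rule: iter_commutator.induct) (auto intro!: closed)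

lemma leibniz_sum_closed:
  "(\<And>i. 1 \<le> i \<Longrightarrow> i \<le> n \<Longrightarrow> x i \<in> A) \<Longrightarrow> (\<And>i. 1 \<le> i \<Longrightarrow> i \<le> n \<Longrightarrow> y i \<in> A)
    \<Longrightarrow> leibniz_sum n x y \<in> A"
proof (induction n x y rule: leibniz_sum.induct)
  case (3 k x y)
  then show ?case using iter_commutator_closed[of "Suc k" x] by (auto intro!: closed)
qed (auto intro!: closed)

text \<open>Used twice: it lets an inner derivation be subtracted from a Lie derivation, and in the
  end it shows that \<phi> and the derivation agree on iterated commutators.\<close>

lemma leibniz_sum_derivation:
  assumes "\<And>x y. x \<in> A \<Longrightarrow> y \<in> A \<Longrightarrow>
      d (commutator x y) = commutator (d x) y + commutator x (d y)"
    and "\<And>i. 1 \<le> i \<Longrightarrow> i \<le> Suc k \<Longrightarrow> x i \<in> A"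
  shows "leibniz_sum (Suc k) x (\<lambda>i. d (x i)) = d (iter_commutator (Suc k) x)"
  using assms(2)
proof (induction k)
  case (Suc k)
  have "iter_commutator (Suc k) x \<in> A"
    by (rule iter_commutator_closed) (use Suc.prems in auto)
  moreover have "x (Suc (Suc k)) \<in> A" using Suc.prems by simp
  ultimately show ?case using Suc by (simp add: assms(1))
qed auto

text \<open>Every summand contains a commutator with a central value. The length must be at least 2,
  since for length 1 the sum is \<open>y 1\<close> itself.\<close>

lemma leibniz_sum_Z:
  assumes "\<And>i. 1 \<le> i \<Longrightarrow> i \<le> Suc (Suc k) \<Longrightarrow> x i \<in> A"
    and "\<And>i. 1 \<le> i \<Longrightarrow> i \<le> Suc (Suc k) \<Longrightarrow> y i \<in> Z"
  shows "leibniz_sum (Suc (Suc k)) x y = 0"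
  using assms
proof (induction k)
  case 0
  then show ?case by (simp add: commutator_Z_left commutator_Z_right)
next
  case (Suc k)
  have "iter_commutator (Suc (Suc k)) x \<in> A"
    by (rule iter_commutator_closed) (use Suc.prems in auto)
  then have "commutator (iter_commutator (Suc (Suc k)) x) (y (Suc (Suc (Suc k)))) = 0"
    using Suc.prems by (simp add: commutator_Z_right)
  moreover have "leibniz_sum (Suc (Suc k)) x y = 0" using Suc by simp
  ultimately show ?case unfolding leibniz_sum.simps(3)[of "Suc k"] by (simp add: commutator_def)
qed

end

subsection \<open>Peirce decomposition\<close>

text \<open>For idempotents \<open>e\<close> and \<open>f\<close> this is \<open>eAf\<close>; the
  fixed-point form turns membership directly into rewrite rules.\<close>

definition corner :: "'a::ring set \<Rightarrow> 'a \<Rightarrow> 'a \<Rightarrow> 'a set" where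
  "corner A e f = {x \<in> A. e * x = x \<and> x * f = x}"

text \<open>The \<open>faithful\<close> assumptions express central carrier 1 of \<open>P\<close>
  and \<open>Q\<close> as cancellation rules; \<open>torsion_free\<close> is a repeated sum because
  the ring carries no scalars; the \<open>lift\<close> assumptions say that the centre of a diagonal
  corner comes from the centre of \<open>A\<close>. The list is symmetric in \<open>P\<close> and
  \<open>Q\<close>, so every result also holds with the two exchanged.\<close>

locale peirce = subring A for A :: "'a::{ring,monoid_mult} set" +
  fixes P Q :: 'a
  assumes P_in: "P \<in> A" and Q_in: "Q \<in> A"
    and PQ_sum: "P + Q = 1" and PQ: "P * Q = 0" and QP: "Q * P = 0"
    and faithful_rP: "a \<in> A \<Longrightarrow> (\<And>r. r \<in> A \<Longrightarrow> a * (r * P) = 0) \<Longrightarrow> a = 0"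
    and faithful_rQ: "a \<in> A \<Longrightarrow> (\<And>r. r \<in> A \<Longrightarrow> a * (r * Q) = 0) \<Longrightarrow> a = 0"
    and faithful_lP: "a \<in> A \<Longrightarrow> (\<And>r. r \<in> A \<Longrightarrow> P * (r * a) = 0) \<Longrightarrow> a = 0"
    and faithful_lQ: "a \<in> A \<Longrightarrow> (\<And>r. r \<in> A \<Longrightarrow> Q * (r * a) = 0) \<Longrightarrow> a = 0"
    and torsion_free: "a \<in> A \<Longrightarrow> (\<Sum>i<Suc k. a) = 0 \<Longrightarrow> a = 0"
    and central_nilpotent: "z \<in> Z \<Longrightarrow> z * z = 0 \<Longrightarrow> z = 0"
    and lift_P: "c \<in> corner A P P \<Longrightarrow> (\<And>b. b \<in> corner A P P \<Longrightarrow> c * b = b * c)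
        \<Longrightarrow> \<exists>z\<in>Z. z * P = c"
    and lift_Q: "c \<in> corner A Q Q \<Longrightarrow> (\<And>b. b \<in> corner A Q Q \<Longrightarrow> c * b = b * c)
        \<Longrightarrow> \<exists>z\<in>Z. z * Q = c"
begin

lemma peirce_swap: "peirce A Q P"
  by unfold_locales
    (fact Q_in P_in QP PQ faithful_rQ faithful_rP faithful_lQ faithful_lP torsion_free
       central_nilpotent lift_Q lift_P
     | simp add: PQ_sum add.commute)+

lemma PP: "P * P = P" and QQ: "Q * Q = Q"
proof -
  have "P * (P + Q) = P" "Q * (P + Q) = Q" by (simp_all add: PQ_sum)
  then show "P * P = P" "Q * Q = Q" by (simp_all add: distrib_left PQ QP)
qed

lemma double_zero: "a \<in> A \<Longrightarrow> a + a = 0 \<Longrightarrow> a = 0"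
  using torsion_free[of a 1] by simp

lemma idem_simps [simp]:
  "P * P = P" "Q * Q = Q" "P * Q = 0" "Q * P = 0"
  "P * (P * w) = P * w" "Q * (Q * w) = Q * w" "P * (Q * w) = 0" "Q * (P * w) = 0"
  by (simp_all add: PP QQ PQ QP mult.assoc[symmetric])

abbreviation "C11 \<equiv> corner A P P"
abbreviation "C12 \<equiv> corner A P Q"
abbreviation "C21 \<equiv> corner A Q P"
abbreviation "C22 \<equiv> corner A Q Q"

lemma corner_in: "x \<in> corner A e f \<Longrightarrow> x \<in> A"
  by (simp add: corner_def)

lemma corner_left: "x \<in> corner A e f \<Longrightarrow> e * x = x" "x \<in> corner A e f \<Longrightarrow> e * (x * w) = x * w"
  by (simp_all add: corner_def mult.assoc[symmetric])

lemma corner_right: "x \<in> corner A e f \<Longrightarrow> x * f = x" "x \<in> corner A e f \<Longrightarrow> x * (f * w) = x * w"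
  by (simp_all add: corner_def mult.assoc[symmetric])

lemma corner_orth_left: "x \<in> corner A e f \<Longrightarrow> g * e = 0 \<Longrightarrow> g * x = 0"
  "x \<in> corner A e f \<Longrightarrow> g * e = 0 \<Longrightarrow> g * (x * w) = 0"
  by (metis corner_left(1) mult.assoc mult_zero_left)+

lemma corner_orth_right: "x \<in> corner A e f \<Longrightarrow> f * g = 0 \<Longrightarrow> x * g = 0"
  "x \<in> corner A e f \<Longrightarrow> f * g = 0 \<Longrightarrow> x * (g * w) = 0"
  by (metis corner_right(1) mult.assoc mult_zero_left mult_zero_right)+

lemma corner_orth: "x \<in> corner A e f \<Longrightarrow> y \<in> corner A g h \<Longrightarrow> f * g = 0 \<Longrightarrow> x * y = 0"
  "x \<in> corner A e f \<Longrightarrow> y \<in> corner A g h \<Longrightarrow> f * g = 0 \<Longrightarrow> x * (y * w) = 0"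
  by (metis corner_orth_left(1) corner_right(1) mult.assoc mult_zero_right)
    (metis corner_orth_left(1) corner_right(1) mult.assoc mult_zero_right mult_zero_left)

lemma cornerI: "x \<in> A \<Longrightarrow> e * x = x \<Longrightarrow> x * f = x \<Longrightarrow> x \<in> corner A e f"
  by (simp add: corner_def)

lemma corner_add: "x \<in> corner A e f \<Longrightarrow> y \<in> corner A e f \<Longrightarrow> x + y \<in> corner A e f"
  by (intro cornerI) (simp_all add: add_closed corner_in distrib_left distrib_right corner_left(1) corner_right(1))

lemma corner_minus: "x \<in> corner A e f \<Longrightarrow> - x \<in> corner A e f"
  by (intro cornerI) (simp_all add: minus_closed corner_in corner_left(1) corner_right(1))

lemma corner_diff: "x \<in> corner A e f \<Longrightarrow> y \<in> corner A e f \<Longrightarrow> x - y \<in> corner A e f"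
  using corner_add[of x e f "- y"] corner_minus[of y e f] by simp

lemma corner_zero: "0 \<in> corner A e f"
  by (intro cornerI) (simp_all add: zero_closed)

lemma corner_mult: "x \<in> corner A e f \<Longrightarrow> y \<in> corner A f g \<Longrightarrow> x * y \<in> corner A e g"
  by (intro cornerI) (simp_all add: mult_closed corner_in corner_left(2) corner_right(1) mult.assoc)

lemma c11_simps [simp]: assumes "x \<in> C11"
  shows "P * x = x" "P * (x * w) = x * w" "Q * x = 0" "Q * (x * w) = 0"
    "x * P = x" "x * (P * w) = x * w" "x * Q = 0" "x * (Q * w) = 0"
  using corner_left[OF assms] corner_right[OF assms] corner_orth_left[OF assms QP]
    corner_orth_right[OF assms PQ] by blast+

lemma c12_simps [simp]: assumes "x \<in> C12"
  shows "P * x = x" "P * (x * w) = x * w" "Q * x = 0" "Q * (x * w) = 0"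
    "x * Q = x" "x * (Q * w) = x * w" "x * P = 0" "x * (P * w) = 0"
  using corner_left[OF assms] corner_right[OF assms] corner_orth_left[OF assms QP]
    corner_orth_right[OF assms QP] by blast+

lemma c21_simps [simp]: assumes "x \<in> C21"
  shows "Q * x = x" "Q * (x * w) = x * w" "P * x = 0" "P * (x * w) = 0"
    "x * P = x" "x * (P * w) = x * w" "x * Q = 0" "x * (Q * w) = 0"
  using corner_left[OF assms] corner_right[OF assms] corner_orth_left[OF assms PQ]
    corner_orth_right[OF assms PQ] by blast+

lemma c22_simps [simp]: assumes "x \<in> C22"
  shows "Q * x = x" "Q * (x * w) = x * w" "P * x = 0" "P * (x * w) = 0"
    "x * Q = x" "x * (Q * w) = x * w" "x * P = 0" "x * (P * w) = 0"
  using corner_left[OF assms] corner_right[OF assms] corner_orth_left[OF assms PQ]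
    corner_orth_right[OF assms QP] by blast+

lemma corner_prod_zero [simp]:
  "x \<in> C11 \<Longrightarrow> y \<in> C21 \<Longrightarrow> x * y = 0" "x \<in> C11 \<Longrightarrow> y \<in> C22 \<Longrightarrow> x * y = 0"
  "x \<in> C21 \<Longrightarrow> y \<in> C21 \<Longrightarrow> x * y = 0" "x \<in> C21 \<Longrightarrow> y \<in> C22 \<Longrightarrow> x * y = 0"
  "x \<in> C12 \<Longrightarrow> y \<in> C11 \<Longrightarrow> x * y = 0" "x \<in> C12 \<Longrightarrow> y \<in> C12 \<Longrightarrow> x * y = 0"
  "x \<in> C22 \<Longrightarrow> y \<in> C11 \<Longrightarrow> x * y = 0" "x \<in> C22 \<Longrightarrow> y \<in> C12 \<Longrightarrow> x * y = 0"
  "x \<in> C11 \<Longrightarrow> y \<in> C21 \<Longrightarrow> x * (y * w) = 0" "x \<in> C11 \<Longrightarrow> y \<in> C22 \<Longrightarrow> x * (y * w) = 0"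
  "x \<in> C21 \<Longrightarrow> y \<in> C21 \<Longrightarrow> x * (y * w) = 0" "x \<in> C21 \<Longrightarrow> y \<in> C22 \<Longrightarrow> x * (y * w) = 0"
  "x \<in> C12 \<Longrightarrow> y \<in> C11 \<Longrightarrow> x * (y * w) = 0" "x \<in> C12 \<Longrightarrow> y \<in> C12 \<Longrightarrow> x * (y * w) = 0"
  "x \<in> C22 \<Longrightarrow> y \<in> C11 \<Longrightarrow> x * (y * w) = 0" "x \<in> C22 \<Longrightarrow> y \<in> C12 \<Longrightarrow> x * (y * w) = 0"
  by ((rule corner_orth(2), assumption, assumption, rule PQ QP)
    | (rule corner_orth(1), assumption, assumption, rule PQ QP))+

lemma in_corner:
  assumes "r \<in> A"
  shows "P * (r * P) \<in> C11" "P * (r * Q) \<in> C12" "Q * (r * P) \<in> C21" "Q * (r * Q) \<in> C22"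
  using assms P_in Q_in by (auto intro!: cornerI mult_closed simp: mult.assoc)

lemma idem_corner: "P \<in> C11" "Q \<in> C22"
  using P_in Q_in by (auto intro!: cornerI)

lemma peirce_decomp: "r = P * (r * P) + P * (r * Q) + Q * (r * P) + Q * (r * Q)"
proof -
  have "r = (P + Q) * (r * (P + Q))" by (simp add: PQ_sum)
  then show ?thesis by (simp add: algebra_simps)
qed

lemma peirce_cases:
  assumes "r \<in> A"
  obtains a x y b where "a \<in> C11" "x \<in> C12" "y \<in> C21" "b \<in> C22" "r = a + x + y + b"
  using peirce_decomp[of r] in_corner[OF assms] by blast

lemma diagonal_cases:
  assumes "r \<in> A" "P * r = r * P"
  obtains a b where "a \<in> C11" "b \<in> C22" "r = a + b"
proof -
  have 1: "P * (r * Q) = 0" by (metis assms(2) idem_simps(3) mult.assoc mult_zero_right)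
  have 2: "Q * (r * P) = 0" by (metis assms(2) idem_simps(8))
  show ?thesis using that[OF in_corner(1,4)[OF assms(1) ]] assms(1) peirce_decomp[of r] 1 2 by simp
qed

text \<open>With \<open>D = a + b\<close> the hypothesis reads \<open>a u = u b\<close>. For
  \<open>c\<close> in \<open>PAP\<close> this gives \<open>a c u = c u b = c a u\<close>, and
  \<open>u\<close> is cancelled by faithfulness of \<open>Q\<close>; the other corners are treated
  alike. Thus a single off-diagonal corner suffices to test a diagonal element for
  centrality.\<close>

lemma commutes_C12_imp_Z:
  assumes D: "D \<in> A" "P * D = D * P" and comm: "\<And>u. u \<in> C12 \<Longrightarrow> D * u = u * D"
  shows "D \<in> Z"
proof -
  obtain a b where ab: "a \<in> C11" "b \<in> C22" "D = a + b" using D by (rule diagonal_cases)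
  note abA = ab(1,2)[THEN corner_in]
  have au: "a * u = u * b" if "u \<in> C12" for u
    using comm[OF that] ab that by (simp add: algebra_simps)
  have c11: "a * c = c * a" if c: "c \<in> C11" for c
  proof -
    have cA: "c \<in> A" using c by (rule corner_in)
    have "a * c - c * a = 0"
    proof (rule faithful_rQ)
      show "a * c - c * a \<in> A" using abA cA by (simp add: closed)
      fix r assume r: "r \<in> A"
      let ?u = "P * (r * Q)"
      have u: "?u \<in> C12" using r by (rule in_corner)
      have "a * (c * ?u) = c * ?u * b" using au[of "c * ?u"] c u corner_mult by blast
      also have "\<dots> = c * (a * ?u)" using au[OF u] by (simp add: mult.assoc)
      finally show "(a * c - c * a) * (r * Q) = 0"
        using c ab by (simp add: algebra_simps)
    qed
    then show ?thesis by simp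
  qed
  have c22: "b * c = c * b" if c: "c \<in> C22" for c
  proof -
    have cA: "c \<in> A" using c by (rule corner_in)
    have "b * c - c * b = 0"
    proof (rule faithful_lP)
      show "b * c - c * b \<in> A" using abA cA by (simp add: closed)
      fix r assume r: "r \<in> A"
      let ?u = "P * (r * Q)"
      have u: "?u \<in> C12" using r by (rule in_corner)
      have "?u * b * c = a * (?u * c)" by (subst au[OF u, symmetric]) (rule mult.assoc)
      also have "\<dots> = ?u * c * b" using au[of "?u * c"] c u corner_mult by blast
      finally show "P * (r * (b * c - c * b)) = 0"
        using c ab by (simp add: algebra_simps)
    qed
    then show ?thesis by simp
  qed
  have c21: "b * c = c * a" if c: "c \<in> C21" for c
  proof -
    have cA: "c \<in> A" using c by (rule corner_in)
    have "b * c - c * a = 0"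
    proof (rule faithful_lP)
      show "b * c - c * a \<in> A" using abA cA by (simp add: closed)
      fix r assume r: "r \<in> A"
      let ?u = "P * (r * Q)"
      have u: "?u \<in> C12" using r by (rule in_corner)
      have "?u * b * c = a * (?u * c)" by (subst au[OF u, symmetric]) (rule mult.assoc)
      \<comment> \<open>The product \<open>?u * c\<close> lies in \<open>PAP\<close>, where
        \<open>a\<close> is already known to be central.\<close>
      also have "\<dots> = ?u * c * a" using c11[of "?u * c"] c u corner_mult by blast
      finally show "P * (r * (b * c - c * a)) = 0"
        using c ab by (simp add: algebra_simps)
    qed
    then show ?thesis by simp
  qed
  have "D * r = r * D" if "r \<in> A" for r
  proof -
    obtain k x y l where r: "k \<in> C11" "x \<in> C12" "y \<in> C21" "l \<in> C22" "r = k + x + y + l"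
      using \<open>r \<in> A\<close> by (rule peirce_cases)
    show ?thesis
      using r(1-4) ab(1,2) au[OF r(2)] c11[OF r(1)] c21[OF r(3)] c22[OF r(4)]
      unfolding r(5) ab(3) by (simp add: algebra_simps)
  qed
  then show ?thesis using D by (simp add: Z_def)
qed

text \<open>Faithfulness of \<open>Q\<close> turns the hypothesis into \<open>z z P = 0\<close>,
  faithfulness of \<open>P\<close> then gives \<open>z z = 0\<close>.\<close>

lemma Z_square_C12: "z \<in> Z \<Longrightarrow> (\<And>u. u \<in> C12 \<Longrightarrow> z * (z * u) = 0) \<Longrightarrow> z = 0"
proof -
  assume z: "z \<in> Z" and u: "\<And>u. u \<in> C12 \<Longrightarrow> z * (z * u) = 0"
  have zP: "P * z = z * P" and zA: "z \<in> A" using z P_in by (simp_all add: Z_def)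
  have "z * z * P = 0"
  proof (rule faithful_rQ)
    show "z * z * P \<in> A" using zA P_in by (simp add: closed)
    show "z * z * P * (r * Q) = 0" if "r \<in> A" for r
      using u[OF in_corner(2)[OF that]] by (simp add: mult.assoc)
  qed
  then have "z * z = 0"
  proof -
    assume "z * z * P = 0"
    then have "z * z * (r * P) = 0" if "r \<in> A" for r
      using that zA z by (metis Z_commute Z_mult mult.assoc mult_zero_right)
    then show ?thesis using faithful_rP[of "z * z"] zA by (simp add: closed)
  qed
  then show "z = 0" using z central_nilpotent by blast
qed

text \<open>With \<open>c = [u, y]\<close>, the element \<open>[u, u y] = u c\<close> is central
  too. Comparing \<open>u c y\<close> with \<open>y u c\<close> gives \<open>c c = 0\<close>, and
  central nilpotents vanish.\<close>

lemma Z_of_commutators: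
  assumes u: "u \<in> A" and c: "\<And>y. y \<in> A \<Longrightarrow> commutator u y \<in> Z"
  shows "u \<in> Z"
proof -
  have "commutator u y = 0" if y: "y \<in> A" for y
  proof -
    let ?c = "commutator u y"
    have eq: "commutator u (u * y) = u * ?c" by (simp add: commutator_def algebra_simps)
    have uc: "u * ?c \<in> Z" using c[of "u * y"] u y eq by (simp add: closed)
    have "u * ?c * y = y * (u * ?c)" using uc y by (simp add: Z_commute)
    also have "\<dots> = y * u * ?c" by (simp add: mult.assoc)
    finally have "u * (?c * y) - y * u * ?c = 0" by (simp add: mult.assoc)
    then have "?c * ?c = 0" using Z_commute[OF c[OF y] y]
      by (simp add: commutator_def[of u y]) (simp add: algebra_simps)
    then show ?thesis using c[OF y] central_nilpotent by blast
  qed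
  then show ?thesis using u by (simp add: Z_def commutator_def)
qed

text \<open>A commutator with \<open>P\<close> has only off-diagonal components, while a central
  element is diagonal, so the commutator is 0.\<close>

lemma commutator_P_Z: 
  assumes "t \<in> A" "commutator t P \<in> Z" shows "P * t = t * P"
proof -
  let ?z = "commutator t P"
  have "?z * P = P * ?z" using assms P_in by (simp add: Z_commute)
  then have e: "t * P - P * (t * P) = P * (t * P) - P * t"
    by (simp add: commutator_def algebra_simps)
  from arg_cong[OF e, of "\<lambda>w. P * w"] have "P * (t * P) = P * t" by (simp add: algebra_simps)
  with e show ?thesis by simp
qed

end

subsection \<open>Lie derivations of odd degree\<close>

text \<open>The degree \<open>2 * m + 3\<close> is \<open>2n - 1\<close> for
  \<open>n = m + 2\<close>.\<close>

locale lie_derivation = peirce A P Q for A :: "'a::{ring,monoid_mult} set" and P Q +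
  fixes \<phi> :: "'a \<Rightarrow> 'a" and m :: nat
  assumes phi_in: "r \<in> A \<Longrightarrow> \<phi> r \<in> A"
    and lie: "(\<And>i. x i \<in> A) \<Longrightarrow>
      \<phi> (iter_commutator (2 * m + 3) x) = leibniz_sum (2 * m + 3) x (\<lambda>i. \<phi> (x i))"
begin

lemma double_commutator_P: "commutator (commutator w P) P = P * (w * Q) + Q * (w * P)"
proof -
  have Q: "Q = 1 - P" using PQ_sum by (metis add_diff_cancel_left')
  show ?thesis unfolding Q by (simp add: commutator_def algebra_simps)
qed

text \<open>Commuting twice with \<open>P\<close> projects onto the off-diagonal part, and a
  commutator with \<open>P\<close> is already off-diagonal.\<close>

lemma triple_commutator_P: "commutator (commutator (commutator w P) P) P = commutator w P"
  by (simp add: commutator_def algebra_simps)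

lemma commutator_P_tail:
  assumes x: "\<And>i. x i \<in> A" and tail: "\<And>i. Suc k < i \<Longrightarrow> i \<le> Suc k + 2 * j + 1 \<Longrightarrow> x i = P"
  shows "iter_commutator (Suc k + 2 * j + 1) x = commutator (iter_commutator (Suc k) x) P"
  using tail by (induction j) (simp_all add: triple_commutator_P)

lemma leibniz_sum_P_tail:
  assumes x: "\<And>i. x i \<in> A" and tail: "\<And>i. Suc k < i \<Longrightarrow> i \<le> Suc k + 2 * j + 1 \<Longrightarrow> x i = P"
    and y: "\<And>i. Suc k < i \<Longrightarrow> i \<le> Suc k + 2 * j + 1 \<Longrightarrow> y i \<in> Z"
  shows "leibniz_sum (Suc k + 2 * j + 1) x y = commutator (leibniz_sum (Suc k) x y) P"
  using tail y
proof (induction j)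
  case 0
  then show ?case
    by (simp add: commutator_Z_right iter_commutator_closed x)
next
  case (Suc j)
  have "commutator (iter_commutator n x) (y i) = 0" if "Suc k < i" "i \<le> Suc k + 2 * Suc j + 1" for n i
    using Suc.prems(2)[OF that] by (simp add: commutator_Z_right iter_commutator_closed x)
  note z = this
  from Suc show ?case by (simp add: z triple_commutator_P del: iter_commutator.simps)
qed

lemma phi_zero: "\<phi> 0 = 0"
proof -
  have "iter_commutator (Suc (Suc k)) (\<lambda>i. 0 :: 'a) = 0" for k
    by (induction k) (simp_all add: commutator_def)
  moreover have "leibniz_sum (Suc (Suc k)) (\<lambda>i. 0) y = 0" for k and y :: "nat \<Rightarrow> 'a"
    by (induction k) (simp_all add: commutator_def calculation[simplified commutator_def])
  ultimately have "iter_commutator (2 * m + 3) (\<lambda>i. 0 :: 'a) = 0"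
      "leibniz_sum (2 * m + 3) (\<lambda>i. 0) (\<lambda>i. \<phi> 0) = 0"
    unfolding numeral_3_eq_3 add_Suc_right add_0_right by blast+
  then show ?thesis using lie[of "\<lambda>i. 0"] by (simp only: zero_closed)
qed

text \<open>Summands that differentiate a later argument contain \<open>[r, s] = 0\<close>. So the
  Lie identity says that the given element becomes 0 after commuting with any
  \<open>2 * m + 1\<close> further elements of \<open>A\<close>; \<open>Z_of_commutators\<close>
  removes these one at a time.\<close>

lemma lie_commuting_pair:
  assumes r: "r \<in> A" and s: "s \<in> A" and rs: "commutator r s = 0"
  shows "commutator (\<phi> r) s + commutator r (\<phi> s) \<in> Z"
proof -
  \<comment> \<open>Induction on \<open>k\<close>, the number of arguments after \<open>r\<close>
    and \<open>s\<close>; each step shortens this tail by one.\<close>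
  have *: "commutator (\<phi> r) s + commutator r (\<phi> s) \<in> Z"
    if "\<And>x. (\<And>i. x i \<in> A) \<Longrightarrow> x 1 = r \<Longrightarrow> x 2 = s
      \<Longrightarrow> leibniz_sum (Suc (Suc k)) x (\<lambda>i. \<phi> (x i)) \<in> Z" for k
    using that
  proof (induction k)
    case 0
    from 0[of "\<lambda>i. if i = 1 then r else s"] r s show ?case by (simp add: numeral_2_eq_2)
  next
    case (Suc k)
    show ?case
    proof (rule Suc.IH)
      fix x :: "nat \<Rightarrow> 'a"
      assume x: "\<And>i. x i \<in> A" "x 1 = r" "x 2 = s"
      show "leibniz_sum (Suc (Suc k)) x (\<lambda>i. \<phi> (x i)) \<in> Z"
      proof (rule Z_of_commutators)
        show "leibniz_sum (Suc (Suc k)) x (\<lambda>i. \<phi> (x i)) \<in> A"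
          by (rule leibniz_sum_closed) (simp_all add: x phi_in)
        fix t assume t: "t \<in> A"
        let ?x = "x(Suc (Suc (Suc k)) := t)"
        have zero: "iter_commutator (Suc (Suc j)) ?x = 0" if "j \<le> k" for j
          using that
        proof (induction j)
          case 0
          show ?case using rs x(2,3) by (simp add: numeral_2_eq_2)
        qed (simp add: commutator_def)
        have "leibniz_sum (Suc (Suc (Suc k))) ?x (\<lambda>i. \<phi> (?x i)) \<in> Z"
          by (rule Suc.prems) (use x t in auto)
        moreover have "leibniz_sum (Suc (Suc k)) ?x (\<lambda>i. \<phi> (?x i))
            = leibniz_sum (Suc (Suc k)) x (\<lambda>i. \<phi> (x i))"
          by (rule leibniz_sum_cong) auto
        ultimately show "commutator (leibniz_sum (Suc (Suc k)) x (\<lambda>i. \<phi> (x i))) t \<in> Z"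
          using zero[of k] unfolding leibniz_sum.simps(3)[of "Suc k"]
          by (simp add: commutator_def)
      qed
    qed
  qed
  show ?thesis
  proof (rule *)
    fix x :: "nat \<Rightarrow> 'a"
    assume x: "\<And>i. x i \<in> A" "x 1 = r" "x 2 = s"
    have "iter_commutator (Suc (Suc j)) x = 0" for j
      using rs x(2,3) by (induction j) (simp_all add: numeral_2_eq_2, simp add: commutator_def)
    from this[of "Suc (2 * m)"] have "leibniz_sum (Suc (Suc (Suc (2 * m)))) x (\<lambda>i. \<phi> (x i)) = 0"
      using lie[of x] x(1) unfolding numeral_3_eq_3 add_Suc_right add_0_right by (metis phi_zero)
    then show "leibniz_sum (Suc (Suc (Suc (2 * m)))) x (\<lambda>i. \<phi> (x i)) \<in> Z"
      by (metis Z_zero)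
  qed
qed

text \<open>Apply the identity to \<open>u, P, ..., P\<close> with \<open>u\<close> in
  \<open>PAQ\<close>. In the \<open>PAQ\<close> component each of the \<open>2 * m + 2\<close>
  copies of \<open>P\<close> contributes \<open>- c\<close> with \<open>c = [u, \<phi> P]\<close>,
  and the contribution of \<open>\<phi> u\<close> cancels; hence \<open>2 * m + 2\<close> copies of
  \<open>c\<close> sum to 0.\<close>

lemma phi_P_in_Z:
  assumes comm: "P * \<phi> P = \<phi> P * P"
  shows "\<phi> P \<in> Z"
proof (rule commutes_C12_imp_Z)
  show "\<phi> P \<in> A" using P_in by (rule phi_in)
  show "P * \<phi> P = \<phi> P * P" by fact
  fix u assume u: "u \<in> C12"
  have uA: "u \<in> A" using u by (rule corner_in)
  define c where "c = commutator u (\<phi> P)"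
  obtain a b where ab: "a \<in> C11" "b \<in> C22" "\<phi> P = a + b"
    using phi_in[OF P_in] comm by (rule diagonal_cases)
  have c: "c \<in> C12"
    unfolding c_def ab(3) commutator_def distrib_left distrib_right using ab(1,2) u
    by (simp add: corner_diff corner_mult)
  let ?x = "\<lambda>i::nat. if i = 1 then u else P"
  let ?y = "\<lambda>i. \<phi> (?x i)"
  \<comment> \<open>The sign stems from \<open>[u, P] = - u\<close>; it disappears at the end
    because the number of copies of \<open>P\<close> is even.\<close>
  let ?s = "\<lambda>k (w::'a). if even k then w else - w"
  have it: "iter_commutator (Suc k) ?x = ?s k u" for k
    by (induction k) (use u in \<open>auto simp: commutator_def\<close>)
  have lb: "P * (leibniz_sum (Suc k) ?x ?y * Q) = ?s k (P * (\<phi> u * Q) - (\<Sum>i<k. c))" for k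
  proof (induction k)
    case (Suc k)
    have "commutator (iter_commutator (Suc k) ?x) (\<phi> P) = ?s k c"
      unfolding it c_def by (simp add: commutator_def)
    then have "P * (leibniz_sum (Suc (Suc k)) ?x ?y * Q)
        = P * (commutator (leibniz_sum (Suc k) ?x ?y) P * Q) + ?s k (P * (c * Q))"
      by (simp add: algebra_simps)
    also have "P * (commutator (leibniz_sum (Suc k) ?x ?y) P * Q)
        = - (P * (leibniz_sum (Suc k) ?x ?y * Q))"
      by (simp add: commutator_def algebra_simps)
    finally have eq: "P * (leibniz_sum (Suc (Suc k)) ?x ?y * Q)
        = - (P * (leibniz_sum (Suc k) ?x ?y * Q)) + ?s k (P * (c * Q))" .
    show ?case unfolding eq Suc using c by auto
  qed auto
  have cancel: "S = 0" if "a = a - S" for a S :: 'a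
    using that by (simp add: eq_diff_eq)
  have "P * (\<phi> u * Q) = P * (\<phi> u * Q) - (\<Sum>i<Suc (Suc (2 * m)). c)"
    using lie[of ?x] uA P_in it[of "Suc (Suc (2 * m))"] lb[of "Suc (Suc (2 * m))"]
    by (simp add: numeral_3_eq_3)
  then have "(\<Sum>i<Suc (Suc (2 * m)). c) = 0"
    by (rule cancel)
  then have "c = 0" using torsion_free corner_in[OF c] by blast
  then show "\<phi> P * u = u * \<phi> P" by (simp add: c_def commutator_def)
qed

text \<open>The arguments are \<open>r\<close>, then \<open>2 * m + 1\<close> copies of
  \<open>P\<close>, then \<open>t\<close>. The copies collapse to one, and central
  \<open>\<phi> P\<close> leaves only \<open>r\<close> and \<open>t\<close> to be
  differentiated.\<close>

lemma lie_commutator_P_first: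
  assumes "\<phi> P \<in> Z" and r: "r \<in> A" and t: "t \<in> A"
  shows "\<phi> (commutator (commutator r P) t)
    = commutator (commutator (\<phi> r) P) t + commutator (commutator r P) (\<phi> t)"
proof -
  let ?x = "\<lambda>i. if i = 1 then r else if i = 2 * m + 3 then t else P"
  have x: "?x i \<in> A" for i using r t P_in by simp
  have "iter_commutator (2 * m + 2) ?x = commutator r P"
    using commutator_P_tail[of ?x 0 m] x by simp
  moreover have "leibniz_sum (2 * m + 2) ?x (\<lambda>i. \<phi> (?x i)) = commutator (\<phi> r) P"
    using leibniz_sum_P_tail[of ?x 0 m "\<lambda>i. \<phi> (?x i)"] x assms(1) by simp
  ultimately show ?thesis using lie[of ?x] x by (simp add: numeral_3_eq_3)
qed

text \<open>The same collapse, with the \<open>2 * m + 1\<close> copies of \<open>P\<close> placed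
  after \<open>r\<close> and \<open>s\<close>.\<close>

lemma lie_commutator_P_last:
  assumes "\<phi> P \<in> Z" and r: "r \<in> A" and s: "s \<in> A"
  shows "\<phi> (commutator (commutator r s) P)
    = commutator (commutator (\<phi> r) s + commutator r (\<phi> s)) P"
proof -
  let ?x = "\<lambda>i::nat. if i = 1 then r else if i = 2 then s else P"
  have x: "?x i \<in> A" for i using r s P_in by simp
  have "iter_commutator (2 * m + 3) ?x = commutator (commutator r s) P"
    using commutator_P_tail[of ?x 1 m] x by (simp add: numeral_3_eq_3)
  moreover have "leibniz_sum (2 * m + 3) ?x (\<lambda>i. \<phi> (?x i))
      = commutator (commutator (\<phi> r) s + commutator r (\<phi> s)) P"
    using leibniz_sum_P_tail[of ?x 1 m "\<lambda>i. \<phi> (?x i)"] x assms(1) by (simp add: numeral_3_eq_3)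
  ultimately show ?thesis using lie[of ?x] x by simp
qed

end

locale normalized_lie_derivation = lie_derivation A P Q \<phi> m
  for A :: "'a::{ring,monoid_mult} set" and P Q \<phi> m +
  assumes phi_P: "\<phi> P \<in> Z" and phi_Q: "\<phi> Q \<in> Z"

text \<open>For \<open>u\<close> in \<open>PAQ\<close>, the element \<open>- u\<close> is both
  \<open>[[P, u], P]\<close> and \<open>[[u, Q], P]\<close>. Comparing the two values of \<phi>
  leaves \<open>[[u, \<phi> Q], P] = 0\<close>, and for diagonal \<open>\<phi> Q\<close> this says
  that \<open>\<phi> Q\<close> commutes with \<open>u\<close>.\<close>

lemma (in lie_derivation) normalized:
  assumes P: "\<phi> P \<in> Z"
  shows "normalized_lie_derivation A P Q \<phi> m"
proof -
  have QA: "\<phi> Q \<in> A" using Q_in by (rule phi_in)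
  have "commutator P Q = 0" by (simp add: commutator_def)
  then have "commutator (\<phi> P) Q + commutator P (\<phi> Q) \<in> Z"
    using lie_commuting_pair P_in Q_in by blast
  then have "commutator P (\<phi> Q) \<in> Z" using P Q_in by (simp add: commutator_Z_left)
  then have "commutator (\<phi> Q) P \<in> Z" using Z_minus by (fastforce simp: commutator_def)
  then have comm: "P * \<phi> Q = \<phi> Q * P" using commutator_P_Z QA by blast
  obtain a b where ab: "a \<in> C11" "b \<in> C22" "\<phi> Q = a + b"
    using QA comm by (rule diagonal_cases)
  have "\<phi> Q \<in> Z"
  proof (rule commutes_C12_imp_Z[OF QA comm])
    fix u assume u: "u \<in> C12"
    have uA: "u \<in> A" using u by (rule corner_in)
    have e1: "commutator (commutator u P) P = u" "commutator (commutator P u) P = - u"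
        "commutator (commutator u Q) P = - u"
      using u by (simp_all add: commutator_def)
    have pu: "\<phi> u = P * (\<phi> u * Q) + Q * (\<phi> u * P)"
      using lie_commutator_P_first[OF P uA P_in] e1(1) uA P
      by (simp add: double_commutator_P commutator_Z_right closed P_in)
    have "\<phi> (- u) = commutator (commutator (\<phi> P) u + commutator P (\<phi> u)) P"
      using lie_commutator_P_last[OF P P_in uA] e1(2) by simp
    also have "\<dots> = commutator (commutator P (\<phi> u)) P" using P uA by (simp add: commutator_Z_left)
    finally have n1: "\<phi> (- u) = commutator (commutator P (\<phi> u)) P" .
    have n2: "\<phi> (- u) = commutator (commutator (\<phi> u) Q + commutator u (\<phi> Q)) P"
      using lie_commutator_P_last[OF P uA Q_in] e1(3) by simp
    have q: "commutator (commutator w Q) P = commutator (commutator P w) P" for w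
    proof -
      have Q: "Q = 1 - P" using PQ_sum by (metis add_diff_cancel_left')
      show ?thesis unfolding Q by (simp add: commutator_def algebra_simps)
    qed
    have "commutator (commutator u (\<phi> Q)) P = 0"
    proof -
      have "commutator (v + w) P = commutator v P + commutator w P" for v w
        by (simp add: commutator_def algebra_simps)
      with n1 n2 show ?thesis by (simp add: q)
    qed
    then show "\<phi> Q * u = u * \<phi> Q"
      unfolding ab(3) using ab(1,2) u by (simp add: commutator_def algebra_simps)
  qed
  then show ?thesis using P by unfold_locales
qed

section \<open>Behaviour of a normalized map on off-diagonal elements\<close>

context normalized_lie_derivation
begin

lemma swap: "normalized_lie_derivation A Q P \<phi> m"
proof -
  interpret swap: peirce A Q P by (rule peirce_swap)
  show ?thesis by unfold_locales (fact phi_in lie phi_P phi_Q)+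
qed

lemmas P_first = lie_commutator_P_first[OF phi_P]
lemmas P_last = lie_commutator_P_last[OF phi_P]

lemma phi_off_diagonal:
  assumes r: "r \<in> A"
  shows "\<phi> (P * (r * Q) + Q * (r * P)) = P * (\<phi> r * Q) + Q * (\<phi> r * P)"
  using P_first[OF r P_in] phi_P r P_in
  by (simp add: double_commutator_P commutator_Z_right commutator_closed)

lemma phi_minus_C12:
  assumes x: "x \<in> C12"
  shows "\<phi> (- x) = - \<phi> x"
proof -
  have xA: "x \<in> A" using x by (rule corner_in)
  have e: "commutator (commutator P x) P = - x" using x by (simp add: commutator_def)
  have px: "\<phi> x = P * (\<phi> x * Q) + Q * (\<phi> x * P)" using phi_off_diagonal[OF xA] x by simp
  have "\<phi> (- x) = commutator (commutator P (\<phi> x)) P"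
    using P_last[OF P_in xA] phi_P xA unfolding e by (simp add: commutator_Z_left)
  also have "\<dots> = - (P * (\<phi> x * Q) + Q * (\<phi> x * P))"
  proof -
    have Q: "Q = 1 - P" using PQ_sum by (metis add_diff_cancel_left')
    show ?thesis unfolding Q by (simp add: commutator_def algebra_simps)
  qed
  finally show ?thesis using px by simp
qed

text \<open>The unwanted component \<open>g x\<close> of \<open>\<phi> x\<close> lies in
  \<open>QAP\<close>. For \<open>y\<close> in \<open>PAQ\<close>, twice
  \<open>g x * y - y * g x\<close> is central with square 0, hence 0; its two terms lie in different
  corners, so \<open>y * g x = 0\<close> for all \<open>y\<close>, and faithfulness of
  \<open>P\<close> gives \<open>g x = 0\<close>.\<close>

lemma phi_C12:
  assumes x: "x \<in> C12"
  shows "\<phi> x \<in> C12"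
proof -
  define h where "h x = P * (\<phi> x * Q)" for x
  define g where "g x = Q * (\<phi> x * P)" for x
  have h: "h x \<in> C12" and g: "g x \<in> C21" and dec: "\<phi> x = h x + g x" if "x \<in> C12" for x
    using in_corner phi_in corner_in[OF that] phi_off_diagonal[of x] that
    by (simp_all add: h_def g_def)
  have rel: "g x * y + g y * x = 0 \<and> y * g x + x * g y = 0" if x: "x \<in> C12" and y: "y \<in> C12" for x y
  proof -
    have xA: "x \<in> A" "y \<in> A" using x y by (auto intro: corner_in)
    have "commutator (commutator x P) y = 0" "commutator x P = - x"
      using x y by (simp_all add: commutator_def)
    with P_first[OF xA] have "commutator (commutator (\<phi> x) P) y + commutator (- x) (\<phi> y) = 0"
      by (simp add: phi_zero)
    then have eq: "g x * y + g y * x = y * g x + x * g y"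
      unfolding dec[OF x] dec[OF y] using x y h[OF x] g[OF x] h[OF y] g[OF y]
      by (simp add: commutator_def algebra_simps)
    \<comment> \<open>The two sides of \<open>eq\<close> lie in \<open>QAQ\<close> and
      \<open>PAP\<close> respectively, so both vanish.\<close>
    have "P * (g x * y + g y * x) = 0" using g[OF x] g[OF y] by (simp add: algebra_simps)
    moreover have "P * (y * g x + x * g y) = y * g x + x * g y" using x y by (simp add: algebra_simps)
    ultimately show ?thesis using eq by simp
  qed
  have zero: "y * g x = 0" if y: "y \<in> C12" for y
  proof -
    let ?z = "commutator (\<phi> x) y + commutator x (\<phi> y)"
    have xA: "x \<in> A" "y \<in> A" using x y by (auto intro: corner_in)
    have "commutator x y = 0" using x y by (simp add: commutator_def)
    then have z: "?z \<in> Z" using lie_commuting_pair xA by blast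
    have "g x * y = - (g y * x)" "x * g y = - (y * g x)"
      using rel[OF x y] by (simp_all add: eq_neg_iff_add_eq_0 add.commute)
    then have zeq: "?z = (g x * y + g x * y) - (y * g x + y * g x)"
      unfolding dec[OF x] dec[OF y] using x y h[OF x] g[OF x] h[OF y] g[OF y]
      by (simp add: commutator_def algebra_simps)
    have "g x * x = 0" "x * g x = 0"
      using rel[OF x x] mult_closed corner_in[OF g[OF x]] xA(1) double_zero by blast+
    then have gyg: "g x * (y * g x) = 0"
      using \<open>g x * y = - (g y * x)\<close> by (metis minus_mult_left mult.assoc mult_zero_right)
    have gyg': "g x * (y * (g x * w)) = 0" for w
      using gyg by (metis mult.assoc mult_zero_left)
    have "?z * ?z = 0" unfolding zeq using gyg gyg' g[OF x] y by (simp add: algebra_simps)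
    then have "?z = 0" using z central_nilpotent by blast
    then have "P * (y * g x + y * g x) = P * (g x * y + g x * y)" unfolding zeq by simp
    then have "y * g x + y * g x = 0" using g[OF x] y by (simp add: algebra_simps)
    then show ?thesis using mult_closed corner_in[OF g[OF x]] xA(2) double_zero by blast
  qed
  have "g x = 0"
  proof (rule faithful_lP)
    show "g x \<in> A" using g[OF x] by (rule corner_in)
    show "P * (r * g x) = 0" if "r \<in> A" for r
      using zero[OF in_corner(2)[OF that]] g[OF x] by (simp add: mult.assoc)
  qed
  then show ?thesis using h[OF x] dec[OF x] by simp
qed

text \<open>Since \<open>x = [- x, P]\<close>, the inner \<open>P\<close> of the threefold identity
  is absorbed into \<open>x\<close>.\<close>

lemma lie_C12:
  assumes x: "x \<in> C12" and t: "t \<in> A"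
  shows "\<phi> (commutator x t) = commutator (\<phi> x) t + commutator x (\<phi> t)"
proof -
  have "- x \<in> A" using x by (simp add: minus_closed corner_in)
  from P_first[OF this t] show ?thesis
    using x phi_C12[OF x] by (simp add: phi_minus_C12 commutator_def)
qed

lemma phi_diagonal_commutes:
  assumes "a \<in> A" "P * a = a * P"
  shows "P * \<phi> a = \<phi> a * P"
proof -
  have "commutator a P = 0" using assms by (simp add: commutator_def)
  then have "commutator (\<phi> a) P + commutator a (\<phi> P) \<in> Z"
    using lie_commuting_pair assms(1) P_in by blast
  then show ?thesis
    using commutator_P_Z assms(1) phi_in phi_P by (simp add: commutator_Z_right)
qed

lemma phi_diagonal:
  assumes "a \<in> C11" "b \<in> C22"
  shows "P * (\<phi> (a + b) * P) + Q * (\<phi> (a + b) * Q) = \<phi> (a + b)"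
proof -
  have "a + b \<in> A" using assms by (simp add: add_closed corner_in)
  moreover from this have "P * \<phi> (a + b) = \<phi> (a + b) * P"
    by (rule phi_diagonal_commutes) (use assms in \<open>simp add: algebra_simps\<close>)
  ultimately obtain k l where "k \<in> C11" "l \<in> C22" "\<phi> (a + b) = k + l"
    using diagonal_cases[of "\<phi> (a + b)"] phi_in by blast
  then show ?thesis by (simp add: algebra_simps)
qed

text \<open>\<open>\<phi> (x + y)\<close> is exactly the off-diagonal part of
  \<open>\<phi> r\<close>, so what remains is diagonal and can be tested against \<open>u\<close> in
  \<open>PAQ\<close>. As \<open>[[r, u], P] = [u, a + b]\<close>, the identities for
  \<open>r, u, P\<close> and for \<open>u, a + b\<close> evaluate \<phi> at the same
  element.\<close>

lemma phi_split:
  assumes a: "a \<in> C11" and x: "x \<in> C12" and y: "y \<in> C21" and b: "b \<in> C22"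
  shows "\<phi> (a + b + (x + y)) - \<phi> (a + b) - \<phi> (x + y) \<in> Z"
proof -
  define r where "r = a + b + (x + y)"
  note cA = assms[THEN corner_in]
  have r: "r \<in> A" unfolding r_def using cA by (simp add: add_closed)
  define k where "k = P * (\<phi> r * P)"
  define l where "l = Q * (\<phi> r * Q)"
  have kl: "k \<in> C11" "l \<in> C22"
    unfolding k_def l_def using in_corner phi_in[OF r] by blast+
  have "P * (r * Q) + Q * (r * P) = x + y"
    unfolding r_def using assms by (simp add: algebra_simps)
  with phi_off_diagonal[OF r] have off: "\<phi> (x + y) = P * (\<phi> r * Q) + Q * (\<phi> r * P)" by simp
  have phr: "\<phi> r - \<phi> (x + y) = k + l"
    using peirce_decomp[of "\<phi> r"] unfolding off k_def l_def by (simp add: algebra_simps)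
  have abA: "a + b \<in> A" using cA by (simp add: add_closed)
  obtain k' l' where kl': "k' \<in> C11" "l' \<in> C22" "\<phi> (a + b) = k' + l'"
    using phi_diagonal[OF a b] in_corner phi_in[OF abA] by metis
  have "k + l - \<phi> (a + b) \<in> Z"
  proof (rule commutes_C12_imp_Z)
    show "k + l - \<phi> (a + b) \<in> A"
      using kl[THEN corner_in] phi_in[OF abA] by (simp add: closed)
    show "P * (k + l - \<phi> (a + b)) = (k + l - \<phi> (a + b)) * P"
      unfolding kl'(3) using kl kl' by (simp add: algebra_simps)
    fix u assume u: "u \<in> C12"
    have v: "\<phi> u \<in> C12" using u by (rule phi_C12)
    have uA: "u \<in> A" using u by (rule corner_in)
    have *: "commutator (commutator r w) P = commutator w (a + b)" if "w \<in> C12" for w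
      unfolding r_def using assms that by (simp add: commutator_def algebra_simps)
    have "\<phi> (commutator u (a + b)) = commutator (commutator (\<phi> r) u + commutator r (\<phi> u)) P"
      using P_last[OF r uA] *[OF u] by simp
    also have "\<dots> = commutator (commutator (\<phi> r) u) P + commutator (\<phi> u) (a + b)"
      using *[OF v] by (simp add: commutator_def algebra_simps)
    also have "commutator (commutator (\<phi> r) u) P = commutator u (k + l)"
    proof -
      have pr: "\<phi> r = k + l + (P * (\<phi> r * Q) + Q * (\<phi> r * P))"
        using peirce_decomp[of "\<phi> r"] unfolding k_def l_def by (simp add: algebra_simps)
      show ?thesis by (subst pr) (use kl u in \<open>simp add: commutator_def algebra_simps\<close>)
    qed
    finally have "commutator u (k + l) = commutator u (\<phi> (a + b))"
      using lie_C12[OF u abA] by simp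
    then show "(k + l - \<phi> (a + b)) * u = u * (k + l - \<phi> (a + b))"
      by (simp add: commutator_def algebra_simps)
  qed
  then show ?thesis using phr unfolding r_def by (simp add: algebra_simps)
qed

end

section \<open>Additivity modulo the centre\<close>

context normalized_lie_derivation
begin

text \<open>The sum is produced by \<open>[[P + x, Q + y], P] = - (x + y)\<close>. Because
  \<open>\<phi> P\<close> and \<open>\<phi> Q\<close> are central, \<open>\<phi> (P + x)\<close> and
  \<open>\<phi> (Q + y)\<close> equal \<open>\<phi> x\<close> and \<open>\<phi> y\<close> modulo the
  centre, and commutators do not see the difference.\<close>

lemma phi_add_C12:
  assumes x: "x \<in> C12" and y: "y \<in> C12"
  shows "\<phi> (x + y) = \<phi> x + \<phi> y"
proof -
  have z1: "\<phi> (P + x) - \<phi> P - \<phi> x \<in> Z"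
    using phi_split[OF idem_corner(1) x corner_zero corner_zero] by simp
  have z2: "\<phi> (Q + y) - \<phi> Q - \<phi> y \<in> Z"
    using phi_split[OF corner_zero y corner_zero idem_corner(2)] by simp
  have A: "P + x \<in> A" "Q + y \<in> A" using x y P_in Q_in by (auto intro: add_closed corner_in)
  have z1: "\<phi> (P + x) - \<phi> x \<in> Z" and z2: "\<phi> (Q + y) - \<phi> y \<in> Z"
    using Z_add[OF z1 phi_P] Z_add[OF z2 phi_Q] by simp_all
  have "commutator (commutator (P + x) (Q + y)) P = - (x + y)"
    using x y by (simp add: commutator_def algebra_simps)
  then have "\<phi> (- (x + y)) = commutator (commutator (\<phi> (P + x)) (Q + y) + commutator (P + x) (\<phi> (Q + y))) P"
    using P_last[OF A] by simp
  also have "commutator (\<phi> (P + x)) (Q + y) = commutator (\<phi> x) (Q + y)"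
    using commutator_Z_left[OF z1 A(2)] by (simp add: commutator_def algebra_simps)
  also have "commutator (P + x) (\<phi> (Q + y)) = commutator (P + x) (\<phi> y)"
    using commutator_Z_right[OF z2 A(1)] by (simp add: commutator_def algebra_simps)
  also have "commutator (commutator (\<phi> x) (Q + y) + commutator (P + x) (\<phi> y)) P = - (\<phi> x + \<phi> y)"
    using x y phi_C12[OF x] phi_C12[OF y] by (simp add: commutator_def algebra_simps)
  finally have "- \<phi> (x + y) = - (\<phi> x + \<phi> y)"
    using phi_minus_C12[OF corner_add[OF x y]] by simp
  then show ?thesis by (simp only: neg_equal_iff_equal)
qed

lemmas phi_C21 = normalized_lie_derivation.phi_C12[OF swap]
lemmas phi_add_C21 = normalized_lie_derivation.phi_add_C12[OF swap]
lemmas phi_minus_C21 = normalized_lie_derivation.phi_minus_C12[OF swap]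
lemmas lie_C21 = normalized_lie_derivation.lie_C12[OF swap]

text \<open>The same double commutator now equals \<open>- x + - y\<close>. The sign rule is known
  only inside each corner, so the resulting identity is applied to \<open>- x\<close> and
  \<open>- y\<close>.\<close>

lemma phi_add_C12_C21:
  assumes x: "x \<in> C12" and y: "y \<in> C21"
  shows "\<phi> (x + y) = \<phi> x + \<phi> y"
proof -
  have *: "\<phi> (- x + - y) = - \<phi> x + - \<phi> y" if x: "x \<in> C12" and y: "y \<in> C21" for x y
  proof -
    have z1: "\<phi> (P + x) - \<phi> P - \<phi> x \<in> Z"
      using phi_split[OF idem_corner(1) x corner_zero corner_zero] by simp
    have z2: "\<phi> (Q + y) - \<phi> Q - \<phi> y \<in> Z"
      using phi_split[OF corner_zero corner_zero y idem_corner(2)] by simp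
    have A: "P + x \<in> A" "Q + y \<in> A" using x y P_in Q_in by (auto intro: add_closed corner_in)
    have z1: "\<phi> (P + x) - \<phi> x \<in> Z" and z2: "\<phi> (Q + y) - \<phi> y \<in> Z"
      using Z_add[OF z1 phi_P] Z_add[OF z2 phi_Q] by simp_all
    have "commutator (commutator (P + x) (Q + y)) P = - x + - y"
      using x y by (simp add: commutator_def algebra_simps)
    then have "\<phi> (- x + - y) = commutator (commutator (\<phi> (P + x)) (Q + y) + commutator (P + x) (\<phi> (Q + y))) P"
      using P_last[OF A] by simp
    also have "commutator (\<phi> (P + x)) (Q + y) = commutator (\<phi> x) (Q + y)"
      using commutator_Z_left[OF z1 A(2)] by (simp add: commutator_def algebra_simps)
    also have "commutator (P + x) (\<phi> (Q + y)) = commutator (P + x) (\<phi> y)"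
      using commutator_Z_right[OF z2 A(1)] by (simp add: commutator_def algebra_simps)
    also have "commutator (commutator (\<phi> x) (Q + y) + commutator (P + x) (\<phi> y)) P = - \<phi> x + - \<phi> y"
      using x y phi_C12[OF x] phi_C21[OF y] by (simp add: commutator_def algebra_simps)
    finally show ?thesis .
  qed
  from *[OF corner_minus[OF x] corner_minus[OF y]] show ?thesis
    using x y by (simp add: phi_minus_C12 phi_minus_C21)
qed

text \<open>Commuting with \<open>u\<close> in \<open>PAQ\<close> sends \<open>D\<close> and
  \<open>E\<close> into that corner, where additivity is already exact.\<close>

lemma phi_add_diagonal:
  assumes D: "D \<in> A" "P * D = D * P" and E: "E \<in> A" "P * E = E * P"
  shows "\<phi> (D + E) - \<phi> D - \<phi> E \<in> Z"
proof (rule commutes_C12_imp_Z)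
  have DE: "D + E \<in> A" "P * (D + E) = (D + E) * P"
    using assms by (simp_all add: add_closed distrib_left distrib_right)
  show "\<phi> (D + E) - \<phi> D - \<phi> E \<in> A" using DE D E by (simp add: closed phi_in)
  show "P * (\<phi> (D + E) - \<phi> D - \<phi> E) = (\<phi> (D + E) - \<phi> D - \<phi> E) * P"
    using phi_diagonal_commutes[OF D] phi_diagonal_commutes[OF E] phi_diagonal_commutes[OF DE]
    by (simp add: left_diff_distrib right_diff_distrib)
  fix u assume u: "u \<in> C12"
  have c: "commutator u w \<in> C12" if "w \<in> A" "P * w = w * P" for w
  proof -
    obtain a b where "a \<in> C11" "b \<in> C22" "w = a + b" using \<open>w \<in> A\<close> \<open>P * w = w * P\<close> by (rule diagonal_cases)
    then show ?thesis unfolding commutator_def using u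
      by (simp add: distrib_left distrib_right corner_diff corner_mult)
  qed
  have "commutator u (D + E) = commutator u D + commutator u E"
    by (simp add: commutator_def algebra_simps)
  then have "\<phi> (commutator u (D + E)) = \<phi> (commutator u D) + \<phi> (commutator u E)"
    using phi_add_C12[OF c[OF D] c[OF E]] by simp
  then have "commutator (\<phi> u) (D + E) + commutator u (\<phi> (D + E))
      = commutator (\<phi> u) D + commutator u (\<phi> D) + (commutator (\<phi> u) E + commutator u (\<phi> E))"
    by (simp only: lie_C12[OF u D(1)] lie_C12[OF u E(1)] lie_C12[OF u DE(1)])
  then have "commutator u (\<phi> (D + E)) = commutator u (\<phi> D) + commutator u (\<phi> E)"
    by (simp add: commutator_def algebra_simps)
  then show "(\<phi> (D + E) - \<phi> D - \<phi> E) * u = u * (\<phi> (D + E) - \<phi> D - \<phi> E)"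
    by (simp add: commutator_def algebra_simps)
qed

lemma phi_sum_corners:
  assumes a: "a \<in> C11" and x: "x \<in> C12" and y: "y \<in> C21" and b: "b \<in> C22"
  shows "\<phi> (a + x + y + b) - (\<phi> a + \<phi> x + \<phi> y + \<phi> b) \<in> Z"
proof -
  have "\<phi> (a + b) - \<phi> a - \<phi> b \<in> Z"
    by (rule phi_add_diagonal) (use a b in \<open>simp_all add: corner_in\<close>)
  from Z_add[OF phi_split[OF assms] this] show ?thesis
    unfolding phi_add_C12_C21[OF x y] by (simp add: algebra_simps)
qed

lemma Z_inter_C11: "z \<in> Z \<Longrightarrow> z \<in> C11 \<Longrightarrow> z = 0"
proof (rule faithful_rQ)
  assume z: "z \<in> Z" "z \<in> C11"
  show "z \<in> A" using z(1) by (rule Z_in)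
  fix r assume r: "r \<in> A"
  have "z * (r * Q) = r * Q * z" using z r Q_in by (intro Z_commute mult_closed)
  also have "\<dots> = 0" using z by (simp add: mult.assoc)
  finally show "z * (r * Q) = 0" .
qed

text \<open>Let \<open>l\<close> be the component of \<open>\<phi> a\<close> in \<open>QAQ\<close>.
  As \<open>a\<close> commutes with every \<open>b\<close> in \<open>QAQ\<close>,
  \<open>[l, b] = \<zeta> Q\<close> with \<open>\<zeta>\<close> central; using \<open>l b\<close> in
  place of \<open>b\<close> gives \<open>\<zeta> \<zeta> = 0\<close>, the trick of
  \<open>Z_of_commutators\<close> inside a corner. So \<open>l = z Q\<close> for a central
  \<open>z\<close>, and subtracting \<open>z\<close> moves \<open>\<phi> a\<close> into
  \<open>PAP\<close>.\<close>

lemma phi_C11_corner_central: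
  assumes a: "a \<in> C11"
  obtains z where "z \<in> Z" "\<phi> a - z \<in> C11"
proof -
  have aA: "a \<in> A" using a by (rule corner_in)
  have diag: "P * (\<phi> a * P) + Q * (\<phi> a * Q) = \<phi> a" using phi_diagonal[OF a corner_zero] by simp
  define k where "k = P * (\<phi> a * P)"
  define l where "l = Q * (\<phi> a * Q)"
  have kl: "k \<in> C11" "l \<in> C22" unfolding k_def l_def using in_corner phi_in[OF aA] by blast+
  have phi: "\<phi> a = k + l" using diag by (simp add: k_def l_def)
  have ex: "\<exists>\<zeta>\<in>Z. l * b - b * l = \<zeta> * Q" if b: "b \<in> C22" for b
  proof -
    let ?\<zeta> = "commutator (\<phi> a) b + commutator a (\<phi> b)"
    have bA: "b \<in> A" using b by (rule corner_in)
    have diag': "P * (\<phi> b * P) + Q * (\<phi> b * Q) = \<phi> b"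
      using phi_diagonal[OF corner_zero b] by simp
    have "commutator a b = 0" using a b by (simp add: commutator_def)
    then have "?\<zeta> \<in> Z" using lie_commuting_pair aA bA by blast
    moreover have "?\<zeta> * Q = l * b - b * l"
      unfolding phi by (subst diag'[symmetric]) (use a b kl in \<open>simp add: commutator_def algebra_simps\<close>)
    ultimately show ?thesis by metis
  qed
  have "l * b = b * l" if b: "b \<in> C22" for b
  proof -
    obtain \<zeta> where \<zeta>: "\<zeta> \<in> Z" "l * b - b * l = \<zeta> * Q" using ex[OF b] by blast
    have lb: "l * b \<in> C22" using kl b by (simp add: corner_mult)
    \<comment> \<open>Here \<open>[l, l b] = l [l, b]\<close>, so \<open>l \<zeta> Q\<close> also
      commutes with \<open>b\<close>.\<close>
    obtain \<zeta>' where \<zeta>': "\<zeta>' \<in> Z" "l * (l * b) - (l * b) * l = \<zeta>' * Q" using ex[OF lb] by blast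
    have bA: "b \<in> A" using b by (rule corner_in)
    have c1: "l * (\<zeta> * Q) = \<zeta>' * Q" using \<zeta>(2) \<zeta>'(2) by (metis mult.assoc right_diff_distrib)
    have "\<zeta>' * Q * b = b * (\<zeta>' * Q)"
      using b Z_commute[OF \<zeta>'(1) bA] by (metis corner_left(1) corner_right(1) mult.assoc)
    then have "l * (\<zeta> * Q) * b = b * (l * (\<zeta> * Q))" using c1 by simp
    moreover have "l * (\<zeta> * Q) * b = l * b * \<zeta>"
    proof -
      have "l * (\<zeta> * Q) * b = l * (\<zeta> * b)" using b by (simp add: mult.assoc)
      then show ?thesis by (simp add: Z_commute[OF \<zeta>(1) bA] mult.assoc)
    qed
    moreover have "b * (l * (\<zeta> * Q)) = b * l * \<zeta>"
      using Z_commute[OF \<zeta>(1) Q_in] kl by (simp add: mult.assoc)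
    ultimately have "(l * b - b * l) * \<zeta> = 0" by (simp add: left_diff_distrib)
    then have 0: "\<zeta> * \<zeta> * Q = 0" unfolding \<zeta>(2) using Z_commute[OF \<zeta>(1) Q_in] by (metis mult.assoc)
    have "\<zeta> * \<zeta> = 0"
    proof (rule faithful_rQ)
      show "\<zeta> * \<zeta> \<in> A" using \<zeta>(1) by (simp add: mult_closed Z_in)
      show "\<zeta> * \<zeta> * (r * Q) = 0" if "r \<in> A" for r
        using 0 Z_commute[OF Z_mult[OF \<zeta>(1) \<zeta>(1)] that] by (metis mult.assoc mult_zero_right)
    qed
    then have "\<zeta> = 0" using \<zeta>(1) central_nilpotent by blast
    then show ?thesis using \<zeta>(2) by simp
  qed
  then obtain z where z: "z \<in> Z" "z * Q = l" using lift_Q kl(2) by blast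
  have zA: "z \<in> A" using z by (simp add: Z_in)
  have Pz: "P * z = z * P" and Qz: "Q * z = z * Q"
    using Z_commute[OF z(1) P_in] Z_commute[OF z(1) Q_in] by simp_all
  have "z = z * P + l" using z(2) PQ_sum by (metis distrib_left mult.right_neutral)
  then have "\<phi> a - z = k - P * (z * P)" unfolding phi using Pz
    by (metis (no_types, lifting) add_diff_cancel_right PP mult.assoc)
  also have "\<dots> \<in> C11" using kl(1) in_corner(1)[OF zA] by (rule corner_diff)
  finally show ?thesis using that z(1) by blast
qed

end

section \<open>From Lie identities modulo the centre to an exact derivation\<close>

locale peirce_additive = peirce A P Q for A :: "'a::{ring,monoid_mult} set" and P Q +
  fixes d :: "'a \<Rightarrow> 'a"
  assumes d_add: "r \<in> A \<Longrightarrow> s \<in> A \<Longrightarrow> d (r + s) = d r + d s"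
    and d_C11: "a \<in> C11 \<Longrightarrow> d a \<in> C11" and d_C12: "x \<in> C12 \<Longrightarrow> d x \<in> C12"
    and d_C21: "y \<in> C21 \<Longrightarrow> d y \<in> C21" and d_C22: "b \<in> C22 \<Longrightarrow> d b \<in> C22"
    and d_lie_C12: "x \<in> C12 \<Longrightarrow> t \<in> A
      \<Longrightarrow> d (commutator x t) - (commutator (d x) t + commutator x (d t)) \<in> Z"
    and d_lie_C21: "x \<in> C21 \<Longrightarrow> t \<in> A
      \<Longrightarrow> d (commutator x t) - (commutator (d x) t + commutator x (d t)) \<in> Z"
begin

lemma swap: "peirce_additive A Q P d"
proof -
  interpret swap: peirce A Q P by (rule peirce_swap)
  show ?thesis by unfold_locales (fact d_add d_C11 d_C12 d_C21 d_C22 d_lie_C12 d_lie_C21)+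
qed

lemma d_zero: "d 0 = 0"
  using d_add[OF zero_closed zero_closed] by simp

lemma d_minus: "r \<in> A \<Longrightarrow> d (- r) = - d r"
  using d_add[of r "- r"] minus_closed[of r] d_zero by (simp add: eq_neg_iff_add_eq_0 add.commute)

lemma d_diff: "r \<in> A \<Longrightarrow> s \<in> A \<Longrightarrow> d (r - s) = d r - d s"
  using d_add[of r "- s"] minus_closed[of s] d_minus[of s] by simp

lemma Z_inter_C12: "z \<in> Z \<Longrightarrow> z \<in> C12 \<Longrightarrow> z = 0"
  using Z_commute[of z P] P_in by simp

text \<open>\<open>a x\<close> is a commutator up to sign, and the error is both central and in
  \<open>PAQ\<close>, hence 0.\<close>

lemma d_11_12:
  assumes a: "a \<in> C11" and x: "x \<in> C12"
  shows "d (a * x) = d a * x + a * d x"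
proof -
  have A: "a \<in> A" "x \<in> A" "a * x \<in> A" using a x by (auto intro: corner_in mult_closed)
  have "commutator x a = - (a * x)" using a x by (simp add: commutator_def)
  then have "d a * x + a * d x - d (a * x) \<in> Z"
    using d_lie_C12[OF x A(1)] a x d_C11[OF a] d_C12[OF x] A
    by (simp add: d_minus commutator_def algebra_simps)
  moreover have "d a * x + a * d x - d (a * x) \<in> C12"
    using a x d_C11[OF a] d_C12[OF x] d_C12[of "a * x"]
    by (meson corner_add corner_diff corner_mult)
  ultimately have "d a * x + a * d x - d (a * x) = 0" by (rule Z_inter_C12)
  then show ?thesis by simp
qed

lemma d_12_22:
  assumes x: "x \<in> C12" and b: "b \<in> C22"
  shows "d (x * b) = d x * b + x * d b"
proof -
  have A: "b \<in> A" "x \<in> A" "x * b \<in> A" using b x by (auto intro: corner_in mult_closed)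
  have "commutator x b = x * b" using b x by (simp add: commutator_def)
  then have "d (x * b) - (d x * b + x * d b) \<in> Z"
    using d_lie_C12[OF x A(1)] b x d_C22[OF b] d_C12[OF x] A
    by (simp add: commutator_def algebra_simps)
  moreover have "d (x * b) - (d x * b + x * d b) \<in> C12"
    using b x d_C22[OF b] d_C12[OF x] d_C12[of "x * b"]
    by (meson corner_add corner_diff corner_mult)
  ultimately have "d (x * b) - (d x * b + x * d b) = 0" by (rule Z_inter_C12)
  then show ?thesis by simp
qed

text \<open>The product of two elements of \<open>PAP\<close> is not a commutator with an
  off-diagonal factor, so such a factor is supplied: \<open>d (a b x)\<close> is expanded in two
  ways for \<open>x\<close> in \<open>PAQ\<close>, and \<open>x\<close> is cancelled by faithfulness
  of \<open>Q\<close>.\<close>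

lemma d_11_11:
  assumes a: "a \<in> C11" and b: "b \<in> C11"
  shows "d (a * b) = d a * b + a * d b"
proof -
  have ab: "a * b \<in> C11" using a b by (rule corner_mult)
  have "d (a * b) - (d a * b + a * d b) = 0"
  proof (rule faithful_rQ)
    show "d (a * b) - (d a * b + a * d b) \<in> A"
      using a b ab d_C11 by (auto intro!: closed intro: corner_in)
    fix r assume "r \<in> A"
    then have x: "P * (r * Q) \<in> C12" (is "?x \<in> _") by (rule in_corner)
    have bx: "b * ?x \<in> C12" using b x by (rule corner_mult)
    have "d (a * b) * ?x + a * b * d ?x = d (a * (b * ?x))"
      using d_11_12[OF ab x] by (simp only: mult.assoc)
    also have "\<dots> = d a * (b * ?x) + a * (d b * ?x + b * d ?x)"
      using d_11_12[OF a bx] d_11_12[OF b x] by simp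
    finally have "(d (a * b) - (d a * b + a * d b)) * ?x = 0"
      by (simp only: mult.assoc distrib_left distrib_right left_diff_distrib)
        (simp only: add_diff_add diff_self add_0_right diff_eq_eq add.assoc[symmetric] add_right_cancel add_0_left)
    then show "(d (a * b) - (d a * b + a * d b)) * (r * Q) = 0"
      using a b d_C11[OF a] d_C11[OF b] d_C11[OF ab] by (simp add: algebra_simps)
  qed
  then show ?thesis by simp
qed

text \<open>The Lie identity controls only the difference \<open>z\<close> of the defects
  \<open>\<alpha> x\<close> and \<open>\<beta> x\<close>. Associativity and centrality of
  \<open>z\<close> yield \<open>\<alpha> x * x = 0\<close> and
  \<open>\<alpha> x * u = - (\<alpha> u * x)\<close>, whence
  \<open>z z u = - \<alpha> u z x = 0\<close> and so \<open>z = 0\<close>. The defects lie in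
  different corners, so each of them is 0.\<close>

lemma d_12_21:
  assumes x: "x \<in> C12" and y: "y \<in> C21"
  shows "d (x * y) = d x * y + x * d y" "d (y * x) = d y * x + y * d x"
proof -
  define \<alpha> where "\<alpha> x = d (x * y) - (d x * y + x * d y)" for x
  define \<beta> where "\<beta> x = d (y * x) - (d y * x + y * d x)" for x
  have \<alpha>: "\<alpha> x \<in> C11" and \<beta>: "\<beta> x \<in> C22" if "x \<in> C12" for x
    unfolding \<alpha>_def \<beta>_def using that y d_C12[OF that] d_C21[OF y] d_C11[of "x * y"] d_C22[of "y * x"]
    by (meson corner_add corner_diff corner_mult)+
  have yA: "y \<in> A" using y by (rule corner_in)
  have \<zeta>: "\<alpha> x - \<beta> x \<in> Z" if x: "x \<in> C12" for x
  proof -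
    have A: "x * y \<in> A" "y * x \<in> A" using x y by (auto intro: corner_in mult_closed)
    then have eq: "d (commutator x y) = d (x * y) - d (y * x)" by (simp add: commutator_def d_diff)
    show ?thesis using d_lie_C12[OF x yA] unfolding eq
      by (simp add: \<alpha>_def \<beta>_def commutator_def algebra_simps)
  qed
  \<comment> \<open>The two ways of bracketing \<open>d (x * y * u)\<close>.\<close>
  have assoc: "\<alpha> x * u = x * \<beta> u" if x: "x \<in> C12" and u: "u \<in> C12" for x u
  proof -
    have xy: "x * y \<in> C11" and yu: "y * u \<in> C22" using x y u by (auto intro: corner_mult)
    have "d (x * y) * u + x * y * d u = d x * (y * u) + x * d (y * u)"
      using d_11_12[OF xy u] d_12_22[OF x yu] by (simp only: mult.assoc)
    then show ?thesis by (simp add: \<alpha>_def \<beta>_def algebra_simps)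
  qed
  have comm: "\<alpha> x * u = - (u * \<beta> x)" if x: "x \<in> C12" and u: "u \<in> C12" for x u
    using Z_commute[OF \<zeta>[OF x] corner_in[OF u]] \<alpha>[OF x] \<beta>[OF x] u by (simp add: algebra_simps)
  have sq: "\<alpha> x * x = 0" if x: "x \<in> C12" for x
  proof (rule double_zero)
    show "\<alpha> x * x \<in> A" using corner_in[OF \<alpha>[OF x]] corner_in[OF x] by (rule mult_closed)
    have "\<alpha> x * x = - (\<alpha> x * x)" using assoc[OF x x] comm[OF x x] by metis
    then show "\<alpha> x * x + \<alpha> x * x = 0" by (simp only: eq_neg_iff_add_eq_0)
  qed
  have "\<alpha> x - \<beta> x = 0"
  proof (rule Z_square_C12)
    show "\<alpha> x - \<beta> x \<in> Z" using x by (rule \<zeta>)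
    fix u assume u: "u \<in> C12"
    have "\<alpha> x * u = - (\<alpha> u * x)" using assoc[OF x u] comm[OF u x] by simp
    then have "(\<alpha> x - \<beta> x) * ((\<alpha> x - \<beta> x) * u) = - (\<alpha> x * (\<alpha> u * x))"
      using \<alpha>[OF x] \<alpha>[OF u] \<beta>[OF x] u by (simp add: algebra_simps)
    also have "\<alpha> x * (\<alpha> u * x) = (\<alpha> x - \<beta> x) * (\<alpha> u * x)"
      using \<beta>[OF x] \<alpha>[OF u] by (simp add: algebra_simps)
    also have "\<dots> = \<alpha> u * ((\<alpha> x - \<beta> x) * x)"
      using Z_commute[OF \<zeta>[OF x] corner_in[OF \<alpha>[OF u]]] by (metis mult.assoc)
    also have "(\<alpha> x - \<beta> x) * x = 0" using sq[OF x] \<beta>[OF x] x by (simp add: algebra_simps)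
    finally show "(\<alpha> x - \<beta> x) * ((\<alpha> x - \<beta> x) * u) = 0" by simp
  qed
  then have eq: "\<alpha> x = \<beta> x" by simp
  moreover have "P * \<alpha> x = \<alpha> x" "P * \<beta> x = 0" using \<alpha>[OF x] \<beta>[OF x] by simp_all
  ultimately have "\<alpha> x = 0" "\<beta> x = 0" by simp_all
  then show "d (x * y) = d x * y + x * d y" "d (y * x) = d y * x + y * d x"
    by (simp_all add: \<alpha>_def \<beta>_def)
qed

lemma derivation:
  shows "r \<in> A \<Longrightarrow> d r \<in> A"
    and "r \<in> A \<Longrightarrow> s \<in> A \<Longrightarrow> d (r * s) = d r * s + r * d s"
proof -
  note d_22_21 = peirce_additive.d_11_12[OF swap]
  note d_21_11 = peirce_additive.d_12_22[OF swap]
  note d_22_22 = peirce_additive.d_11_11[OF swap]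
  have split: "d (a + x + y + b) = d a + d x + d y + d b"
    if "a \<in> C11" "x \<in> C12" "y \<in> C21" "b \<in> C22" for a x y b
    using that[THEN corner_in] by (simp add: d_add add_closed)
  show "d r \<in> A" if r: "r \<in> A"
  proof -
    obtain a x y b where "a \<in> C11" "x \<in> C12" "y \<in> C21" "b \<in> C22" "r = a + x + y + b"
      using r by (rule peirce_cases)
    then show ?thesis
      using split[of a x y b] d_C11[of a] d_C12[of x] d_C21[of y] d_C22[of b]
      by (simp add: add_closed corner_in)
  qed
  assume r: "r \<in> A" and s: "s \<in> A"
  obtain a x y b where r4: "a \<in> C11" "x \<in> C12" "y \<in> C21" "b \<in> C22" "r = a + x + y + b"
    using r by (rule peirce_cases)
  obtain a' x' y' b' where s4: "a' \<in> C11" "x' \<in> C12" "y' \<in> C21" "b' \<in> C22" "s = a' + x' + y' + b'"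
    using s by (rule peirce_cases)
  note dr = d_C11[OF r4(1)] d_C12[OF r4(2)] d_C21[OF r4(3)] d_C22[OF r4(4)]
  note ds = d_C11[OF s4(1)] d_C12[OF s4(2)] d_C21[OF s4(3)] d_C22[OF s4(4)]
  have mem: "a * a' + x * y' \<in> C11" "a * x' + x * b' \<in> C12"
      "y * a' + b * y' \<in> C21" "y * x' + b * b' \<in> C22"
    using r4 s4 by (meson corner_add corner_mult)+
  have "r * s = (a * a' + x * y') + (a * x' + x * b') + (y * a' + b * y') + (y * x' + b * b')"
    unfolding r4(5) s4(5) using r4(1-4) s4(1-4) by (simp add: algebra_simps)
  then have "d (r * s) = d (a * a' + x * y') + d (a * x' + x * b') + d (y * a' + b * y') + d (y * x' + b * b')"
    using split[OF mem] by simp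
  also have "\<dots> = d (a * a') + d (x * y') + (d (a * x') + d (x * b'))
      + (d (y * a') + d (b * y')) + (d (y * x') + d (b * b'))"
    using r4(1-4)[THEN corner_in] s4(1-4)[THEN corner_in] by (simp add: d_add mult_closed)
  also have "\<dots> = d r * s + r * d s"
    unfolding r4(5) s4(5) split[OF r4(1-4)] split[OF s4(1-4)]
      d_11_11[OF r4(1) s4(1)] d_12_21(1)[OF r4(2) s4(3)] d_11_12[OF r4(1) s4(2)]
      d_12_22[OF r4(2) s4(4)] d_21_11[OF r4(3) s4(1)] d_22_21[OF r4(4) s4(3)]
      d_12_21(2)[OF s4(2) r4(3)] d_22_22[OF r4(4) s4(4)]
    using r4(1-4) s4(1-4) dr ds by (simp add: algebra_simps)
  finally show "d (r * s) = d r * s + r * d s" .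
qed

end

section \<open>Correction by central values and reduction to the normalized case\<close>

lemma (in normalized_lie_derivation) derivation_mod_center:
  obtains d where "additive_derivation A d" "\<And>r. r \<in> A \<Longrightarrow> \<phi> r - d r \<in> Z"
proof -
  have "\<exists>z\<in>Z. \<phi> a - z \<in> C11" if "a \<in> C11" for a
    using phi_C11_corner_central[OF that] by blast
  then obtain z1 where z1: "z1 a \<in> Z" "\<phi> a - z1 a \<in> C11" if "a \<in> C11" for a by metis
  have "\<exists>z\<in>Z. \<phi> a - z \<in> C22" if "a \<in> C22" for a
    using normalized_lie_derivation.phi_C11_corner_central[OF swap that] by blast
  then obtain z2 where z2: "z2 b \<in> Z" "\<phi> b - z2 b \<in> C22" if "b \<in> C22" for b by metis
  define d1 where "d1 a = \<phi> a - z1 a" for a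
  define d2 where "d2 b = \<phi> b - z2 b" for b
  define d where "d r = d1 (P * (r * P)) + \<phi> (P * (r * Q)) + \<phi> (Q * (r * P)) + d2 (Q * (r * Q))" for r
  have d1: "d1 a \<in> C11" if "a \<in> C11" for a using z1[OF that] by (simp add: d1_def)
  have d2: "d2 a \<in> C22" if "a \<in> C22" for a using z2[OF that] by (simp add: d2_def)
  note Z_inter_C22 = normalized_lie_derivation.Z_inter_C11[OF swap]
  \<comment> \<open>The values \<open>z1 a\<close> are arbitrary choices; \<open>d1\<close> is
    nevertheless additive, because its defect lies in the centre and in \<open>PAP\<close>.\<close>
  have d1_add: "d1 (a + b) = d1 a + d1 b" if a: "a \<in> C11" and b: "b \<in> C11" for a b
  proof -
    have ab: "a + b \<in> C11" using a b by (rule corner_add)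
    have "\<phi> (a + b) - \<phi> a - \<phi> b \<in> Z"
      by (rule phi_add_diagonal) (use a b in \<open>simp_all add: corner_in\<close>)
    then have "\<phi> (a + b) - \<phi> a - \<phi> b - z1 (a + b) + z1 a + z1 b \<in> Z"
      using z1(1)[OF a] z1(1)[OF b] z1(1)[OF ab] by (simp add: Z_add Z_diff)
    then have "d1 (a + b) - d1 a - d1 b \<in> Z" by (simp add: d1_def algebra_simps)
    moreover have "d1 (a + b) - d1 a - d1 b \<in> C11"
      using d1[OF a] d1[OF b] d1[OF ab] by (simp add: corner_diff)
    ultimately have "d1 (a + b) - d1 a - d1 b = 0" by (rule Z_inter_C11)
    then show ?thesis by (simp add: algebra_simps)
  qed
  have d2_add: "d2 (a + b) = d2 a + d2 b" if a: "a \<in> C22" and b: "b \<in> C22" for a b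
  proof -
    have ab: "a + b \<in> C22" using a b by (rule corner_add)
    have "\<phi> (a + b) - \<phi> a - \<phi> b \<in> Z"
      by (rule phi_add_diagonal) (use a b in \<open>simp_all add: corner_in\<close>)
    then have "\<phi> (a + b) - \<phi> a - \<phi> b - z2 (a + b) + z2 a + z2 b \<in> Z"
      using z2(1)[OF a] z2(1)[OF b] z2(1)[OF ab] by (simp add: Z_add Z_diff)
    then have "d2 (a + b) - d2 a - d2 b \<in> Z" by (simp add: d2_def algebra_simps)
    moreover have "d2 (a + b) - d2 a - d2 b \<in> C22"
      using d2[OF a] d2[OF b] d2[OF ab] by (simp add: corner_diff)
    ultimately have "d2 (a + b) - d2 a - d2 b = 0" by (rule Z_inter_C22)
    then show ?thesis by (simp add: algebra_simps)
  qed
  have zero: "d1 0 = 0" "d2 0 = 0"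
    using d1_add[OF corner_zero corner_zero] d2_add[OF corner_zero corner_zero] by simp_all
  have mod_Z: "\<phi> r - d r \<in> Z" if r: "r \<in> A" for r
  proof -
    note c = in_corner[OF r]
    from phi_sum_corners[OF c] peirce_decomp[of r, symmetric]
    have "\<phi> r - (\<phi> (P * (r * P)) + \<phi> (P * (r * Q)) + \<phi> (Q * (r * P)) + \<phi> (Q * (r * Q))) \<in> Z"
      by simp
    from Z_add[OF this Z_add[OF z1(1)[OF c(1)] z2(1)[OF c(4)]]]
    show ?thesis by (simp add: d_def d1_def d2_def algebra_simps)
  qed
  have d12: "d x = \<phi> x" if "x \<in> C12" for x using that by (simp add: d_def zero phi_zero)
  have d21: "d x = \<phi> x" if "x \<in> C21" for x using that by (simp add: d_def zero phi_zero)
  \<comment> \<open>The central difference at \<open>t\<close> drops out of the commutator, so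
    replacing \<phi> by \<open>d\<close> costs only a central term at \<open>[x, t]\<close>.\<close>
  have lie_mod: "d (commutator x t) - (commutator (d x) t + commutator x (d t)) \<in> Z"
    if x: "x \<in> A" "d x = \<phi> x" and t: "t \<in> A"
      and lie: "\<phi> (commutator x t) = commutator (\<phi> x) t + commutator x (\<phi> t)" for x t
  proof -
    have "commutator x (\<phi> t - d t) = 0" using mod_Z[OF t] x(1) by (rule commutator_Z_right)
    then have "commutator x (d t) = commutator x (\<phi> t)"
      by (simp add: commutator_def algebra_simps)
    then show ?thesis using Z_minus[OF mod_Z[OF commutator_closed[OF x(1) t]]] lie x(2) by simp
  qed
  interpret d: peirce_additive A P Q d
  proof
    fix r s assume A: "r \<in> A" "s \<in> A"
    show "d (r + s) = d r + d s"
      using d1_add[OF in_corner(1)[OF A(1)] in_corner(1)[OF A(2)]]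
        phi_add_C12[OF in_corner(2)[OF A(1)] in_corner(2)[OF A(2)]]
        phi_add_C21[OF in_corner(3)[OF A(1)] in_corner(3)[OF A(2)]]
        d2_add[OF in_corner(4)[OF A(1)] in_corner(4)[OF A(2)]]
      by (simp add: d_def distrib_left distrib_right)
  next
    show "d a \<in> C11" if "a \<in> C11" for a using d1[OF that] that by (simp add: d_def zero phi_zero)
    show "d a \<in> C22" if "a \<in> C22" for a using d2[OF that] that by (simp add: d_def zero phi_zero)
    show "d x \<in> C12" if "x \<in> C12" for x using phi_C12[OF that] d12[OF that] by simp
    show "d x \<in> C21" if "x \<in> C21" for x using phi_C21[OF that] d21[OF that] by simp
    show "d (commutator x t) - (commutator (d x) t + commutator x (d t)) \<in> Z"
      if "x \<in> C12" "t \<in> A" for x t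
      using lie_mod lie_C12 that d12 corner_in by blast
    show "d (commutator x t) - (commutator (d x) t + commutator x (d t)) \<in> Z"
      if "x \<in> C21" "t \<in> A" for x t
      using lie_mod lie_C21 that d21 corner_in by blast
  qed
  have "additive_derivation A d"
    unfolding additive_derivation_def using d.derivation d.d_add by auto
  then show ?thesis using that mod_Z by blast
qed

lemma (in lie_derivation) derivation_mod_center:
  obtains d where "additive_derivation A d" "\<And>r. r \<in> A \<Longrightarrow> \<phi> r - d r \<in> Z"
proof -
  \<comment> \<open>Chosen so that \<open>[P, T]\<close> is the off-diagonal part of
    \<open>\<phi> P\<close>; subtracting this inner derivation makes the value at \<open>P\<close>
    diagonal, as \<open>phi_P_in_Z\<close> requires.\<close>
  define T where "T = P * (\<phi> P * Q) - Q * (\<phi> P * P)"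
  let ?\<delta> = "\<lambda>r. commutator r T"
  have T: "T \<in> A" unfolding T_def using phi_in P_in Q_in by (simp add: closed)
  have inner: "?\<delta> (commutator x y) = commutator (?\<delta> x) y + commutator x (?\<delta> y)" for x y
    by (simp add: commutator_def algebra_simps)
  interpret \<psi>: lie_derivation A P Q "\<lambda>r. \<phi> r - ?\<delta> r" m
  proof
    show "\<phi> r - ?\<delta> r \<in> A" if "r \<in> A" for r using that T by (simp add: closed phi_in)
    fix x :: "nat \<Rightarrow> 'a" assume x: "\<And>i. x i \<in> A"
    have "leibniz_sum (2 * m + 3) x (\<lambda>i. ?\<delta> (x i)) = ?\<delta> (iter_commutator (2 * m + 3) x)"
      using leibniz_sum_derivation[of ?\<delta> "2 * m + 2" x] inner x by (simp add: numeral_3_eq_3)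
    then show "\<phi> (iter_commutator (2 * m + 3) x) - ?\<delta> (iter_commutator (2 * m + 3) x)
        = leibniz_sum (2 * m + 3) x (\<lambda>i. \<phi> (x i) - ?\<delta> (x i))"
      using lie[OF x] by (simp only: leibniz_sum_diff)
  qed
  have "P * (\<phi> P - ?\<delta> P) = (\<phi> P - ?\<delta> P) * P"
  proof -
    have "\<phi> P * P - Q * (\<phi> P * P) = P * (\<phi> P * P)" "P * \<phi> P - P * (\<phi> P * Q) = P * (\<phi> P * P)"
      using peirce_decomp[of "\<phi> P"] by (metis add_diff_cancel_right' distrib_right PQ_sum mult_1)
        (metis add_diff_cancel_left' diff_add_cancel distrib_left PQ_sum mult.right_neutral)
    then show ?thesis by (simp add: commutator_def T_def algebra_simps)
  qed
  then interpret \<psi>: normalized_lie_derivation A P Q "\<lambda>r. \<phi> r - ?\<delta> r" m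
    by (intro \<psi>.normalized \<psi>.phi_P_in_Z)
  obtain d where d: "additive_derivation A d" "\<And>r. r \<in> A \<Longrightarrow> \<phi> r - ?\<delta> r - d r \<in> Z"
    using \<psi>.derivation_mod_center by blast
  have "additive_derivation A (\<lambda>r. ?\<delta> r + d r)"
    using d(1) T unfolding additive_derivation_def
    by (auto simp: closed Pi_iff) (simp_all add: commutator_def algebra_simps)
  moreover have "\<phi> r - (?\<delta> r + d r) \<in> Z" if "r \<in> A" for r
    using d(2)[OF that] by (simp add: algebra_simps)
  ultimately show ?thesis using that by blast
qed

lemma (in peirce) nonlinear_Lie_n_derivation_structure:
  assumes n: "n \<ge> 2" and lie: "nonlinear_Lie_n_derivation n A \<phi>"
  obtains d where "additive_derivation A d" "\<And>r. r \<in> A \<Longrightarrow> \<phi> r - d r \<in> Z"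
    "\<And>x. x \<in> {1..n} \<rightarrow> A \<Longrightarrow> \<phi> (iter_commutator n x) = d (iter_commutator n x)"
proof -
  have phi_in: "\<phi> r \<in> A" if "r \<in> A" for r
    using lie that by (auto simp: nonlinear_Lie_n_derivation_def)
  have lie': "\<phi> (iter_commutator n x) = leibniz_sum n x (\<lambda>i. \<phi> (x i))"
    if "x \<in> {1..n} \<rightarrow> A" for x
    using lie that sum_iter_commutator[of n x "\<lambda>i. \<phi> (x i)"]
    by (simp add: nonlinear_Lie_n_derivation_def)
  obtain m where m: "n = Suc (Suc m)" using n by (metis add_2_eq_Suc le_Suc_ex)
  interpret L: lie_derivation A P Q \<phi> m
  proof
    show "\<phi> r \<in> A" if "r \<in> A" for r using that by (rule phi_in)
    fix x :: "nat \<Rightarrow> 'a" assume x: "\<And>i. x i \<in> A"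
    \<comment> \<open>A Lie \<open>n\<close>-derivation is a Lie \<open>(2n-1)\<close>-derivation, and \<open>2n - 1\<close> is odd.\<close>
    let ?x = "\<lambda>i. if i = 1 then iter_commutator n x else x (n + i - 1)"
    have N: "2 * m + 3 = n + Suc m" "Suc (Suc m) = n" using m by simp_all
    have it: "iter_commutator n x \<in> A" using x by (simp add: iter_commutator_closed)
    have "\<phi> (iter_commutator (2 * m + 3) x) = \<phi> (iter_commutator n ?x)"
      unfolding N(1) using iter_commutator_concat[of n "Suc m" x] n N(2) by simp
    also have "\<dots> = leibniz_sum n ?x (\<lambda>i. \<phi> (?x i))" by (rule lie') (use x it in auto)
    also have "(\<lambda>i. \<phi> (?x i)) = (\<lambda>i. if i = 1 then leibniz_sum n x (\<lambda>i. \<phi> (x i)) else \<phi> (x (n + i - 1)))"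
      using lie'[of x] x by auto
    also have "leibniz_sum n ?x \<dots> = leibniz_sum (2 * m + 3) x (\<lambda>i. \<phi> (x i))"
      unfolding N(1) using leibniz_sum_concat[of n "Suc m" x "\<lambda>i. \<phi> (x i)"] n N(2) by simp
    finally show "\<phi> (iter_commutator (2 * m + 3) x) = leibniz_sum (2 * m + 3) x (\<lambda>i. \<phi> (x i))" .
  qed
  obtain d where d: "additive_derivation A d" "\<And>r. r \<in> A \<Longrightarrow> \<phi> r - d r \<in> Z"
    using L.derivation_mod_center by blast
  have "\<phi> (iter_commutator n x) = d (iter_commutator n x)" if x: "x \<in> {1..n} \<rightarrow> A" for x
  proof -
    have dA: "d r \<in> A" if "r \<in> A" for r using d(1) that by (auto simp: additive_derivation_def)
    have dadd: "d (r + s) = d r + d s" if "r \<in> A" "s \<in> A" for r s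
      using d(1) that by (simp add: additive_derivation_def)
    have dmult: "d (r * s) = d r * s + r * d s" if "r \<in> A" "s \<in> A" for r s
      using d(1) that by (simp add: additive_derivation_def)
    have ddiff: "d (r - s) = d r - d s" if "r \<in> A" "s \<in> A" for r s
      using dadd[of "r - s" s] that by (simp add: diff_closed)
    have dlie: "d (commutator r s) = commutator (d r) s + commutator r (d s)"
      if "r \<in> A" "s \<in> A" for r s
      using that by (simp add: commutator_def ddiff dmult mult_closed algebra_simps)
    have xi: "x i \<in> A" if "1 \<le> i" "i \<le> n" for i using x that by auto
    \<comment> \<open>\<phi> and \<open>d\<close> differ by central values, so their Leibniz sums
      coincide.\<close>
    have "leibniz_sum n x (\<lambda>i. \<phi> (x i)) - leibniz_sum n x (\<lambda>i. d (x i)) = 0"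
      unfolding leibniz_sum_diff[symmetric] m
      by (rule leibniz_sum_Z) (use xi d(2) m in auto)
    moreover have "leibniz_sum n x (\<lambda>i. d (x i)) = d (iter_commutator n x)"
      unfolding m by (rule leibniz_sum_derivation) (use dlie xi m in auto)
    ultimately show ?thesis using lie'[OF x] by simp
  qed
  with d that show ?thesis by blast
qed

subsection \<open>Complex Hilbert spaces\<close>

lemma cinner_add_right: "cinner x (y + z) = cinner x y + cinner (x::'h::complex_hilbert) z"
  by (metis cinner_add_left cinner_commute complex_cnj_add)

lemma cinner_scaleC_right: "cinner x (a *\<^sub>C y) = cnj a * cinner (x::'h::complex_hilbert) y"
  by (metis cinner_scaleC_left cinner_commute complex_cnj_mult)

lemma scaleC_minus_left: "(- a) *\<^sub>C x = - (a *\<^sub>C (x::'h::complex_hilbert))"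
proof -
  have "0 *\<^sub>C x = 0" using scaleR_scaleC[of 0 x] by simp
  then show ?thesis using scaleC_add_left[of a "- a" x] by (simp add: eq_neg_iff_add_eq_0 add.commute)
qed

lemma scaleC_one: "1 *\<^sub>C x = (x::'h::complex_hilbert)"
  using scaleR_scaleC[of 1 x] by simp

lemma cinner_zero_left [simp]: "cinner 0 (x::'h::complex_hilbert) = 0"
  using cinner_add_left[of 0 0 x] by simp

lemma cinner_zero_right [simp]: "cinner (x::'h::complex_hilbert) 0 = 0"
  using cinner_add_right[of x 0 0] by simp

lemma cinner_minus_left: "cinner (- x) y = - cinner (x::'h::complex_hilbert) y"
  using cinner_add_left[of x "- x" y] by (simp add: eq_neg_iff_add_eq_0 add.commute)

lemma cinner_minus_right: "cinner x (- y) = - cinner (x::'h::complex_hilbert) y"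
  using cinner_add_right[of x y "- y"] by (simp add: eq_neg_iff_add_eq_0 add.commute)

lemma cinner_diff_left: "cinner (x - y) z = cinner x z - cinner (y::'h::complex_hilbert) z"
  using cinner_add_left[of x "- y" z] by (simp add: cinner_minus_left)

lemma cinner_diff_right: "cinner x (y - z) = cinner x y - cinner (x::'h::complex_hilbert) z"
  using cinner_add_right[of x y "- z"] by (simp add: cinner_minus_right)

lemma cinner_scaleR_left: "cinner (r *\<^sub>R x) y = of_real r * cinner (x::'h::complex_hilbert) y"
  by (simp add: scaleR_scaleC cinner_scaleC_left)

lemma cinner_scaleR_right: "cinner x (r *\<^sub>R y) = of_real r * cinner (x::'h::complex_hilbert) y"
  by (simp add: scaleR_scaleC cinner_scaleC_right)

lemmas cinner_simps = cinner_add_left cinner_add_right cinner_diff_left cinner_diff_right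
  cinner_minus_left cinner_minus_right cinner_scaleR_left cinner_scaleR_right

lemma Re_cinner_commute: "Re (cinner y x) = Re (cinner x (y::'h::complex_hilbert))"
  by (subst cinner_commute) simp

lemma Re_cinner_self: "Re (cinner x x) = (norm (x::'h::complex_hilbert))\<^sup>2"
  by (simp add: cinner_self)

lemma norm_add_square:
  "(norm (x + y))\<^sup>2 = (norm x)\<^sup>2 + 2 * Re (cinner x y) + (norm (y::'h::complex_hilbert))\<^sup>2"
  unfolding Re_cinner_self[symmetric] by (simp add: cinner_simps Re_cinner_commute[of y x])

lemma norm_diff_square:
  "(norm (x - y))\<^sup>2 = (norm x)\<^sup>2 - 2 * Re (cinner x y) + (norm (y::'h::complex_hilbert))\<^sup>2"
  unfolding Re_cinner_self[symmetric] by (simp add: cinner_simps Re_cinner_commute[of y x])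

lemma norm_scaleC: "norm (a *\<^sub>C x) = cmod a * norm (x::'h::complex_hilbert)"
proof -
  have "complex_of_real ((norm (a *\<^sub>C x))\<^sup>2) = (a * cnj a) * complex_of_real ((norm x)\<^sup>2)"
    unfolding cinner_self[symmetric] by (simp add: cinner_scaleC_left cinner_scaleC_right)
  also have "\<dots> = complex_of_real ((cmod a * norm x)\<^sup>2)"
    by (simp add: complex_norm_square[symmetric] power_mult_distrib)
  finally have "(norm (a *\<^sub>C x))\<^sup>2 = (cmod a * norm x)\<^sup>2" by (simp only: of_real_eq_iff)
  then show ?thesis by (simp add: power2_eq_iff_nonneg)
qed

lemma Re_cinner_le: "Re (cinner x y) \<le> norm x * norm (y::'h::complex_hilbert)"
proof (cases "x = 0 \<or> y = 0")
  case False
  then have pos: "norm x * norm y > 0" by simp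
  have "0 \<le> (norm (norm y *\<^sub>R x - norm x *\<^sub>R y))\<^sup>2" by simp
  also have "\<dots> = 2 * (norm x * norm y) * (norm x * norm y - Re (cinner x y))"
    unfolding norm_diff_square by (simp add: cinner_simps algebra_simps power2_eq_square)
  finally have "0 \<le> norm x * norm y - Re (cinner x y)"
    using pos by (metis mult_pos_pos zero_le_mult_iff zero_less_numeral not_less)
  then show ?thesis by simp
qed auto

text \<open>Real and imaginary part are estimated separately; the factor 2 is not sharp, but
  boundedness is all that is asked.\<close>

lemma cmod_cinner_le: "cmod (cinner x y) \<le> norm x * norm (y::'h::complex_hilbert) * 2"
proof -
  have re: "\<bar>Re (cinner x y)\<bar> \<le> norm x * norm y" for x y :: 'h
    using Re_cinner_le[of x y] Re_cinner_le[of "- x" y] by (simp add: cinner_minus_left)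
  have "Im (cinner x y) = - Re (cinner (\<i> *\<^sub>C x) y)" by (simp add: cinner_scaleC_left)
  then have "\<bar>Im (cinner x y)\<bar> \<le> norm x * norm y"
    using re[of "\<i> *\<^sub>C x" y] by (simp add: norm_scaleC)
  then show ?thesis using re[of x y] cmod_le[of "cinner x y"] by simp
qed

lemma bounded_bilinear_cinner: "bounded_bilinear (cinner :: 'h::complex_hilbert \<Rightarrow> 'h \<Rightarrow> complex)"
proof
  show "\<exists>K. \<forall>a b. norm (cinner (a::'h) b) \<le> norm a * norm b * K"
    using cmod_cinner_le by blast
qed (simp_all add: cinner_simps scaleR_conv_of_real)

lemmas tendsto_cinner = bounded_bilinear.tendsto[OF bounded_bilinear_cinner]
lemmas continuous_on_cinner = bounded_bilinear.continuous_on[OF bounded_bilinear_cinner]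

lemma cinner_eq_zero_imp: "(\<And>k. cinner h k = 0) \<Longrightarrow> h = (0::'h::complex_hilbert)"
  using cinner_self[of h] by simp

lemma cinner_eqI: "(\<And>k. cinner h k = cinner h' k) \<Longrightarrow> h = (h'::'h::complex_hilbert)"
  using cinner_eq_zero_imp[of "h - h'"] by (simp add: cinner_simps)

subsection \<open>Closed subspaces and projections\<close>

definition closed_csubspace :: "'h::complex_hilbert set \<Rightarrow> bool" where
  "closed_csubspace K \<longleftrightarrow> closed K \<and> 0 \<in> K \<and> (\<forall>x\<in>K. \<forall>y\<in>K. x + y \<in> K) \<and> (\<forall>c. \<forall>x\<in>K. c *\<^sub>C x \<in> K)"

lemma closed_csubspace_scaleR: "closed_csubspace K \<Longrightarrow> x \<in> K \<Longrightarrow> r *\<^sub>R x \<in> K"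
  by (simp add: closed_csubspace_def scaleR_scaleC)

lemma closed_csubspace_diff: "closed_csubspace K \<Longrightarrow> x \<in> K \<Longrightarrow> y \<in> K \<Longrightarrow> x - y \<in> K"
  using closed_csubspace_scaleR[of K y "- 1"] unfolding closed_csubspace_def by fastforce

lemma closed_csubspace_Inter:
  "(\<And>K. K \<in> \<K> \<Longrightarrow> closed_csubspace K) \<Longrightarrow> closed_csubspace (\<Inter>\<K>)"
  by (auto simp: closed_csubspace_def)

text \<open>\<open>k\<close> is the nearest point of \<open>K\<close>. A minimising sequence is
  Cauchy by the parallelogram law, since midpoints stay in \<open>K\<close>; varying the limit along
  \<open>v\<close> gives orthogonality.\<close>

lemma orthogonal_projection_exists:
  fixes K :: "'h::complex_hilbert set"
  assumes K: "closed_csubspace K"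
  shows "\<exists>k\<in>K. \<forall>v\<in>K. cinner (h - k) v = 0"
proof -
  let ?D = "INF k\<in>K. (norm (h - k))\<^sup>2"
  have ne: "K \<noteq> {}" and cl: "closed K" using K by (auto simp: closed_csubspace_def)
  have bdd: "bdd_below ((\<lambda>k. (norm (h - k))\<^sup>2) ` K)" by (rule bdd_belowI[of _ 0]) auto
  have lower: "?D \<le> (norm (h - k))\<^sup>2" if "k \<in> K" for k
    using bdd that by (rule cINF_lower)
  have "\<exists>k\<in>K. (norm (h - k))\<^sup>2 < ?D + 1 / real (Suc n)" for n
    using cINF_less_iff[OF ne bdd, of "?D + 1 / real (Suc n)"] by simp
  then obtain s where s: "s n \<in> K" "(norm (h - s n))\<^sup>2 < ?D + 1 / real (Suc n)" for n by metis
  have close: "(norm (s n - s m))\<^sup>2 \<le> 2 / real (Suc n) + 2 / real (Suc m)" for n m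
  proof -
    have mid: "(1/2) *\<^sub>R (s n + s m) \<in> K"
      using closed_csubspace_scaleR[OF K] K s(1) unfolding closed_csubspace_def by blast
    have half: "h - (1/2) *\<^sub>R (s n + s m) = (1/2) *\<^sub>R ((h - s n) + (h - s m))"
      by (simp add: algebra_simps flip: scaleR_add_left)
    have "4 * (norm (h - (1/2) *\<^sub>R (s n + s m)))\<^sup>2 = (norm ((h - s n) + (h - s m)))\<^sup>2"
      unfolding half by (simp add: power_mult_distrib power2_eq_square)
    also have "\<dots> = 2 * (norm (h - s n))\<^sup>2 + 2 * (norm (h - s m))\<^sup>2 - (norm ((h - s m) - (h - s n)))\<^sup>2"
      unfolding norm_add_square norm_diff_square[of "h - s m"]
      by (simp add: Re_cinner_commute[of "h - s m"])
    finally have "(norm (s n - s m))\<^sup>2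
        = 2 * (norm (h - s n))\<^sup>2 + 2 * (norm (h - s m))\<^sup>2 - 4 * (norm (h - (1/2) *\<^sub>R (s n + s m)))\<^sup>2"
      by simp
    then show ?thesis using lower[OF mid] s(2)[of n] s(2)[of m] by simp
  qed
  have "Cauchy s"
  proof (rule metric_CauchyI)
    fix e :: real assume e: "e > 0"
    then obtain M where M: "4 / e\<^sup>2 < real M" using reals_Archimedean2 by blast
    have "dist (s m) (s n) < e" if "m \<ge> M" "n \<ge> M" for m n
    proof -
      have "4 < e\<^sup>2 * real M" using M e by (simp add: field_simps)
      then have "4 < e\<^sup>2 * real (Suc m)" "4 < e\<^sup>2 * real (Suc n)"
        using that e by (smt (verit) mult_left_mono of_nat_mono le_SucI zero_le_power2)+
      then have "2 / real (Suc m) < e\<^sup>2 / 2" "2 / real (Suc n) < e\<^sup>2 / 2"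
        by (simp_all add: field_simps)
      then have "(norm (s m - s n))\<^sup>2 < e\<^sup>2" using close[of m n] by linarith
      then show ?thesis using e by (simp add: dist_norm power_less_imp_less_base)
    qed
    then show "\<exists>M. \<forall>m\<ge>M. \<forall>n\<ge>M. dist (s m) (s n) < e" by blast
  qed
  then obtain k where k: "s \<longlonglongrightarrow> k" by (auto simp: Cauchy_convergent_iff convergent_def)
  have kK: "k \<in> K" using closed_sequentially[OF cl _ k] s(1) by blast
  have min: "(norm (h - k))\<^sup>2 \<le> ?D"
  proof (rule LIMSEQ_le)
    show "(\<lambda>n. (norm (h - s n))\<^sup>2) \<longlonglongrightarrow> (norm (h - k))\<^sup>2" by (intro tendsto_intros k)
    show "(\<lambda>n. ?D + 1 / real (Suc n)) \<longlonglongrightarrow> ?D"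
      using tendsto_add[OF tendsto_const[of ?D] LIMSEQ_inverse_real_of_nat] by (simp add: inverse_eq_divide)
    show "\<exists>N. \<forall>n\<ge>N. (norm (h - s n))\<^sup>2 \<le> ?D + 1 / real (Suc n)" using s(2) less_imp_le by blast
  qed
  have re: "Re (cinner (h - k) v) = 0" if v: "v \<in> K" for v
  proof -
    define r where "r = Re (cinner (h - k) v)"
    define N where "N = (norm v)\<^sup>2"
    \<comment> \<open>The optimal step would be \<open>r / N\<close>; the denominator
      \<open>N + 1\<close> cannot vanish and still forces \<open>r = 0\<close>.\<close>
    define t where "t = r / (N + 1)"
    have N: "N \<ge> 0" by (simp add: N_def)
    have "k + t *\<^sub>R v \<in> K" using closed_csubspace_scaleR[OF K v] K kK unfolding closed_csubspace_def by blast
    from order_trans[OF min lower[OF this]]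
    have "(norm (h - k))\<^sup>2 \<le> (norm ((h - k) - t *\<^sub>R v))\<^sup>2"
      by (simp only: diff_diff_eq)
    then have "2 * t * r \<le> t\<^sup>2 * N"
      unfolding norm_diff_square by (simp add: cinner_simps r_def N_def power_mult_distrib)
    moreover have "r = t * (N + 1)" using N by (simp add: t_def)
    ultimately have "(t * t) * (N + 2) \<le> 0" by (simp add: power2_eq_square algebra_simps)
    then have "t = 0" using N by (auto simp: mult_le_0_iff)
    then show ?thesis using \<open>r = t * (N + 1)\<close> by (simp add: r_def)
  qed
  have "cinner (h - k) v = 0" if v: "v \<in> K" for v
  proof -
    have "\<i> *\<^sub>C v \<in> K" using K v by (simp add: closed_csubspace_def)
    from re[OF this] re[OF v] show ?thesis by (simp add: cinner_scaleC_right complex_eq_iff)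
  qed
  with kK show ?thesis by blast
qed

subsection \<open>Bounded operators\<close>

lemma op_eqI: "(\<And>h. op_apply a h = op_apply b h) \<Longrightarrow> a = (b::'h::complex_hilbert bounded_op)"
  by (simp add: op_apply_inject[symmetric] fun_eq_iff)

lemma op_bounded_linear: "bounded_linear (op_apply (T::'h::complex_hilbert bounded_op))"
  using op_apply[of T] by simp

lemma op_scaleC: "op_apply T (c *\<^sub>C h) = c *\<^sub>C op_apply (T::'h::complex_hilbert bounded_op) h"
  using op_apply[of T] by simp

lemmas op_linear_simps = linear_simps[OF op_bounded_linear]

lemma op_simps [simp]:
  "op_apply (S + T) h = op_apply S h + op_apply (T::'h::complex_hilbert bounded_op) h"
  "op_apply (S - T) h = op_apply S h - op_apply T h"
  "op_apply (- T) h = - op_apply T h"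
  "op_apply (S * T) h = op_apply S (op_apply T h)"
  "op_apply (0::'h bounded_op) h = 0"
  "op_apply (1::'h bounded_op) h = h"
  by (transfer, simp)+

text \<open>Scalars act as multiplication by central operators, so scalar multiples stay within the
  language of rings.\<close>

lift_definition scale_op :: "complex \<Rightarrow> 'h::complex_hilbert bounded_op" is "\<lambda>c x. c *\<^sub>C x"
proof (intro conjI allI)
  fix c d :: complex and x :: 'h
  show "bounded_linear (\<lambda>x::'h. c *\<^sub>C x)"
    by (rule bounded_linear_intro[of _ "cmod c"])
      (simp_all add: scaleC_add_right scaleR_scaleC scaleC_scaleC norm_scaleC mult.commute)
  show "c *\<^sub>C d *\<^sub>C x = d *\<^sub>C c *\<^sub>C x" by (simp add: scaleC_scaleC mult.commute)
qed

lemma op_scale_op [simp]: "op_apply (scale_op c) h = c *\<^sub>C h"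
  by transfer simp

lemma scale_op_commute: "scale_op c * T = T * (scale_op c :: 'h::complex_hilbert bounded_op)"
  by (rule op_eqI) (simp add: op_scaleC)

lemma op_limit_exists:
  fixes T :: "nat \<Rightarrow> 'h::complex_hilbert bounded_op"
  assumes conv: "\<And>h. convergent (\<lambda>k. op_apply (T k) h)"
    and bound: "\<And>k h. norm (op_apply (T k) h) \<le> C * norm h"
  obtains L where "\<And>h. (\<lambda>k. op_apply (T k) h) \<longlonglongrightarrow> op_apply L h"
proof -
  define f where "f h = lim (\<lambda>k. op_apply (T k) h)" for h
  have f: "(\<lambda>k. op_apply (T k) h) \<longlonglongrightarrow> f h" for h
    using conv unfolding f_def by (simp add: convergent_LIMSEQ_iff)
  have scaleC_lim: "(\<lambda>k. c *\<^sub>C g k) \<longlonglongrightarrow> c *\<^sub>C l" if "g \<longlonglongrightarrow> l" for c and g :: "nat \<Rightarrow> 'h" and l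
    using bounded_linear.tendsto[OF op_bounded_linear[of "scale_op c"] that] by simp
  have "f (x + y) = f x + f y" for x y
    using LIMSEQ_unique[OF f[of "x + y"]] tendsto_add[OF f[of x] f[of y]] by (simp add: op_linear_simps)
  moreover have fC: "f (c *\<^sub>C x) = c *\<^sub>C f x" for c x
    using LIMSEQ_unique[OF f[of "c *\<^sub>C x"]] scaleC_lim[OF f[of x], of c] by (simp add: op_scaleC)
  moreover have "norm (f h) \<le> norm h * C" for h
    by (rule LIMSEQ_le_const2[OF tendsto_norm[OF f[of h]]]) (use bound[of _ h] in \<open>auto simp: mult.commute\<close>)
  ultimately have "bounded_linear f"
    by (intro bounded_linear_intro) (auto simp: scaleR_scaleC)
  then have "op_apply (Bounded_Op f) = f" using fC by (intro Bounded_Op_inverse) auto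
  then show ?thesis using that[of "Bounded_Op f"] f by simp
qed

lemma is_adjoint_sym: "is_adjoint S T \<Longrightarrow> is_adjoint T S"
  unfolding is_adjoint_def by (metis cinner_commute)

lemma is_adjoint_mult: "is_adjoint S T \<Longrightarrow> is_adjoint S' T' \<Longrightarrow> is_adjoint (S' * S) (T * T')"
  by (simp add: is_adjoint_def)

lemma is_adjoint_add: "is_adjoint S T \<Longrightarrow> is_adjoint S' T' \<Longrightarrow> is_adjoint (S + S') (T + T')"
  by (simp add: is_adjoint_def cinner_simps)

lemma is_adjoint_diff: "is_adjoint S T \<Longrightarrow> is_adjoint S' T' \<Longrightarrow> is_adjoint (S - S') (T - T')"
  by (simp add: is_adjoint_def cinner_simps)

lemma is_adjoint_one: "is_adjoint 1 1"
  by (simp add: is_adjoint_def)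

lemma is_adjoint_zero: "is_adjoint 0 0"
  by (simp add: is_adjoint_def)

lemma is_adjoint_scale: "is_adjoint (scale_op (cnj c)) (scale_op c)"
  by (simp add: is_adjoint_def cinner_scaleC_left cinner_scaleC_right)

lemma is_adjoint_unique: "is_adjoint S T \<Longrightarrow> is_adjoint S' T \<Longrightarrow> S = S'"
  by (rule op_eqI, rule cinner_eqI) (simp add: is_adjoint_def)

lemma is_adjoint_self_mult_zero:
  assumes "is_adjoint S T" "S * T = 0"
  shows "T = 0"
proof (rule op_eqI)
  fix h
  have "cinner (op_apply T h) (op_apply T h) = cinner (op_apply S (op_apply T h)) h"
    using assms(1) by (simp add: is_adjoint_def)
  also have "\<dots> = 0" using assms(2) by (metis cinner_zero_left op_simps(4,5))
  finally show "op_apply T h = op_apply 0 h" by (simp add: cinner_self)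
qed

lemma projectionD: "is_projection e \<Longrightarrow> e * e = e" "is_projection e \<Longrightarrow> e * (e * w) = e * w"
  "is_projection e \<Longrightarrow> is_adjoint e e"
  by (simp_all add: is_projection_def mult.assoc[symmetric])

lemma projection_onto_exists:
  assumes K: "closed_csubspace K"
  obtains e where "is_projection e" "\<And>h. op_apply e h \<in> K" "\<And>k. k \<in> K \<Longrightarrow> op_apply e k = k"
proof -
  obtain p where p: "p h \<in> K" "\<And>v. v \<in> K \<Longrightarrow> cinner (h - p h) v = 0" for h
    using orthogonal_projection_exists[OF K] by metis
  have uniq: "p h = k" if k: "k \<in> K" and *: "\<And>v. v \<in> K \<Longrightarrow> cinner (h - k) v = 0" for h k
  proof -
    have v: "p h - k \<in> K" using K p(1) k by (rule closed_csubspace_diff)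
    have "cinner ((h - k) - (h - p h)) (p h - k) = 0"
      unfolding cinner_diff_left[of "h - k"] using *[OF v] p(2)[OF v, of h] by simp
    then show ?thesis by (simp add: cinner_self)
  qed
  have add: "p (x + y) = p x + p y" for x y
  proof (rule uniq)
    show "p x + p y \<in> K" using K p(1) by (simp add: closed_csubspace_def)
    show "cinner (x + y - (p x + p y)) v = 0" if "v \<in> K" for v
      using p(2)[OF that, of x] p(2)[OF that, of y] by (simp add: cinner_simps)
  qed
  have scale: "p (c *\<^sub>C x) = c *\<^sub>C p x" for c x
  proof (rule uniq)
    show "c *\<^sub>C p x \<in> K" using K p(1) by (simp add: closed_csubspace_def)
    show "cinner (c *\<^sub>C x - c *\<^sub>C p x) v = 0" if "v \<in> K" for v
      using p(2)[OF that, of x] by (simp add: cinner_scaleC_left flip: scaleC_diff_right)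
  qed
  have bound: "norm (p x) \<le> norm x * 1" for x
  proof -
    have "(norm x)\<^sup>2 = (norm (x - p x))\<^sup>2 + (norm (p x))\<^sup>2"
      using norm_add_square[of "x - p x" "p x"] p(2)[OF p(1), of x x] by simp
    then have "(norm (p x))\<^sup>2 \<le> (norm x)\<^sup>2" by simp
    then show ?thesis by (simp add: power2_le_iff_abs_le)
  qed
  have lin: "bounded_linear p"
    by (rule bounded_linear_intro[of _ 1]) (use add scale bound in \<open>auto simp: scaleR_scaleC\<close>)
  have fixed: "p k = k" if "k \<in> K" for k by (rule uniq) (use that in auto)
  have e: "op_apply (Bounded_Op p) = p" using lin scale by (intro Bounded_Op_inverse) auto
  have "cinner (p x) y = cinner x (p y)" for x y
  proof -
    have "cinner x (p y) = cinner (p x) (p y)"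
      using p(2)[OF p(1), of x y] by (simp add: cinner_simps)
    moreover have "cinner (p x) y = cinner (p x) (p y)"
    proof -
      have "cinner y (p x) = cinner (p y) (p x)"
        using p(2)[OF p(1), of y x] by (simp add: cinner_simps)
      then show ?thesis by (metis cinner_commute)
    qed
    ultimately show ?thesis by simp
  qed
  then have "is_projection (Bounded_Op p)"
    unfolding is_projection_def is_adjoint_def by (auto simp: e intro!: op_eqI fixed p)
  then show ?thesis using that e p(1) fixed by metis
qed

lemma closed_csubspace_kernel: "closed_csubspace {h. op_apply x h = 0}"
  unfolding closed_csubspace_def
  by (auto simp: op_linear_simps op_scaleC scaleC_zero_right
      intro!: closed_Collect_eq linear_continuous_on op_bounded_linear)

lemma closed_csubspace_orthogonal: "closed_csubspace {h. cinner h k = 0}"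
  unfolding closed_csubspace_def
  by (auto simp: cinner_simps cinner_scaleC_left
      intro!: closed_Collect_eq continuous_on_cinner continuous_on_id continuous_on_const)

text \<open>\<open>e\<close> projects onto the closed span of the ranges. The two annihilator
  clauses express minimality from either side; together they later show that \<open>e\<close>
  commutes with an operator without forming the adjoint of that operator.\<close>

lemma range_projection_exists:
  fixes S :: "'h::complex_hilbert bounded_op set"
  shows "\<exists>e. is_projection e \<and> (\<forall>b\<in>S. e * b = b) \<and> (\<forall>x. (\<forall>b\<in>S. x * b = 0) \<longrightarrow> x * e = 0)
    \<and> (\<forall>y. (\<forall>b\<in>S. \<forall>h k. cinner (op_apply b h) (op_apply y k) = 0) \<longrightarrow> e * y = 0)"
proof -
  define K where "K = \<Inter>{K. closed_csubspace K \<and> (\<forall>b\<in>S. range (op_apply b) \<subseteq> K)}"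
  have "closed_csubspace K" unfolding K_def by (rule closed_csubspace_Inter) auto
  then obtain e where e: "is_projection e" "\<And>h. op_apply e h \<in> K" "\<And>k. k \<in> K \<Longrightarrow> op_apply e k = k"
    by (blast intro: projection_onto_exists)
  have sub: "K \<subseteq> L" if "closed_csubspace L" "\<And>b h. b \<in> S \<Longrightarrow> op_apply b h \<in> L" for L
    unfolding K_def using that by blast
  have "e * b = b" if "b \<in> S" for b
  proof (rule op_eqI)
    fix h
    have "op_apply b h \<in> K" unfolding K_def using that by blast
    then show "op_apply (e * b) h = op_apply b h" by (simp add: e(3))
  qed
  moreover have "x * e = 0" if "\<And>b. b \<in> S \<Longrightarrow> x * b = 0" for x
  proof (rule op_eqI)
    fix h
    have "op_apply x (op_apply b h) = 0" if "b \<in> S" for b h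
      using \<open>\<And>b. b \<in> S \<Longrightarrow> x * b = 0\<close>[OF that] by (metis op_simps(4,5))
    then have "K \<subseteq> {h. op_apply x h = 0}" by (intro sub closed_csubspace_kernel) auto
    then show "op_apply (x * e) h = op_apply 0 h" using e(2)[of h] by auto
  qed
  moreover have "e * y = 0" if "\<And>b h k. b \<in> S \<Longrightarrow> cinner (op_apply b h) (op_apply y k) = 0" for y
  proof (rule op_eqI)
    fix k
    have "K \<subseteq> {h. cinner h (op_apply y k) = 0}"
      by (intro sub closed_csubspace_orthogonal) (use that in auto)
    then have "cinner (op_apply e (op_apply e (op_apply y k))) (op_apply y k) = 0" using e(2) by auto
    then have "cinner (op_apply e (op_apply y k)) (op_apply e (op_apply y k)) = 0"
      using projectionD(3)[OF e(1)] by (simp add: is_adjoint_def)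
    then show "op_apply (e * y) k = op_apply 0 k" by (simp add: cinner_self)
  qed
  ultimately show ?thesis using e(1) by (intro exI[of _ e]) blast
qed

subsection \<open>Binary expansion of self-adjoint contractions\<close>

definition contraction :: "'h::complex_hilbert bounded_op \<Rightarrow> bool" where
  "contraction T \<longleftrightarrow> (\<forall>h. norm (op_apply T h) \<le> norm h)"

text \<open>The iteration \<open>y \<mapsto> (X + y\<^sup>2) / 2\<close> converges to \<open>1 - sqrt (1 - X)\<close>. Its terms are polynomials in
  \<open>X\<close> with nonnegative coefficients, so the scalar iteration at \<open>X = 1\<close> bounds it.\<close>

primrec sqrt_iter :: "'h::complex_hilbert bounded_op \<Rightarrow> nat \<Rightarrow> 'h bounded_op" where
  "sqrt_iter X 0 = 0"
| "sqrt_iter X (Suc k) = scale_op (1/2) * (X + sqrt_iter X k * sqrt_iter X k)"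

primrec sqrt_bound :: "nat \<Rightarrow> real" where
  "sqrt_bound 0 = 0"
| "sqrt_bound (Suc k) = (1 + (sqrt_bound k)\<^sup>2) / 2"

lemma sqrt_bound_range: "0 \<le> sqrt_bound k" "sqrt_bound k \<le> 1"
  by (induction k) (auto simp: power_le_one)

lemma sqrt_bound_Suc: "sqrt_bound k \<le> sqrt_bound (Suc k)"
proof -
  have "0 \<le> (sqrt_bound k - 1)\<^sup>2" by simp
  then show ?thesis by (simp add: power2_eq_square algebra_simps)
qed

lemma sqrt_bound_convergent: "convergent sqrt_bound"
  using incseq_convergent[of sqrt_bound 1] sqrt_bound_range(2) sqrt_bound_Suc
  by (metis convergentI incseq_SucI)

lemma norm_half: "norm (op_apply (scale_op (1/2)) h) = norm h / 2"
  by (simp add: norm_scaleC norm_divide)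

lemma sqrt_iter_commute: "T * X = X * T \<Longrightarrow> T * sqrt_iter X k = sqrt_iter X k * T"
proof (induction k)
  case (Suc k)
  let ?Y = "sqrt_iter X k"
  have Y: "T * ?Y = ?Y * T" using Suc by blast
  have "T * (X + ?Y * ?Y) = (X + ?Y * ?Y) * T"
    using Suc.prems Y by (simp add: distrib_left distrib_right) (metis mult.assoc)
  then show ?case by (simp, metis mult.assoc scale_op_commute)
qed simp

lemma sqrt_iter_adjoint: "is_adjoint X X \<Longrightarrow> is_adjoint (sqrt_iter X k) (sqrt_iter X k)"
proof (induction k)
  case (Suc k)
  then have "is_adjoint (X + sqrt_iter X k * sqrt_iter X k) (X + sqrt_iter X k * sqrt_iter X k)"
    by (intro is_adjoint_add is_adjoint_mult) auto
  from is_adjoint_mult[OF this is_adjoint_scale[of "1/2"]] show ?case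
    by (simp, metis scale_op_commute)
qed (simp add: is_adjoint_zero)

lemma sqrt_iter_bound:
  assumes "contraction X"
  shows "norm (op_apply (sqrt_iter X k) h) \<le> sqrt_bound k * norm h"
proof (induction k arbitrary: h)
  case (Suc k)
  let ?Y = "op_apply (sqrt_iter X k)"
  have "norm (?Y (?Y h)) \<le> sqrt_bound k * (sqrt_bound k * norm h)"
    using Suc[of "?Y h"] mult_left_mono[OF Suc[of h] sqrt_bound_range(1)[of k]] by linarith
  then have "norm (op_apply X h + ?Y (?Y h)) \<le> norm h + sqrt_bound k * (sqrt_bound k * norm h)"
    using assms norm_triangle_le[of "op_apply X h" "?Y (?Y h)"] unfolding contraction_def
    by (meson add_mono)
  moreover have "op_apply (sqrt_iter X (Suc k)) h = op_apply (scale_op (1/2)) (op_apply X h + ?Y (?Y h))"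
    by (simp only: sqrt_iter.simps op_simps)
  ultimately show ?case
    unfolding norm_half by (simp add: norm_half power2_eq_square algebra_simps del: sqrt_iter.simps op_scale_op)
qed simp

text \<open>Consecutive iterates commute, so a difference is half the sum of the two previous
  iterates times their difference; the scalar bounds obey the same recursion.\<close>

lemma sqrt_iter_diff_bound:
  assumes X: "contraction X"
  shows "norm (op_apply (sqrt_iter X (Suc k)) h - op_apply (sqrt_iter X k) h)
    \<le> (sqrt_bound (Suc k) - sqrt_bound k) * norm h"
proof (induction k arbitrary: h)
  case 0
  then show ?case using sqrt_iter_bound[OF X, of 1 h] by simp
next
  case (Suc k)
  let ?Y = "sqrt_iter X (Suc k)" and ?W = "sqrt_iter X k"
  let ?t = "sqrt_bound (Suc k)" and ?s = "sqrt_bound k"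
  have comm: "?Y * ?W = ?W * ?Y"
    by (intro sqrt_iter_commute, rule sqrt_iter_commute[symmetric]) simp
  have "sqrt_iter X (Suc (Suc k)) = scale_op (1/2) * (X + ?Y * ?Y)"
    "?Y = scale_op (1/2) * (X + ?W * ?W)" by (rule sqrt_iter.simps(2))+
  then have "sqrt_iter X (Suc (Suc k)) - ?Y = scale_op (1/2) * ((X + ?Y * ?Y) - (X + ?W * ?W))"
    by (metis right_diff_distrib)
  also have "(X + ?Y * ?Y) - (X + ?W * ?W) = (?Y + ?W) * (?Y - ?W)"
    using comm by (simp add: distrib_right right_diff_distrib del: sqrt_iter.simps)
  finally have eq: "op_apply (sqrt_iter X (Suc (Suc k))) h - op_apply ?Y h
      = op_apply (scale_op (1/2)) (op_apply (?Y + ?W) (op_apply ?Y h - op_apply ?W h))"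
    by (metis op_simps(2,4))
  let ?v = "op_apply ?Y h - op_apply ?W h"
  have "norm (op_apply (?Y + ?W) ?v) \<le> ?t * norm ?v + ?s * norm ?v"
    using sqrt_iter_bound[OF X, of "Suc k" ?v] sqrt_iter_bound[OF X, of k ?v]
      norm_triangle_le[of "op_apply ?Y ?v" "op_apply ?W ?v"] by (simp del: sqrt_iter.simps sqrt_bound.simps)
  also have "\<dots> = (?t + ?s) * norm ?v" by (simp add: distrib_right)
  also have "\<dots> \<le> (?t + ?s) * ((?t - ?s) * norm h)"
    using Suc[of h] sqrt_bound_range(1)[of "Suc k"] sqrt_bound_range(1)[of k]
    by (intro mult_left_mono) auto
  also have "\<dots> = 2 * ((sqrt_bound (Suc (Suc k)) - ?t) * norm h)"
    by (simp add: power2_eq_square algebra_simps add_divide_distrib diff_divide_distrib)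
  finally show ?case unfolding eq norm_half by simp
qed

text \<open>The steps of the iteration are dominated by the telescoping steps of the convergent
  scalar bounds, so the iterates converge pointwise, and all properties pass to the limit.\<close>

lemma one_minus_sqrt_exists:
  fixes X :: "'h::complex_hilbert bounded_op"
  assumes sa: "is_adjoint X X" and X: "contraction X"
  obtains Y where "is_adjoint Y Y" "contraction Y" "Y + Y = X + Y * Y"
    "\<And>T. T * X = X * T \<Longrightarrow> T * Y = Y * T"
proof -
  let ?Y = "\<lambda>k. op_apply (sqrt_iter X k)"
  have conv: "convergent (\<lambda>k. ?Y k h)" for h
  proof -
    obtain c where "sqrt_bound \<longlonglongrightarrow> c" using sqrt_bound_convergent by (auto simp: convergent_def)
    then have "summable (\<lambda>k. (sqrt_bound (Suc k) - sqrt_bound k) * norm h)"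
      by (intro summable_mult2 telescope_summable)
    then have "summable (\<lambda>k. ?Y (Suc k) h - ?Y k h)"
      by (rule summable_comparison_test') (use sqrt_iter_diff_bound[OF X] in blast)
    from summable_LIMSEQ[OF this] obtain l where "(\<lambda>n. ?Y n h - ?Y 0 h) \<longlonglongrightarrow> l"
      by (simp only: sum_lessThan_telescope[of "\<lambda>k. ?Y k h"])
    then show ?thesis by (auto simp: convergent_def)
  qed
  have bound: "norm (?Y k h) \<le> 1 * norm h" for k h
    using sqrt_iter_bound[OF X, of k h] mult_right_mono[OF sqrt_bound_range(2)[of k], of "norm h"] by simp
  obtain Y where Y: "\<And>h. (\<lambda>k. ?Y k h) \<longlonglongrightarrow> op_apply Y h"
    using op_limit_exists[OF conv bound] by blast
  have "is_adjoint Y Y"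
    unfolding is_adjoint_def
  proof (intro allI)
    fix x y
    have "(\<lambda>k. cinner (?Y k x) y) \<longlonglongrightarrow> cinner (op_apply Y x) y"
      "(\<lambda>k. cinner x (?Y k y)) \<longlonglongrightarrow> cinner x (op_apply Y y)"
      by (intro tendsto_cinner Y tendsto_const)+
    then show "cinner (op_apply Y x) y = cinner x (op_apply Y y)"
      using sqrt_iter_adjoint[OF sa] LIMSEQ_unique unfolding is_adjoint_def by auto
  qed
  moreover have "contraction Y"
    unfolding contraction_def
    by (intro allI LIMSEQ_le_const2[OF tendsto_norm[OF Y]]) (use bound in auto)
  moreover have "Y + Y = X + Y * Y"
  proof (rule op_eqI)
    fix h
    have "(\<lambda>k. ?Y k (?Y k h - op_apply Y h)) \<longlonglongrightarrow> 0"
    proof (rule Lim_null_comparison)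
      show "\<forall>\<^sub>F k in sequentially. norm (?Y k (?Y k h - op_apply Y h)) \<le> norm (?Y k h - op_apply Y h)"
        using bound by simp
      show "(\<lambda>k. norm (?Y k h - op_apply Y h)) \<longlonglongrightarrow> 0"
        using Y[of h] by (metis LIM_zero tendsto_norm_zero)
    qed
    from tendsto_add[OF this Y[of "op_apply Y h"]]
    have "(\<lambda>k. ?Y k (?Y k h)) \<longlonglongrightarrow> op_apply Y (op_apply Y h)" by (simp add: op_linear_simps)
    then have "(\<lambda>k. op_apply X h + ?Y k (?Y k h)) \<longlonglongrightarrow> op_apply X h + op_apply Y (op_apply Y h)"
      by (intro tendsto_add tendsto_const)
    moreover have "op_apply X h + ?Y k (?Y k h) = ?Y (Suc k) h + ?Y (Suc k) h" for k
      by (simp flip: scaleC_add_left) (simp add: scaleC_one flip: scaleC_add_left scaleC_add_right)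
    moreover have "(\<lambda>k. ?Y (Suc k) h + ?Y (Suc k) h) \<longlonglongrightarrow> op_apply Y h + op_apply Y h"
      by (intro tendsto_add LIMSEQ_Suc Y)
    ultimately show "op_apply (Y + Y) h = op_apply (X + Y * Y) h"
      using LIMSEQ_unique by (auto simp del: sqrt_iter.simps)
  qed
  moreover have "T * Y = Y * T" if "T * X = X * T" for T
  proof (rule op_eqI)
    fix h
    have "(\<lambda>k. op_apply T (?Y k h)) \<longlonglongrightarrow> op_apply T (op_apply Y h)"
      by (intro bounded_linear.tendsto[OF op_bounded_linear] Y)
    moreover have "op_apply T (?Y k h) = ?Y k (op_apply T h)" for k
      using sqrt_iter_commute[OF that, of k] by (metis op_simps(4))
    ultimately show "op_apply (T * Y) h = op_apply (Y * T) h"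
      using LIMSEQ_unique Y[of "op_apply T h"] by auto
  qed
  ultimately show ?thesis using that by blast
qed

text \<open>The last two conclusions permit a second application with \<open>1 - S\<close> as
  \<open>X\<close>, which gives a square root of \<open>S\<close> and thereby its
  positivity.\<close>

lemma sqrt_exists:
  fixes X :: "'h::complex_hilbert bounded_op"
  assumes "is_adjoint X X" "contraction X"
  obtains S where "is_adjoint S S" "S * S = 1 - X"
    "\<And>T. T * X = X * T \<Longrightarrow> T * S = S * T" "is_adjoint (1 - S) (1 - S)" "contraction (1 - S)"
proof -
  obtain Y where Y: "is_adjoint Y Y" "contraction Y" "Y + Y = X + Y * Y"
    and comm: "\<And>T. T * X = X * T \<Longrightarrow> T * Y = Y * T"
    using one_minus_sqrt_exists[OF assms] by blast
  show ?thesis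
  proof (rule that[of "1 - Y"])
    show "is_adjoint (1 - Y) (1 - Y)" using is_adjoint_one Y(1) by (rule is_adjoint_diff)
    show "(1 - Y) * (1 - Y) = 1 - X" using Y(3) by (simp add: algebra_simps)
    show "T * (1 - Y) = (1 - Y) * T" if "T * X = X * T" for T
      using comm[OF that] by (simp add: left_diff_distrib right_diff_distrib)
  qed (use Y in simp_all)
qed

text \<open>With \<open>S = |b|\<close> and \<open>e\<close> the range projection of \<open>S + b\<close>, \<open>2b + 1 - 2e = (2S - 1)(2e - 1)\<close>.\<close>

lemma bisection:
  fixes b :: "'h::complex_hilbert bounded_op"
  assumes sa: "is_adjoint b b" and b: "contraction b"
  obtains e where "is_projection e" "contraction (b + b + 1 - (e + e))"
    "\<And>T. T * b = b * T \<Longrightarrow> T * e = e * T"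
proof -
  \<comment> \<open>Chosen so that \<open>S * S = 1 - ?X = b * b\<close>, which makes
    \<open>S\<close> the absolute value of \<open>b\<close>.\<close>
  let ?X = "1 - b * b"
  have Xsa: "is_adjoint ?X ?X"
    using sa by (intro is_adjoint_diff is_adjoint_one is_adjoint_mult)
  have "contraction ?X"
    unfolding contraction_def
  proof
    fix h
    let ?bh = "op_apply b h" and ?bbh = "op_apply b (op_apply b h)"
    have "Re (cinner h ?bbh) = (norm ?bh)\<^sup>2"
      using sa by (simp add: is_adjoint_def Re_cinner_self flip: Re_cinner_self)
    moreover have "(norm ?bbh)\<^sup>2 \<le> (norm ?bh)\<^sup>2" using b by (simp add: contraction_def)
    moreover have "0 \<le> (norm ?bh)\<^sup>2" by simp
    ultimately have "(norm (h - ?bbh))\<^sup>2 \<le> (norm h)\<^sup>2" unfolding norm_diff_square by linarith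
    then show "norm (op_apply ?X h) \<le> norm h" by (simp add: power2_le_iff_abs_le)
  qed
  then obtain S where S: "is_adjoint S S" "S * S = 1 - ?X"
    and S_comm: "\<And>T. T * ?X = ?X * T \<Longrightarrow> T * S = S * T"
    and S': "is_adjoint (1 - S) (1 - S)" "contraction (1 - S)"
    by (blast intro: sqrt_exists[OF Xsa])
  have S: "is_adjoint S S" "S * S = b * b" using S by simp_all
  have S_comm: "T * S = S * T" if "T * b = b * T" for T
  proof (rule S_comm)
    have "T * (b * b) = b * b * T" using that by (metis mult.assoc)
    then show "T * ?X = ?X * T" by (simp add: left_diff_distrib right_diff_distrib)
  qed
  obtain R where R: "is_adjoint R R" "R * R = 1 - (1 - S)"
    by (blast intro: sqrt_exists[OF S'])
  have R: "is_adjoint R R" "R * R = S" using R by simp_all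
  have nS: "norm (op_apply S h) \<le> norm h" for h
  proof -
    have "(norm (op_apply S h))\<^sup>2 = Re (cinner h (op_apply (S * S) h))"
      using S(1) by (simp add: is_adjoint_def flip: Re_cinner_self)
    also have "\<dots> = (norm (op_apply b h))\<^sup>2"
      unfolding S(2) using sa by (simp add: is_adjoint_def flip: Re_cinner_self)
    also have "\<dots> \<le> (norm h)\<^sup>2" using b by (simp add: contraction_def)
    finally show ?thesis by (simp add: power2_le_iff_abs_le)
  qed
  have nR: "(norm (op_apply R h))\<^sup>2 = Re (cinner (op_apply S h) h)" for h
    using R(1) by (simp add: is_adjoint_def flip: Re_cinner_self R(2))
  have S2: "(norm (op_apply S h))\<^sup>2 \<le> Re (cinner (op_apply S h) h)" for h
  proof -
    have "(norm (op_apply S h))\<^sup>2 = (norm (op_apply R (op_apply R h)))\<^sup>2" by (simp flip: R(2))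
    also have "\<dots> \<le> norm (op_apply S (op_apply R h)) * norm (op_apply R h)"
      unfolding nR by (rule Re_cinner_le)
    also have "\<dots> \<le> norm (op_apply R h) * norm (op_apply R h)" using nS by (intro mult_right_mono) auto
    also have "\<dots> = Re (cinner (op_apply S h) h)" unfolding nR[symmetric] by (simp add: power2_eq_square)
    finally show ?thesis .
  qed
  \<comment> \<open>\<open>S2\<close> says \<open>S * S \<le> S\<close> as quadratic forms, which is
    what makes \<open>2S - 1\<close> a contraction.\<close>
  have refl_S: "norm (op_apply (S + S - 1) h) \<le> norm h" for h
  proof -
    have "(norm (op_apply (S + S - 1) h))\<^sup>2
        = 4 * (norm (op_apply S h))\<^sup>2 - 4 * Re (cinner (op_apply S h) h) + (norm h)\<^sup>2"
      by (simp add: norm_diff_square norm_add_square cinner_simps Re_cinner_self)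
    then have "(norm (op_apply (S + S - 1) h))\<^sup>2 \<le> (norm h)\<^sup>2" using S2[of h] by simp
    then show ?thesis by (simp add: power2_le_iff_abs_le)
  qed
  let ?B = "S + b"
  have Bsa: "is_adjoint ?B ?B" using S(1) sa by (rule is_adjoint_add)
  obtain e where e: "is_projection e" "e * ?B = ?B"
    and e_right: "x * ?B = 0 \<Longrightarrow> x * e = 0"
    and e_left: "(\<forall>h k. cinner (op_apply ?B h) (op_apply y k) = 0) \<Longrightarrow> e * y = 0" for x y
    using range_projection_exists[of "{?B}"] by auto
  have "is_adjoint ?B (?B * e)"
    using is_adjoint_mult[OF Bsa projectionD(3)[OF e(1)]] e(2) by simp
  then have Be: "?B * e = ?B" using Bsa by (metis is_adjoint_sym is_adjoint_unique)
  \<comment> \<open>\<open>S\<close> and \<open>b\<close> commute and have equal squares, so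
    \<open>S - b\<close> annihilates the range of \<open>S + b\<close>.\<close>
  have "(S - b) * ?B = 0" using S(2) S_comm[of b] by (simp add: algebra_simps)
  then have "(S - b) * e = 0" by (rule e_right)
  then have "S * e + S * e = S + b" using Be by (simp add: algebra_simps)
  moreover have "(S + S - 1) * (e + e - 1) = (S * e + S * e) + (S * e + S * e) - (S + S) - (e + e) + 1"
    by (simp add: algebra_simps)
  ultimately have fact: "(S + S - 1) * (e + e - 1) = b + b + 1 - (e + e)"
    by simp
  have "contraction (b + b + 1 - (e + e))"
    unfolding contraction_def
  proof
    fix h
    let ?U = "e + e - 1"
    have "is_adjoint ?U ?U" using projectionD(3)[OF e(1)] by (intro is_adjoint_diff is_adjoint_add is_adjoint_one)
    then have "(norm (op_apply ?U h))\<^sup>2 = Re (cinner h (op_apply (?U * ?U) h))"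
      unfolding Re_cinner_self[symmetric] by (simp only: is_adjoint_def op_simps(4))
    also have "?U * ?U = 1" using projectionD(1)[OF e(1)] by (simp add: algebra_simps)
    finally have "(norm (op_apply ?U h))\<^sup>2 = (norm h)\<^sup>2" by (simp add: Re_cinner_self)
    then have "norm (op_apply ?U h) = norm h" by (simp add: power2_eq_iff_nonneg)
    then show "norm (op_apply (b + b + 1 - (e + e)) h) \<le> norm h"
      unfolding fact[symmetric] op_simps(4) using refl_S[of "op_apply ?U h"] by simp
  qed
  moreover have "T * e = e * T" if "T * b = b * T" for T
  proof -
    \<comment> \<open>\<open>T\<close> preserves the range and the kernel of \<open>?B\<close>, so
      both off-diagonal blocks of \<open>T\<close> with respect to \<open>e\<close> vanish.\<close>
    have TB: "T * ?B = ?B * T" using that S_comm[OF that] by (simp add: algebra_simps)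
    have "(1 - e) * T * ?B = 0"
    proof -
      have "(1 - e) * T * ?B = (1 - e) * ?B * T" using TB by (metis mult.assoc)
      also have "(1 - e) * ?B = 0" using e(2) by (simp add: left_diff_distrib)
      finally show ?thesis by simp
    qed
    from e_right[OF this] have 1: "T * e = e * (T * e)" by (simp add: algebra_simps)
    have "e * (T * (1 - e)) = 0"
    proof (rule e_left, intro allI)
      fix h k
      have "cinner (op_apply ?B h) (op_apply (T * (1 - e)) k) = cinner h (op_apply (?B * T * (1 - e)) k)"
        using Bsa by (simp add: is_adjoint_def)
      also have "?B * T * (1 - e) = T * (?B * (1 - e))" using TB by (metis mult.assoc)
      also have "\<dots> = 0" using Be by (simp add: right_diff_distrib)
      finally show "cinner (op_apply ?B h) (op_apply (T * (1 - e)) k) = 0" by simp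
    qed
    then show ?thesis using 1 by (simp add: algebra_simps)
  qed
  ultimately show ?thesis using that e(1) by blast
qed

text \<open>\<open>bisection\<close> is iterated by \<open>B (n + 1) = 2 B n + 1 - 2 e n\<close>
  from \<open>B 0 = b\<close>. The \<open>n\<close>-th partial sum misses \<open>b\<close> by
  \<open>B n\<close> divided by \<open>2^n\<close>, and \<open>B n\<close> remains a
  contraction.\<close>

lemma binary_expansion:
  fixes b :: "'h::complex_hilbert bounded_op"
  assumes sa: "is_adjoint b b" and b: "contraction b"
  obtains e where "\<And>k. is_projection (e k)" "\<And>k T. T * b = b * T \<Longrightarrow> T * e k = e k * T"
    "\<And>h. (\<lambda>k. (1/2) ^ Suc k *\<^sub>R (2 *\<^sub>R op_apply (e k) h - h)) sums op_apply b h"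
proof -
  let ?comm = "\<lambda>c. \<forall>T. T * b = b * T \<longrightarrow> T * c = c * T"
  \<comment> \<open>The clause on \<open>n = 0\<close> pins the start of the chosen sequence to
    \<open>b\<close>.\<close>
  let ?P = "\<lambda>n::nat. \<lambda>c. is_adjoint c c \<and> contraction c \<and> ?comm c \<and> (n = 0 \<longrightarrow> c = b)"
  let ?Q = "\<lambda>n::nat. \<lambda>c c'. \<exists>e. is_projection e \<and> ?comm e \<and> c' = c + c + 1 - (e + e)"
  have "\<exists>B. \<forall>n. ?P n (B n) \<and> ?Q n (B n) (B (Suc n))"
  proof (rule dependent_nat_choice)
    show "\<exists>c. ?P 0 c" using sa b by blast
    fix c n assume c: "?P n c"
    then obtain e where e: "is_projection e" "contraction (c + c + 1 - (e + e))"
      "\<And>T. T * c = c * T \<Longrightarrow> T * e = e * T" using bisection[of c] by metis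
    have ee: "is_adjoint e e" using e(1) by (rule projectionD)
    have "is_adjoint (c + c + 1 - (e + e)) (c + c + 1 - (e + e))"
      using c ee by (intro is_adjoint_diff is_adjoint_add is_adjoint_one) auto
    moreover have ce: "?comm e" using c e(3) by blast
    moreover have "T * (c + c + 1 - (e + e)) = (c + c + 1 - (e + e)) * T" if T: "T * b = b * T" for T
    proof -
      have "T * c = c * T" "T * e = e * T" using c ce T by blast+
      then show ?thesis by (simp add: distrib_left distrib_right left_diff_distrib right_diff_distrib)
    qed
    ultimately show "\<exists>c'. ?P (Suc n) c' \<and> ?Q n c c'" using e(1,2) by auto
  qed
  then obtain B where "\<forall>n. ?P n (B n) \<and> ?Q n (B n) (B (Suc n))" ..
  note B = this[THEN spec]
  have B1: "contraction (B n)" "B 0 = b" for n using B[of n] B[of 0] by (elim conjE; simp)+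
  define e where "e n = (SOME e. is_projection e \<and> ?comm e \<and> B (Suc n) = B n + B n + 1 - (e + e))" for n
  have e_props: "is_projection (e n) \<and> ?comm (e n) \<and> B (Suc n) = B n + B n + 1 - (e n + e n)" for n
    unfolding e_def by (rule someI_ex) (rule conjunct2[OF B])
  have e1: "is_projection (e n)" and e2: "T * b = b * T \<Longrightarrow> T * e n = e n * T"
    and e3: "B (Suc n) = B n + B n + 1 - (e n + e n)" for n T
    using e_props[of n] by blast+
  have "(\<lambda>k. (1/2) ^ Suc k *\<^sub>R (2 *\<^sub>R op_apply (e k) h - h)) sums op_apply b h" for h
  proof -
    have step: "2 *\<^sub>R op_apply (e k) h - h = 2 *\<^sub>R op_apply (B k) h - op_apply (B (Suc k)) h" for k
      unfolding e3 by (simp add: scaleR_2)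
    have "(\<Sum>k<n. (1/2) ^ Suc k *\<^sub>R (2 *\<^sub>R op_apply (e k) h - h))
        = op_apply b h - (1/2) ^ n *\<^sub>R op_apply (B n) h" for n
      by (induction n) (auto simp: step B1 algebra_simps)
    moreover have "(\<lambda>n. (1/2) ^ n *\<^sub>R op_apply (B n) h) \<longlonglongrightarrow> 0"
    proof (rule Lim_null_comparison)
      show "\<forall>\<^sub>F n in sequentially. norm ((1/2) ^ n *\<^sub>R op_apply (B n) h) \<le> (1/2) ^ n * norm h"
        using B1 by (auto simp: contraction_def intro!: mult_left_mono always_eventually)
      show "(\<lambda>n. (1/2) ^ n * norm h) \<longlonglongrightarrow> 0"
        by (intro tendsto_mult_left_zero LIMSEQ_power_zero) simp
    qed
    ultimately show ?thesis
      unfolding sums_def using tendsto_diff[OF tendsto_const[of "op_apply b h"], of _ 0] by simp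
  qed
  then show ?thesis using that[of e] e1 e2 by blast
qed

lemma pointwise_limit_commutes:
  fixes L t :: "'h::complex_hilbert bounded_op"
  assumes lim: "\<And>h. (\<lambda>n. op_apply (T n) h) \<longlonglongrightarrow> op_apply L h"
    and comm: "\<And>n. T n * t = t * T n"
  shows "L * t = t * L"
proof (rule op_eqI)
  fix h
  have "(\<lambda>n. op_apply t (op_apply (T n) h)) \<longlonglongrightarrow> op_apply t (op_apply L h)"
    by (intro bounded_linear.tendsto[OF op_bounded_linear] lim)
  moreover have "op_apply t (op_apply (T n) h) = op_apply (T n) (op_apply t h)" for n
    using comm[of n] by (metis op_simps(4))
  ultimately show "op_apply (L * t) h = op_apply (t * L) h"
    using LIMSEQ_unique lim[of "op_apply t h"] by auto
qed

lemma projection_norm_le: "is_projection e \<Longrightarrow> norm (op_apply e h) \<le> norm h"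
proof -
  assume e: "is_projection e"
  have "cinner (op_apply e h) (op_apply e h) = cinner (op_apply e (op_apply e h)) h"
    using projectionD(3)[OF e] by (simp add: is_adjoint_def)
  also have "op_apply e (op_apply e h) = op_apply e h" using projectionD(1)[OF e] by (metis op_simps(4))
  finally have "(norm (op_apply e h))\<^sup>2 = Re (cinner (op_apply e h) h)" by (metis Re_cinner_self)
  also have "\<dots> \<le> norm (op_apply e h) * norm h" by (rule Re_cinner_le)
  finally show ?thesis by (cases "norm (op_apply e h) = 0") (auto simp: power2_eq_square)
qed

lemma adjoint_of_zero_product:
  assumes "is_adjoint S T" "is_adjoint S' T'" "T * T' = 0"
  shows "S' * S = 0"
  using is_adjoint_mult[OF assms(1,2)] assms(3) is_adjoint_zero is_adjoint_unique by metis

lemma projection_mult: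
  assumes "is_projection e" "is_projection f" "e * f = f * e"
  shows "is_projection (e * f)"
proof -
  have "e * f * (e * f) = (e * e) * (f * f)" using assms(3) by (metis mult.assoc)
  then have "e * f * (e * f) = e * f" using assms(1,2) by (simp add: is_projection_def)
  moreover have "is_adjoint (e * f) (e * f)"
    using is_adjoint_mult[OF projectionD(3)[OF assms(1)] projectionD(3)[OF assms(2)]] assms(3) by simp
  ultimately show ?thesis by (simp add: is_projection_def)
qed

lemma projection_diff:
  assumes "is_projection e" "is_projection f" "e * f = f" "f * e = f"
  shows "is_projection (e - f)"
  unfolding is_projection_def
proof
  show "(e - f) * (e - f) = e - f"
    using assms projectionD(1)[OF assms(1)] projectionD(1)[OF assms(2)]
    by (simp add: left_diff_distrib right_diff_distrib)
  show "is_adjoint (e - f) (e - f)"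
    using assms(1,2)[THEN projectionD(3)] by (rule is_adjoint_diff)
qed

lemma is_projection_one: "is_projection 1"
  by (simp add: is_projection_def is_adjoint_one)

text \<open>An operator is a complex combination of its real and imaginary parts, which can be
  scaled to contractions. The rule serves both \<open>A\<close> and the centre of a corner.\<close>

lemma self_adjoint_contraction_induct [consumes 1, case_names adjoint add scale base add_prop scale_prop]:
  fixes a :: "'h::complex_hilbert bounded_op"
  assumes a: "a \<in> S"
    and adj: "\<And>x. x \<in> S \<Longrightarrow> \<exists>y\<in>S. is_adjoint y x"
    and add: "\<And>x y. x \<in> S \<Longrightarrow> y \<in> S \<Longrightarrow> x + y \<in> S"
    and scale: "\<And>c x. x \<in> S \<Longrightarrow> scale_op c * x \<in> S"
    and base: "\<And>b. b \<in> S \<Longrightarrow> is_adjoint b b \<Longrightarrow> contraction b \<Longrightarrow> R b"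
    and R_add: "\<And>x y. R x \<Longrightarrow> R y \<Longrightarrow> R (x + y)"
    and R_scale: "\<And>c x. R x \<Longrightarrow> R (scale_op c * x)"
  shows "R a"
proof -
  obtain a' where a': "a' \<in> S" "is_adjoint a' a" using adj[OF a] by blast
  obtain K where K: "K > 0" "\<And>h. norm (op_apply a h) \<le> norm h * K"
    using bounded_linear.pos_bounded[OF op_bounded_linear[of a]] by blast
  obtain K' where K': "K' > 0" "\<And>h. norm (op_apply a' h) \<le> norm h * K'"
    using bounded_linear.pos_bounded[OF op_bounded_linear[of a']] by blast
  define C where "C = K + K'"
  have C: "C > 0" using K(1) K'(1) by (simp add: C_def)
  \<comment> \<open>As \<open>C\<close> bounds \<open>a + a'\<close> and \<open>a - a'\<close>, this
    factor makes \<open>b1\<close> and \<open>b2\<close> contractions, and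
    \<open>a = C (b1 + \<i> b2)\<close>.\<close>
  define r where "r = complex_of_real (1 / (2 * C))"
  define b1 where "b1 = scale_op r * (a + a')"
  define b2 where "b2 = scale_op r * (scale_op (- \<i>) * (a + scale_op (- 1) * a'))"
  have minus: "scale_op (- 1) * x = - x" for x :: "'h bounded_op"
    by (rule op_eqI) (simp add: scaleC_minus_left scaleC_one)
  have S: "b1 \<in> S" "b2 \<in> S" unfolding b1_def b2_def by (intro scale add a a'(1))+
  have adj_scale: "is_adjoint (scale_op (cnj c) * y) (scale_op c * x)"
    if "is_adjoint y x" for c and x y :: "'h bounded_op"
    using is_adjoint_mult[OF is_adjoint_scale that, of c] is_adjoint_mult[OF that is_adjoint_scale, of c]
    by (metis scale_op_commute)
  have "cnj r = r" by (simp add: r_def)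
  then have sa1: "is_adjoint b1 b1"
    using adj_scale[OF is_adjoint_add[OF a'(2) is_adjoint_sym[OF a'(2)]], of r]
    by (simp add: b1_def add.commute)
  have "is_adjoint (scale_op \<i> * (a' - a)) (scale_op (- \<i>) * (a - a'))"
    using adj_scale[OF is_adjoint_diff[OF a'(2) is_adjoint_sym[OF a'(2)]], of "- \<i>"] by simp
  moreover have "scale_op \<i> * (a' - a) = scale_op (- \<i>) * (a - a')"
    by (rule op_eqI) (simp add: scaleC_minus_left scaleC_diff_right)
  ultimately have sa2: "is_adjoint b2 b2"
    using adj_scale[of "scale_op (- \<i>) * (a - a')" "scale_op (- \<i>) * (a - a')" r] \<open>cnj r = r\<close>
    by (simp add: b2_def minus)
  have normr: "cmod r * (norm h * K + norm h * K') = norm h / 2" for h :: 'h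
  proof -
    have "cmod r = 1 / (2 * C)" unfolding r_def norm_of_real using C by simp
    moreover have "norm h * K + norm h * K' = norm h * C" by (simp add: C_def distrib_left)
    ultimately show ?thesis using C by simp
  qed
  have half: "norm h / 2 \<le> norm h" for h :: 'h by simp
  have "contraction b1"
    unfolding contraction_def
  proof
    fix h
    have "norm (op_apply b1 h) = cmod r * norm (op_apply a h + op_apply a' h)"
      by (simp add: b1_def norm_scaleC)
    also have "\<dots> \<le> cmod r * (norm h * K + norm h * K')"
      by (intro mult_left_mono norm_triangle_le add_mono K K') simp
    finally show "norm (op_apply b1 h) \<le> norm h" unfolding normr using half[of h] by linarith
  qed
  moreover have "contraction b2"
    unfolding contraction_def
  proof
    fix h
    have "norm (op_apply b2 h) = cmod r * norm (op_apply a h - op_apply a' h)"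
      by (simp add: b2_def norm_scaleC minus)
    also have "\<dots> \<le> cmod r * (norm h * K + norm h * K')"
      by (intro mult_left_mono norm_triangle_le_diff add_mono K K') simp
    finally show "norm (op_apply b2 h) \<le> norm h" unfolding normr using half[of h] by linarith
  qed
  ultimately have "R b1" "R b2" using S sa1 sa2 by (auto intro!: base)
  then have "R (scale_op (of_real C) * (b1 + scale_op \<i> * b2))" by (intro R_add R_scale)
  also have "scale_op (of_real C) * (b1 + scale_op \<i> * b2) = a"
  proof (rule op_eqI)
    fix h
    have r: "complex_of_real C * r = 1/2" using C by (simp add: r_def)
    have ir: "\<i> * (r * - \<i>) = r" by (simp add: complex_eq_iff)
    have "op_apply (scale_op \<i> * b2) h = (\<i> * (r * - \<i>)) *\<^sub>C (op_apply a h - op_apply a' h)"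
      by (simp only: b2_def minus op_simps op_scale_op scaleC_scaleC) simp
    then have "op_apply (scale_op (of_real C) * (b1 + scale_op \<i> * b2)) h
        = (of_real C * r) *\<^sub>C (op_apply a h + op_apply a' h) + (of_real C * r) *\<^sub>C (op_apply a h - op_apply a' h)"
      unfolding ir by (simp add: b1_def scaleC_add_right scaleC_scaleC)
    also have "\<dots> = (1/2) *\<^sub>C op_apply a h + (1/2) *\<^sub>C op_apply a h"
      unfolding r by (simp add: scaleC_add_right scaleC_diff_right)
    also have "\<dots> = op_apply a h" by (simp flip: scaleC_add_left add: scaleC_one)
    finally show "op_apply (scale_op (of_real C) * (b1 + scale_op \<i> * b2)) h = op_apply a h" .
  qed
  finally show ?thesis .
qed

subsection \<open>Von Neumann algebras\<close>

locale vn_algebra =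
  fixes A :: "'h::complex_hilbert bounded_op set"
  assumes von_neumann: "von_neumann_algebra A"
begin

lemma adjoint_in: "a \<in> A \<Longrightarrow> \<exists>b\<in>A. is_adjoint b a"
  using von_neumann by (simp add: von_neumann_algebra_def)

lemma in_bicommutantI: "(\<And>t. (\<And>s. s \<in> A \<Longrightarrow> t * s = s * t) \<Longrightarrow> T * t = t * T) \<Longrightarrow> T \<in> A"
  using von_neumann unfolding von_neumann_algebra_def commutant_def by blast

sublocale subring A
proof
  fix x y assume x: "x \<in> A" and y: "y \<in> A"
  show "x + y \<in> A"
  proof (rule in_bicommutantI)
    fix t assume "\<And>s. s \<in> A \<Longrightarrow> t * s = s * t"
    from this[OF x] this[OF y] show "(x + y) * t = t * (x + y)"
      by (simp add: distrib_left distrib_right)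
  qed
  show "x * y \<in> A"
  proof (rule in_bicommutantI)
    fix t assume "\<And>s. s \<in> A \<Longrightarrow> t * s = s * t"
    from this[OF x] this[OF y] show "x * y * t = t * (x * y)" by (metis mult.assoc)
  qed
next
  fix x assume x: "x \<in> A"
  show "- x \<in> A"
  proof (rule in_bicommutantI)
    fix t assume "\<And>s. s \<in> A \<Longrightarrow> t * s = s * t"
    from this[OF x] show "- x * t = t * - x" by simp
  qed
next
  show "1 \<in> A" by (rule in_bicommutantI) simp
qed

lemma center_eq_Z: "center A = Z"
  by (simp add: center_def Z_def)

lemma scale_in: "scale_op c \<in> A"
  by (rule in_bicommutantI) (rule scale_op_commute)

lemma scale_closed: "x \<in> A \<Longrightarrow> scale_op c * x \<in> A"
  using scale_in by (rule mult_closed)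

lemma scale_in_Z: "scale_op c \<in> Z"
  unfolding Z_def using scale_in scale_op_commute by blast

lemma self_adjoint_induct [consumes 1, case_names base add scale]:
  assumes "a \<in> A" "\<And>b. b \<in> A \<Longrightarrow> is_adjoint b b \<Longrightarrow> contraction b \<Longrightarrow> R b"
    "\<And>x y. R x \<Longrightarrow> R y \<Longrightarrow> R (x + y)" "\<And>c x. R x \<Longrightarrow> R (scale_op c * x)"
  shows "R a"
  using assms(1)
proof (rule self_adjoint_contraction_induct)
  show "\<exists>y\<in>A. is_adjoint y x" if "x \<in> A" for x using that by (rule adjoint_in)
qed (use assms add_closed scale_closed in auto)

section \<open>Range projections and central carriers inside the algebra\<close>

lemma range_projection_in:
  assumes S: "S \<subseteq> A"
  shows "\<exists>e\<in>A. is_projection e \<and> (\<forall>b\<in>S. e * b = b) \<and> (\<forall>x. (\<forall>b\<in>S. x * b = 0) \<longrightarrow> x * e = 0)"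
proof -
  obtain e where e: "is_projection e" "\<And>b. b \<in> S \<Longrightarrow> e * b = b"
    and e_right: "\<And>x. \<forall>b\<in>S. x * b = 0 \<Longrightarrow> x * e = 0"
    and e_left: "\<And>y. \<forall>b\<in>S. \<forall>h k. cinner (op_apply b h) (op_apply y k) = 0 \<Longrightarrow> e * y = 0"
    using range_projection_exists[of S] by metis
  have "e \<in> A"
  proof (rule in_bicommutantI)
    fix t assume t: "\<And>s. s \<in> A \<Longrightarrow> t * s = s * t"
    have "((1 - e) * t) * e = 0"
    proof (rule e_right, rule ballI)
      fix b assume b: "b \<in> S"
      have "(1 - e) * t * b = (1 - e) * b * t" using t b S by (metis mult.assoc subsetD)
      also have "(1 - e) * b = 0" using e(2)[OF b] by (simp add: left_diff_distrib)
      finally show "(1 - e) * t * b = 0" by simp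
    qed
    then have 1: "t * e = e * (t * e)" by (simp add: algebra_simps)
    have "e * (t * (1 - e)) = 0"
    proof (rule e_left, intro ballI allI)
      fix b h k assume b: "b \<in> S"
      \<comment> \<open>The adjoint is taken of \<open>b\<close>: it lies in \<open>A\<close>, hence
        commutes with \<open>t\<close>, and no adjoint of \<open>t\<close> is formed.\<close>
      then obtain b' where b': "b' \<in> A" "is_adjoint b' b" using S adjoint_in by blast
      have "is_adjoint (1 - e) (1 - e)"
        using is_adjoint_one projectionD(3)[OF e(1)] by (rule is_adjoint_diff)
      moreover have "(1 - e) * b = 0" using e(2)[OF b] by (simp add: left_diff_distrib)
      ultimately have "b' * (1 - e) = 0" using adjoint_of_zero_product b'(2) by blast
      then have 0: "b' * (t * (1 - e)) = 0" using t[OF b'(1)] by (metis mult.assoc mult_zero_right)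
      have "cinner (op_apply b h) (op_apply (t * (1 - e)) k)
          = cinner h (op_apply (b' * (t * (1 - e))) k)"
        using is_adjoint_sym[OF b'(2)] by (simp add: is_adjoint_def)
      then show "cinner (op_apply b h) (op_apply (t * (1 - e)) k) = 0" unfolding 0 by simp
    qed
    then show "e * t = t * e" using 1 by (simp add: algebra_simps)
  qed
  then show ?thesis using e e_right by blast
qed

text \<open>Invariance under the adjoint \<open>t'\<close> reads \<open>e t' e = t' e\<close>; its
  adjoint is \<open>e t e = e t\<close>.\<close>

lemma projection_in_Z:
  assumes e: "e \<in> A" "is_projection e" and inv: "\<And>t. t \<in> A \<Longrightarrow> e * (t * e) = t * e"
  shows "e \<in> Z"
proof -
  have "e * t = t * e" if t: "t \<in> A" for t
  proof -
    obtain t' where t': "t' \<in> A" "is_adjoint t' t" using adjoint_in[OF t] by blast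
    have ee: "is_adjoint e e" using e(2) by (rule projectionD)
    have "is_adjoint (e * (t * e)) (e * (t' * e))"
      using is_adjoint_mult[OF is_adjoint_mult[OF ee is_adjoint_sym[OF t'(2)]] ee]
        is_adjoint_mult[OF ee is_adjoint_mult[OF is_adjoint_sym[OF t'(2)] ee]] by (simp add: mult.assoc)
    moreover have "is_adjoint (e * t) (t' * e)"
      using is_adjoint_mult[OF is_adjoint_sym[OF t'(2)] ee] .
    ultimately have "e * (t * e) = e * t"
      using inv[OF t'(1)] is_adjoint_unique by metis
    then show ?thesis using inv[OF t] by simp
  qed
  then show ?thesis using e(1) by (simp add: Z_def)
qed

text \<open>\<open>E\<close> is the range projection of the left ideal \<open>A q\<close>;
  invariance of the ideal under \<open>A\<close> makes it central.\<close>

lemma central_carrier: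
  assumes q: "q \<in> A"
  shows "\<exists>E\<in>Z. is_projection E \<and> E * q = q \<and> (\<forall>x. (\<forall>a\<in>A. x * (a * q) = 0) \<longrightarrow> x * E = 0)"
proof -
  let ?S = "{a * q | a. a \<in> A}"
  have "?S \<subseteq> A" using q by (auto intro: mult_closed)
  from range_projection_in[OF this] obtain E where E: "E \<in> A" "is_projection E"
      "\<forall>b\<in>?S. E * b = b" and right: "\<forall>x. (\<forall>b\<in>?S. x * b = 0) \<longrightarrow> x * E = 0"
    by blast
  have Eq: "E * (a * q) = a * q" if "a \<in> A" for a using E(3) that by blast
  have right': "x * E = 0" if "\<forall>a\<in>A. x * (a * q) = 0" for x using right that by blast
  have "E \<in> Z"
  proof (rule projection_in_Z[OF E(1,2)])
    fix t assume t: "t \<in> A"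
    have "((1 - E) * t) * E = 0"
    proof (rule right', rule ballI)
      fix a assume a: "a \<in> A"
      show "(1 - E) * t * (a * q) = 0"
        using Eq[OF mult_closed[OF t a]] by (simp add: left_diff_distrib mult.assoc)
    qed
    then show "E * (t * E) = t * E" by (simp add: algebra_simps)
  qed
  then show ?thesis using E(2) Eq[OF one_closed] right' by auto
qed

section \<open>A projection such that it and its complement have central carrier 1\<close>

lemma bicommutant_of_element: "b \<in> A \<Longrightarrow> (\<And>T. T * b = b * T \<Longrightarrow> T * e = e * T) \<Longrightarrow> e \<in> A"
  by (rule in_bicommutantI) metis

lemma projection_Z_mult:
  "E \<in> Z \<Longrightarrow> is_projection E \<Longrightarrow> p \<in> A \<Longrightarrow> is_projection p \<Longrightarrow> is_projection (E * p)"
  by (intro projection_mult Z_commute)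

text \<open>If every projection below \<open>F\<close> were central, the binary digits of each
  self-adjoint contraction would become central after multiplication by \<open>F\<close>, and the
  summand \<open>F A\<close> would be commutative.\<close>

lemma noncentral_projection_exists:
  assumes no_I1: "no_I1_central_summand A" and F: "F \<in> Z" "is_projection F" "F \<noteq> 0"
  obtains p where "p \<in> A" "is_projection p" "F * p = p" "p \<notin> Z"
proof -
  have FA: "F \<in> A" using F(1) by (rule Z_in)
  have "\<exists>p\<in>A. is_projection p \<and> F * p = p \<and> p \<notin> Z"
  proof (rule ccontr)
    assume "\<not> ?thesis"
    then have central: "p \<in> Z" if "p \<in> A" "is_projection p" "F * p = p" for p using that by blast
    \<comment> \<open>In this form \<open>a\<close> acts directly on the vectors
      \<open>F x h\<close> and \<open>F h\<close>, so its binary expansion can be inserted on both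
      sides.\<close>
    have comm: "a * (F * x) = x * (a * F)" if a: "a \<in> A" and x: "x \<in> A" for a x
      using a
    proof (induction a rule: self_adjoint_induct)
      case (base b)
      obtain e where e: "\<And>k. is_projection (e k)" "\<And>k T. T * b = b * T \<Longrightarrow> T * e k = e k * T"
        and sums: "\<And>h. (\<lambda>k. (1/2) ^ Suc k *\<^sub>R (2 *\<^sub>R op_apply (e k) h - h)) sums op_apply b h"
        using binary_expansion[OF base(2,3)] by blast
      have eA: "e k \<in> A" for k using base(1) e(2) by (rule bicommutant_of_element)
      have c: "e k * (F * x) = x * (e k * F)" for k
      proof -
        have "F * (F * e k) = F * e k" using projectionD(2)[OF F(2)] .
        then have z: "F * e k \<in> Z"
          using central projection_Z_mult[OF F(1,2) eA e(1)] mult_closed[OF FA eA] by blast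
        have "e k * (F * x) = F * e k * x" using Z_commute[OF F(1) eA] by (metis mult.assoc)
        also have "\<dots> = x * (F * e k)" using z x by (rule Z_commute)
        also have "F * e k = e k * F" using F(1) eA by (rule Z_commute)
        finally show ?thesis .
      qed
      have Fx: "F * x = x * F" using F(1) x by (rule Z_commute)
      show ?case
      proof (rule op_eqI)
        fix h
        have "(\<lambda>k. op_apply x ((1/2) ^ Suc k *\<^sub>R (2 *\<^sub>R op_apply (e k) (op_apply F h) - op_apply F h)))
            sums op_apply x (op_apply b (op_apply F h))"
          by (rule bounded_linear.sums[OF op_bounded_linear sums])
        moreover have "op_apply x ((1/2) ^ Suc k *\<^sub>R (2 *\<^sub>R op_apply (e k) (op_apply F h) - op_apply F h))
            = (1/2) ^ Suc k *\<^sub>R (2 *\<^sub>R op_apply (e k) (op_apply (F * x) h) - op_apply (F * x) h)" for k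
        proof -
          have "op_apply x (op_apply (e k) (op_apply F h)) = op_apply (e k) (op_apply (F * x) h)"
            using c[of k] by (metis op_simps(4))
          moreover have "op_apply x (op_apply F h) = op_apply (F * x) h" unfolding Fx by simp
          ultimately show ?thesis by (simp add: op_linear_simps)
        qed
        ultimately have "op_apply x (op_apply b (op_apply F h)) = op_apply b (op_apply (F * x) h)"
          using sums_unique2 sums[of "op_apply (F * x) h"] by simp
        then show "op_apply (b * (F * x)) h = op_apply (x * (b * F)) h" by simp
      qed
    next
      case (add y z)
      then show ?case by (simp add: distrib_left distrib_right)
    next
      case (scale c y)
      have "scale_op c * y * (F * x) = scale_op c * (x * (y * F))" using scale by (simp add: mult.assoc)
      also have "\<dots> = x * (scale_op c * y * F)" by (metis mult.assoc scale_op_commute)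
      finally show ?case .
    qed
    have "(F * a) * (F * b) = (F * b) * (F * a)" if a: "a \<in> A" and b: "b \<in> A" for a b
    proof -
      have "(F * a) * (F * b) = F * (b * (a * F))" using comm[OF a b] by (simp add: mult.assoc)
      also have "\<dots> = F * (b * (F * a))" using Z_commute[OF F(1) a] by simp
      finally show ?thesis by (simp add: mult.assoc)
    qed
    then show False using no_I1 F unfolding no_I1_central_summand_def center_eq_Z by blast
  qed
  then show ?thesis using that by blast
qed

text \<open>\<open>P\<close> and \<open>E - P\<close> both have central carrier \<open>E\<close>.\<close>

definition full_pair :: "'h bounded_op \<Rightarrow> 'h bounded_op \<Rightarrow> bool" where
  "full_pair E P \<longleftrightarrow> E \<in> Z \<and> is_projection E \<and> P \<in> A \<and> is_projection P \<and> E * P = P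
     \<and> (\<forall>a\<in>A. (\<forall>r\<in>A. a * (r * P) = 0) \<longrightarrow> a * E = 0)
     \<and> (\<forall>a\<in>A. (\<forall>r\<in>A. a * (r * (E - P)) = 0) \<longrightarrow> a * E = 0)"

text \<open>For a noncentral \<open>p\<close> below \<open>F\<close>, let \<open>E = c d\<close>
  with \<open>c\<close> and \<open>d\<close> the central carriers of \<open>p\<close> and
  \<open>F - p\<close>; multiplication by \<open>E\<close> gives both parts carrier
  \<open>E\<close>. If \<open>E\<close> were 0, \<open>c\<close> would annihilate
  \<open>F - p\<close>, so \<open>p = c\<close> would be central.\<close>

lemma full_pair_exists:
  assumes no_I1: "no_I1_central_summand A" and F: "F \<in> Z" "is_projection F" "F \<noteq> 0"
  obtains E P where "full_pair E P" "E \<noteq> 0" "E * F = E"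
proof -
  obtain p where p: "p \<in> A" "is_projection p" "F * p = p" "p \<notin> Z"
    using noncentral_projection_exists[OF assms] by blast
  have FA: "F \<in> A" using F(1) by (rule Z_in)
  have pF: "p * F = p" using Z_commute[OF F(1) p(1)] p(3) by simp
  have FF: "F * F = F" using F(2) by (rule projectionD)
  have qA: "F - p \<in> A" using FA p(1) by (rule diff_closed)
  obtain c where c: "c \<in> Z" "is_projection c" "c * p = p"
    and c_right: "\<forall>x. (\<forall>a\<in>A. x * (a * p) = 0) \<longrightarrow> x * c = 0"
    using central_carrier[OF p(1)] by blast
  obtain d where d: "d \<in> Z" "is_projection d" "d * (F - p) = F - p"
    and d_right: "\<forall>x. (\<forall>a\<in>A. x * (a * (F - p)) = 0) \<longrightarrow> x * d = 0"
    using central_carrier[OF qA] by blast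
  have cd: "c * d = d * c" using c(1) Z_in[OF d(1)] by (rule Z_commute)
  have le: "x * F = x" if x: "x \<in> Z" and w: "F * w = w"
    and right: "\<forall>y. (\<forall>a\<in>A. y * (a * w) = 0) \<longrightarrow> y * x = 0" for x w
  proof -
    have "(1 - F) * x = 0"
    proof (rule right[THEN spec, THEN mp], rule ballI)
      fix a assume a: "a \<in> A"
      have "F * (a * w) = a * w" using Z_commute[OF F(1) a] w by (metis mult.assoc)
      then show "(1 - F) * (a * w) = 0" by (simp add: left_diff_distrib)
    qed
    then show ?thesis using Z_commute[OF x FA] by (simp add: left_diff_distrib)
  qed
  have cF: "c * F = c" using le[OF c(1) p(3) c_right] .
  have "F * (F - p) = F - p" using FF p(3) by (simp add: right_diff_distrib)
  then have dF: "d * F = d" using le[OF d(1) _ d_right] by simp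
  let ?E = "c * d"
  have E: "?E \<in> Z" using c(1) d(1) by (rule Z_mult)
  have Ep: "is_projection ?E" using c(2) d(2) cd by (rule projection_mult)
  have EA: "?E \<in> A" using E by (rule Z_in)
  have EE: "?E * ?E = ?E" using Ep by (rule projectionD)
  have EF: "?E * F = ?E" using dF by (simp add: mult.assoc)
  have key: "a * ?E = 0" if a: "a \<in> A" and w: "w \<in> A" and van: "\<forall>r\<in>A. a * (r * (?E * w)) = 0"
    and x: "?E * x = ?E" and right: "\<forall>y. (\<forall>a\<in>A. y * (a * w) = 0) \<longrightarrow> y * x = 0" for a w x
  proof -
    have "(a * ?E) * x = 0"
    proof (rule right[THEN spec, THEN mp], rule ballI)
      fix r assume r: "r \<in> A"
      show "a * ?E * (r * w) = 0"
        using van r Z_commute[OF E r] by (metis mult.assoc)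
    qed
    then show ?thesis using x by (simp only: mult.assoc)
  qed
  have Ec: "?E * c = ?E" using cd projectionD(1)[OF c(2)] by (metis mult.assoc)
  have Ed: "?E * d = ?E" using projectionD(1)[OF d(2)] by (simp add: mult.assoc)
  have "full_pair ?E (?E * p)"
    unfolding full_pair_def
  proof (intro conjI ballI impI)
    show "?E \<in> Z" by fact
    show "is_projection ?E" by fact
    show "?E * p \<in> A" using EA p(1) by (rule mult_closed)
    show "is_projection (?E * p)" using E Ep p(1,2) by (rule projection_Z_mult)
    show "?E * (?E * p) = ?E * p" using Ep by (rule projectionD)
    show "a * ?E = 0" if "a \<in> A" "\<forall>r\<in>A. a * (r * (?E * p)) = 0" for a
      using key[OF that(1) p(1) that(2) Ec c_right] .
    have "?E - ?E * p = ?E * (F - p)" using EF by (simp add: right_diff_distrib)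
    then show "a * ?E = 0" if "a \<in> A" "\<forall>r\<in>A. a * (r * (?E - ?E * p)) = 0" for a
      using key[OF that(1) qA _ Ed d_right] that(2) by simp
  qed
  moreover have "?E \<noteq> 0"
  proof
    assume 0: "?E = 0"
    have "c * (F - p) = c * (d * (F - p))" using d(3) by simp
    also have "\<dots> = ?E * (F - p)" by (simp only: mult.assoc)
    finally have "c * (F - p) = 0" using 0 by simp
    then have "c = p" using cF c(3) by (simp add: right_diff_distrib)
    then show False using c(1) p(4) by simp
  qed
  ultimately show ?thesis using that EF by blast
qed

text \<open>A maximal family of full pairs with orthogonal first components exhausts 1, since
  \<open>full_pair_exists\<close> would find a further pair below the complement. \<open>P\<close>
  is the joint range projection of the second components.\<close>

lemma full_projection_exists:
  assumes no_I1: "no_I1_central_summand A"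
  obtains P where "full_pair 1 P"
proof -
  let ?F = "{M. (\<forall>(E, P)\<in>M. full_pair E P) \<and> (\<forall>x\<in>M. \<forall>y\<in>M. x \<noteq> y \<longrightarrow> fst x * fst y = 0)}"
  have "\<exists>M\<in>?F. \<forall>X\<in>?F. M \<subseteq> X \<longrightarrow> X = M"
  proof (rule subset_Zorn_nonempty)
    show "?F \<noteq> {}" by blast
    fix \<C> assume ne: "\<C> \<noteq> {}" and chain: "subset.chain ?F \<C>"
    have "fst x * fst y = 0" if xy: "x \<in> \<Union>\<C>" "y \<in> \<Union>\<C>" "x \<noteq> y" for x y
    proof -
      obtain X Y where XY: "X \<in> \<C>" "x \<in> X" "Y \<in> \<C>" "y \<in> Y" using xy by blast
      then have "X \<subseteq> Y \<or> Y \<subseteq> X" using chain by (auto simp: subset_chain_def)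
      then obtain W where "W \<in> \<C>" "x \<in> W" "y \<in> W" using XY by blast
      then show ?thesis using chain xy(3) by (auto simp: subset_chain_def)
    qed
    moreover have "\<forall>(E, P)\<in>\<Union>\<C>. full_pair E P" using chain by (auto simp: subset_chain_def)
    ultimately show "\<Union>\<C> \<in> ?F" by blast
  qed
  then obtain M where M: "M \<in> ?F" and "\<forall>X\<in>?F. M \<subseteq> X \<longrightarrow> X = M" by (rule bexE)
  note max = this(2)[THEN bspec, THEN mp]
  have full: "full_pair (fst x) (snd x)" if "x \<in> M" for x using M that by auto
  have orth: "fst x * fst y = 0" if "x \<in> M" "y \<in> M" "x \<noteq> y" for x y using M that by blast
  have fZ: "fst x \<in> Z" "is_projection (fst x)" "snd x \<in> A" "is_projection (snd x)"
    "fst x * snd x = snd x" if "x \<in> M" for x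
    using full[OF that] by (simp_all add: full_pair_def)
  have snd_fst: "snd x * fst x = snd x" if "x \<in> M" for x
    using Z_commute[OF fZ(1)[OF that] fZ(3)[OF that]] fZ(5)[OF that] by simp
  have "fst ` M \<subseteq> A" using fZ(1) Z_in by blast
  from range_projection_in[OF this] obtain e where e: "e \<in> A" "is_projection e"
      "\<forall>b\<in>fst ` M. e * b = b" and "\<forall>x. (\<forall>b\<in>fst ` M. x * b = 0) \<longrightarrow> x * e = 0"
    by blast
  note e_right = this(4)[THEN spec, THEN mp]
  have eZ: "e \<in> Z"
  proof (rule projection_in_Z[OF e(1,2)])
    fix t assume t: "t \<in> A"
    have "((1 - e) * t) * e = 0"
    proof (rule e_right, rule ballI)
      fix b assume b: "b \<in> fst ` M"
      then have "b \<in> Z" using fZ(1) by blast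
      then have "(1 - e) * t * b = (1 - e) * b * t" using t Z_commute by (metis mult.assoc)
      also have "(1 - e) * b = 0" using bspec[OF e(3) b] by (simp add: left_diff_distrib)
      finally show "(1 - e) * t * b = 0" by simp
    qed
    then show "e * (t * e) = t * e" by (simp add: algebra_simps)
  qed
  have "e = 1"
  proof (rule ccontr)
    assume "e \<noteq> 1"
    then have "1 - e \<noteq> 0" by simp
    moreover have "1 - e \<in> Z" using Z_one eZ by (rule Z_diff)
    moreover have "is_projection (1 - e)" by (rule projection_diff[OF is_projection_one e(2)]) simp_all
    ultimately obtain E P where EP: "full_pair E P" "E \<noteq> 0" "E * (1 - e) = E"
      using full_pair_exists[OF no_I1] by blast
    have EZ: "E \<in> Z" using EP(1) by (simp add: full_pair_def)
    have o: "E * fst y = 0" if "y \<in> M" for y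
    proof -
      have "e * fst y = fst y" using e(3) that by simp
      then have "(1 - e) * fst y = 0" by (simp add: left_diff_distrib)
      then show ?thesis using EP(3) by (metis mult.assoc mult_zero_right)
    qed
    then have "fst y * E = 0" if "y \<in> M" for y
      using Z_commute[OF EZ Z_in[OF fZ(1)[OF that]]] that by simp
    with o have "insert (E, P) M \<in> ?F" using M EP(1) by auto
    \<comment> \<open>By maximality the new pair is already in \<open>M\<close>, so \<open>E\<close>
      is orthogonal to itself.\<close>
    then have "(E, P) \<in> M" using max[of "insert (E, P) M"] by blast
    then have "E * E = 0" using o[of "(E, P)"] by simp
    then show False using EP(1,2) projectionD(1)[of E] by (simp add: full_pair_def)
  qed
  then have total: "x = 0" if "\<And>y. y \<in> M \<Longrightarrow> x * fst y = 0" for x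
    using e_right[of x] that by auto
  have "snd ` M \<subseteq> A" using fZ(3) by blast
  from range_projection_in[OF this] obtain P where P: "P \<in> A" "is_projection P"
      "\<forall>b\<in>snd ` M. P * b = b" and "\<forall>x. (\<forall>b\<in>snd ` M. x * b = 0) \<longrightarrow> x * P = 0"
    by blast
  note P_right = this(4)[THEN spec, THEN mp]
  \<comment> \<open>Each summand recovers its own piece of \<open>P\<close>, because
    \<open>fst x - snd x\<close> annihilates all second components.\<close>
  have comp: "fst x * P = snd x" if x: "x \<in> M" for x
  proof -
    have "(fst x - snd x) * P = 0"
    proof (rule P_right, rule ballI)
      fix b assume "b \<in> snd ` M"
      then obtain y where y: "y \<in> M" "b = snd y" by blast
      show "(fst x - snd x) * b = 0"
      proof (cases "x = y")
        case True
        then show ?thesis using y fZ(5)[OF x] projectionD(1)[OF fZ(4)[OF x]] by (simp add: left_diff_distrib)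
      next
        case False
        have 0: "fst x * snd y = 0"
          using orth[OF x y(1) False] fZ(5)[OF y(1)] by (metis mult.assoc mult_zero_left)
        then have "snd x * snd y = 0" using snd_fst[OF x] by (metis mult.assoc mult_zero_right)
        with 0 show ?thesis using y(2) by (simp add: left_diff_distrib)
      qed
    qed
    then have "fst x * P = snd x * P" by (simp add: left_diff_distrib)
    also have "\<dots> = snd x"
    proof -
      have "is_adjoint (snd x * P) (P * snd x)"
        using projectionD(3)[OF P(2)] projectionD(3)[OF fZ(4)[OF x]] by (rule is_adjoint_mult)
      moreover have "P * snd x = snd x" using P(3) x by blast
      ultimately show ?thesis using projectionD(3)[OF fZ(4)[OF x]] is_adjoint_unique by metis
    qed
    finally show ?thesis .
  qed
  have "full_pair 1 P"
    unfolding full_pair_def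
  proof (intro conjI ballI impI)
    show "1 \<in> Z" by (rule Z_one)
    show "is_projection 1" by (rule is_projection_one)
    show "1 * P = P" by simp
    show "P \<in> A" "is_projection P" by fact+
    fix a assume a: "a \<in> A"
    show "a * 1 = 0" if van: "\<forall>r\<in>A. a * (r * P) = 0"
    proof -
      have "a = 0"
      proof (rule total)
        fix x assume x: "x \<in> M"
        have "a * (r * snd x) = 0" if r: "r \<in> A" for r
          using van[THEN bspec, OF mult_closed[OF r Z_in[OF fZ(1)[OF x]]]]
          by (simp only: mult.assoc comp[OF x])
        then show "a * fst x = 0" using full[OF x] a unfolding full_pair_def by blast
      qed
      then show ?thesis by simp
    qed
    show "a * 1 = 0" if van: "\<forall>r\<in>A. a * (r * (1 - P)) = 0"
    proof -
      have "a = 0"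
      proof (rule total)
        fix x assume x: "x \<in> M"
        have eq: "fst x * (1 - P) = fst x - snd x" using comp[OF x] by (simp add: right_diff_distrib)
        have "a * (r * (fst x - snd x)) = 0" if r: "r \<in> A" for r
          using van[THEN bspec, OF mult_closed[OF r Z_in[OF fZ(1)[OF x]]]]
          by (simp only: mult.assoc eq)
        then show "a * fst x = 0" using full[OF x] a unfolding full_pair_def by blast
      qed
      then show ?thesis by simp
    qed
  qed
  then show ?thesis by (rule that)
qed

text \<open>Expand a self-adjoint contraction \<open>b\<close> in the centre of the corner into
  digits \<open>e k\<close>. Since \<open>e k\<close> commutes with the corner,
  \<open>e k Q = E k Q\<close> for the central carrier \<open>E k\<close> of \<open>e k Q\<close>.
  The series with digits \<open>E k\<close> then has a central sum \<open>L\<close> with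
  \<open>L Q = b\<close>.\<close>

lemma corner_center_lift:
  assumes Q: "Q \<in> A" "is_projection Q"
    and c: "c \<in> corner A Q Q" "\<And>b. b \<in> corner A Q Q \<Longrightarrow> c * b = b * c"
  shows "\<exists>z\<in>Z. z * Q = c"
proof -
  let ?S = "{c \<in> corner A Q Q. \<forall>b\<in>corner A Q Q. c * b = b * c}"
  have QQ: "Q * Q = Q" using Q(2) by (rule projectionD)
  have adj_corner: "y \<in> corner A Q Q" if "x \<in> corner A Q Q" "y \<in> A" "is_adjoint y x" for x y
  proof -
    have qq: "is_adjoint Q Q" using Q(2) by (rule projectionD)
    have "is_adjoint (Q * y) (x * Q)" "is_adjoint (y * Q) (Q * x)"
      using is_adjoint_mult[OF that(3) qq] is_adjoint_mult[OF qq that(3)] by simp_all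
    then have "Q * y = y" "y * Q = y" using that is_adjoint_unique unfolding corner_def by auto
    then show ?thesis using that(2) by (simp add: corner_def)
  qed
  have "c \<in> ?S" using c by blast
  then show ?thesis
  proof (rule self_adjoint_contraction_induct)
    show "\<exists>y\<in>?S. is_adjoint y x" if x: "x \<in> ?S" for x
    proof -
      obtain y where y: "y \<in> A" "is_adjoint y x" using x adjoint_in by (auto simp: corner_def)
      have "y * b = b * y" if b: "b \<in> corner A Q Q" for b
      proof -
        obtain b' where b': "b' \<in> A" "is_adjoint b' b" using b adjoint_in by (auto simp: corner_def)
        have "x * b' = b' * x" using adj_corner[OF b b'] x by blast
        moreover have "is_adjoint (b * y) (x * b')" "is_adjoint (y * b) (b' * x)"
          using is_adjoint_mult[OF y(2) is_adjoint_sym[OF b'(2)]] is_adjoint_mult[OF is_adjoint_sym[OF b'(2)] y(2)] .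
        ultimately show ?thesis using is_adjoint_unique by metis
      qed
      moreover have "y \<in> corner A Q Q" using adj_corner x y by blast
      ultimately show ?thesis using y(2) by blast
    qed
    show "x + y \<in> ?S" if "x \<in> ?S" "y \<in> ?S" for x y
      using that by (auto simp: corner_def distrib_left distrib_right add_closed)
    show "scale_op k * x \<in> ?S" if "x \<in> ?S" for k x
    proof -
      have *: "b * (scale_op k * x) = scale_op k * (b * x)" for b
        by (metis mult.assoc scale_op_commute)
      show ?thesis using that by (auto simp: corner_def mult.assoc scale_closed *)
    qed
    show "\<exists>z\<in>Z. z * Q = x + y" if "\<exists>z\<in>Z. z * Q = x" "\<exists>z\<in>Z. z * Q = y" for x y
      using that Z_add by (metis distrib_right)
    show "\<exists>z\<in>Z. z * Q = scale_op k * x" if "\<exists>z\<in>Z. z * Q = x" for k x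
      using that Z_mult[OF scale_in_Z] by (metis mult.assoc)
    fix b assume b: "b \<in> ?S" "is_adjoint b b" "contraction b"
    then have bA: "b \<in> A" and bQ: "b * Q = b" by (auto simp: corner_def)
    have bcomm: "x * b = b * x" if "x \<in> corner A Q Q" for x using b(1) that by auto
    obtain e where e: "\<And>k. is_projection (e k)" "\<And>k T. T * b = b * T \<Longrightarrow> T * e k = e k * T"
      and sums: "\<And>h. (\<lambda>k. (1/2) ^ Suc k *\<^sub>R (2 *\<^sub>R op_apply (e k) h - h)) sums op_apply b h"
      using binary_expansion[OF b(2,3)] by blast
    have eA: "e k \<in> A" for k using bA e(2) by (rule bicommutant_of_element)
    have "Q \<in> corner A Q Q" using Q(1) QQ by (simp add: corner_def)
    then have Qe: "Q * e k = e k * Q" for k using e(2) bcomm by blast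
    have "\<exists>E. E \<in> Z \<and> is_projection E \<and> E * Q = e k * Q" for k
    proof -
      let ?q = "e k * Q"
      have qA: "?q \<in> A" using eA Q(1) by (rule mult_closed)
      obtain E where E: "E \<in> Z" "is_projection E" "E * ?q = ?q"
        and right: "\<forall>x. (\<forall>a\<in>A. x * (a * ?q) = 0) \<longrightarrow> x * E = 0"
        using central_carrier[OF qA] by blast
      have "(Q - ?q) * E = 0"
      proof (rule right[THEN spec, THEN mp], rule ballI)
        fix a assume a: "a \<in> A"
        have "Q * (a * Q) \<in> corner A Q Q"
          using Q(1) QQ a by (simp add: corner_def mult_closed mult.assoc) (metis mult.assoc)
        then have com: "Q * (a * Q) * e k = e k * (Q * (a * Q))" using e(2) bcomm by blast
        have "(Q - ?q) * (a * ?q) = (1 - e k) * (Q * (a * Q) * e k)"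
          using Qe[of k] by (simp add: left_diff_distrib mult.assoc)
        also have "\<dots> = ((1 - e k) * e k) * (Q * (a * Q))" unfolding com by (simp only: mult.assoc)
        also have "(1 - e k) * e k = 0" using projectionD(1)[OF e(1)] by (simp add: left_diff_distrib)
        finally show "(Q - ?q) * (a * ?q) = 0" by simp
      qed
      then have "E * (Q - ?q) = 0" using Z_commute[OF E(1) diff_closed[OF Q(1) qA]] by simp
      then have "E * Q = ?q" using E(3) by (simp add: right_diff_distrib)
      then show ?thesis using E by blast
    qed
    then obtain E where E: "\<And>k. E k \<in> Z" "\<And>k. is_projection (E k)" "\<And>k. E k * Q = e k * Q" by metis
    define T where "T n = (\<Sum>k<n. scale_op (of_real ((1/2) ^ Suc k)) * (E k + E k - 1))" for n
    have T: "op_apply (T n) h = (\<Sum>k<n. (1/2) ^ Suc k *\<^sub>R (2 *\<^sub>R op_apply (E k) h - h))" for n h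
      unfolding T_def by (induction n) (simp_all add: scaleR_scaleC[of "(1/2) ^ Suc _"] scaleR_2 del: power_Suc)
    have TZ: "T n \<in> Z" for n
      unfolding T_def using E(1) by (induction n) (auto intro!: Z_zero Z_one Z_add Z_mult Z_diff scale_in_Z)
    \<comment> \<open>The \<open>E k\<close> are chosen separately and expand no given operator, so
      convergence of their series needs its own bound; 3 is \<open>2 + 1\<close> from the triangle
      inequality.\<close>
    have term_le: "norm ((1/2) ^ Suc k *\<^sub>R (2 *\<^sub>R op_apply (E k) h - h)) \<le> (1/2) ^ Suc k * (3 * norm h)" for k h
    proof -
      have "norm (2 *\<^sub>R op_apply (E k) h - h) \<le> 3 * norm h"
        using projection_norm_le[OF E(2), of k h] norm_triangle_ineq4[of "2 *\<^sub>R op_apply (E k) h" h] by simp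
      then have "(1/2) ^ Suc k * norm (2 *\<^sub>R op_apply (E k) h - h) \<le> (1/2) ^ Suc k * (3 * norm h)"
        by (intro mult_left_mono) auto
      then show ?thesis by simp
    qed
    have geo: "(\<lambda>k. (1/2) ^ Suc k * (3 * norm h)) sums (3 * norm h)" for h :: 'h
      using sums_mult2[OF power_half_series, of "3 * norm h"] by simp
    have conv: "convergent (\<lambda>n. op_apply (T n) h)" for h
      unfolding T
    proof -
      have "summable (\<lambda>k. (1/2) ^ Suc k *\<^sub>R (2 *\<^sub>R op_apply (E k) h - h))"
        by (rule summable_comparison_test'[OF sums_summable[OF geo[of h]]]) (rule term_le)
      then show "convergent (\<lambda>n. \<Sum>k<n. (1/2) ^ Suc k *\<^sub>R (2 *\<^sub>R op_apply (E k) h - h))"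
        by (simp add: summable_iff_convergent)
    qed
    have bound: "norm (op_apply (T n) h) \<le> 3 * norm h" for n h
    proof -
      have "norm (op_apply (T n) h) \<le> (\<Sum>k<n. (1/2) ^ Suc k * (3 * norm h))"
        unfolding T by (rule sum_norm_le) (rule term_le)
      also have "\<dots> \<le> (\<Sum>k. (1/2) ^ Suc k * (3 * norm h))"
        by (rule sum_le_suminf[OF sums_summable[OF geo]]) auto
      also have "\<dots> = 3 * norm h" using geo by (simp add: sums_iff)
      finally show ?thesis .
    qed
    obtain L where L: "\<And>h. (\<lambda>n. op_apply (T n) h) \<longlonglongrightarrow> op_apply L h"
      using op_limit_exists[OF conv bound] by blast
    have "L \<in> A"
    proof (rule in_bicommutantI)
      fix t assume "\<And>s. s \<in> A \<Longrightarrow> t * s = s * t"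
      then have "T n * t = t * T n" for n using TZ Z_in by metis
      then show "L * t = t * L" using L by (rule pointwise_limit_commutes[rotated])
    qed
    moreover have "L * t = t * L" if "t \<in> A" for t
      using L by (rule pointwise_limit_commutes) (use Z_commute[OF TZ that] in blast)
    ultimately have "L \<in> Z" by (simp add: Z_def)
    moreover have "L * Q = b"
    proof (rule op_eqI)
      fix h
      have "op_apply (T n) (op_apply Q h)
          = (\<Sum>k<n. (1/2) ^ Suc k *\<^sub>R (2 *\<^sub>R op_apply (e k) (op_apply Q h) - op_apply Q h))" for n
        unfolding T using E(3) by (metis op_simps(4))
      then have "(\<lambda>n. op_apply (T n) (op_apply Q h)) \<longlonglongrightarrow> op_apply b (op_apply Q h)"
        using sums[of "op_apply Q h"] by (simp only: sums_def)
      then have "op_apply L (op_apply Q h) = op_apply b (op_apply Q h)"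
        using L LIMSEQ_unique by blast
      then show "op_apply (L * Q) h = op_apply b h" using bQ by (metis op_simps(4))
    qed
    ultimately show "\<exists>z\<in>Z. z * Q = b" by blast
  qed
qed

text \<open>With \<open>y\<close> the adjoint of \<open>z\<close>, centrality makes
  \<open>y z\<close> self-adjoint with square \<open>y z z y = 0\<close>; so \<open>y z = 0\<close>,
  and hence \<open>z = 0\<close>.\<close>

lemma central_nilpotent_zero:
  assumes z: "z \<in> Z" "z * z = 0"
  shows "z = 0"
proof -
  obtain y where y: "y \<in> A" "is_adjoint y z" using adjoint_in Z_in[OF z(1)] by blast
  have "(y * z) * (y * z) = y * (z * z) * y" using Z_commute[OF z(1) y(1)] by (metis mult.assoc)
  then have "(y * z) * (y * z) = 0" using z(2) by simp
  moreover have "is_adjoint (y * z) (y * z)"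
    using is_adjoint_mult[OF is_adjoint_sym[OF y(2)] y(2)]
      is_adjoint_mult[OF y(2) is_adjoint_sym[OF y(2)]] Z_commute[OF z(1) y(1)] by simp
  ultimately have "y * z = 0" using is_adjoint_self_mult_zero by blast
  then show ?thesis using y(2) is_adjoint_self_mult_zero by blast
qed

text \<open>\<open>full_pair\<close> provides cancellation from the right; the rules from the left
  follow by taking adjoints.\<close>

lemma peirce_of_full_pair:
  assumes "full_pair 1 P"
  shows "peirce A P (1 - P)"
proof -
  have P: "P \<in> A" "is_projection P"
    and rP: "\<And>a. a \<in> A \<Longrightarrow> (\<And>r. r \<in> A \<Longrightarrow> a * (r * P) = 0) \<Longrightarrow> a = 0"
    and rQ: "\<And>a. a \<in> A \<Longrightarrow> (\<And>r. r \<in> A \<Longrightarrow> a * (r * (1 - P)) = 0) \<Longrightarrow> a = 0"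
    using assms unfolding full_pair_def mult_1_right by blast+
  have Q: "1 - P \<in> A" "is_projection (1 - P)"
    using P one_closed projection_diff[OF is_projection_one P(2)] by (simp_all add: diff_closed)
  have PP: "P * P = P" using P(2) by (rule projectionD)
  have left: "a = 0" if e: "is_projection e"
    and right: "\<And>a. a \<in> A \<Longrightarrow> (\<And>r. r \<in> A \<Longrightarrow> a * (r * e) = 0) \<Longrightarrow> a = 0"
    and a: "a \<in> A" and van: "\<And>r. r \<in> A \<Longrightarrow> e * (r * a) = 0" for a e
  proof -
    obtain a' where a': "a' \<in> A" "is_adjoint a' a" using adjoint_in[OF a] by blast
    have "a' = 0"
    proof (rule right[OF a'(1)])
      fix r assume "r \<in> A"
      then obtain r' where r': "r' \<in> A" "is_adjoint r' r" using adjoint_in by blast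
      have "is_adjoint (a' * r) (r' * a)"
        using is_adjoint_sym[OF r'(2)] a'(2) by (rule is_adjoint_mult)
      from adjoint_of_zero_product[OF projectionD(3)[OF e] this] van[OF r'(1)]
      show "a' * (r * e) = 0" by (simp add: mult.assoc)
    qed
    then show "a = 0" using a'(2) is_adjoint_self_mult_zero[of a' a] by simp
  qed
  have torsion: "a = 0" if "(\<Sum>i<Suc k. a) = 0" for a :: "'h bounded_op" and k
  proof (rule op_eqI)
    fix h
    have "op_apply (\<Sum>i<n. a) h = real n *\<^sub>R op_apply a h" for n
      by (induction n) (simp_all add: algebra_simps)
    from this[of "Suc k"] that have "real (Suc k) *\<^sub>R op_apply a h = 0" by (simp only: op_simps)
    then show "op_apply a h = op_apply 0 h" by (simp del: of_nat_Suc)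
  qed
  show ?thesis
  proof
    show "P \<in> A" "1 - P \<in> A" by fact+
    show "P + (1 - P) = 1" by simp
    show "P * (1 - P) = 0" "(1 - P) * P = 0" using PP by (simp_all add: right_diff_distrib left_diff_distrib)
    show "a = 0" if "a \<in> A" "\<And>r. r \<in> A \<Longrightarrow> a * (r * P) = 0" for a using rP that by blast
    show "a = 0" if "a \<in> A" "\<And>r. r \<in> A \<Longrightarrow> a * (r * (1 - P)) = 0" for a using rQ that by blast
    show "a = 0" if "a \<in> A" "\<And>r. r \<in> A \<Longrightarrow> P * (r * a) = 0" for a using left[OF P(2) rP that] .
    show "a = 0" if "a \<in> A" "\<And>r. r \<in> A \<Longrightarrow> (1 - P) * (r * a) = 0" for a using left[OF Q(2) rQ that] .
    show "a = 0" if "a \<in> A" "(\<Sum>i<Suc k. a) = 0" for a k using that(2) by (rule torsion)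
    show "z = 0" if "z \<in> Z" "z * z = 0" for z using that by (rule central_nilpotent_zero)
    show "\<exists>z\<in>Z. z * P = c" if "c \<in> corner A P P" "\<And>b. b \<in> corner A P P \<Longrightarrow> c * b = b * c" for c
      using P that by (rule corner_center_lift)
    show "\<exists>z\<in>Z. z * (1 - P) = c"
      if "c \<in> corner A (1 - P) (1 - P)" "\<And>b. b \<in> corner A (1 - P) (1 - P) \<Longrightarrow> c * b = b * c" for c
      using Q that by (rule corner_center_lift)
  qed
qed

end

theorem theorem2p3:
  fixes A :: "'h::complex_hilbert bounded_op set"
    and n :: nat
    and \<phi> :: "'h bounded_op \<Rightarrow> 'h bounded_op"
  assumes "n \<ge> 2"
    and "von_neumann_algebra A"
    and "no_I1_central_summand A"
    and "nonlinear_Lie_n_derivation n A \<phi>"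
  shows "\<exists>d f. additive_derivation A d \<and> f \<in> A \<rightarrow> center A \<and>
           (\<forall>x\<in>A. \<phi> x = d x + f x) \<and>
           (\<forall>x \<in> {1..n} \<rightarrow> A. f (iter_commutator n x) = 0)"
proof -
  interpret vn_algebra A by unfold_locales (rule assms)
  obtain P where "full_pair 1 P" using full_projection_exists[OF assms(3)] by blast
  then interpret peirce A P "1 - P" by (rule peirce_of_full_pair)
  obtain d where d: "additive_derivation A d" "\<And>r. r \<in> A \<Longrightarrow> \<phi> r - d r \<in> Z"
    "\<And>x. x \<in> {1..n} \<rightarrow> A \<Longrightarrow> \<phi> (iter_commutator n x) = d (iter_commutator n x)"
    using nonlinear_Lie_n_derivation_structure[OF assms(1,4)] by blast
  show ?thesis
    by (intro exI[of _ d] exI[of _ "\<lambda>r. \<phi> r - d r"] conjI) (use d center_eq_Z in auto)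
qed

end
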